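(* Let $n\ge1$, let $\Theta\in M_n(\mathbb{R})$ be a skewsymmetric matrix in block normal form which satisfies the Diophantine condition (both described in the context), and let $g$ be a constant metric. Then for all $l,r\in C^\infty(\mathbb{T}^n_\Theta)$, as $t\to0^+$, $$\mathrm{Tr}\big(L(l)R(r)e^{-t\Delta}\big)=\frac{\sqrt g}{(4\pi t)^{n/2}}\sum_{q\in\mathcal{Z}}l_q\,r_{-q}+\text{e.s.t.},$$ where e.s.t. denotes a term that vanishes faster than any power of $t$ as $t\to0^+$.
   Context: Noncommutative torus. $C^\infty(\mathbb{T}^n_\Theta)$ is the $*$-algebra of all $a=(2\pi)^{-n/2}\sum_{k\in\mathbb{Z}^n}a_kU_k$ with $\{a_k\}$ a Schwartz (rapidly decreasing) sequence, where the $U_k$ are unitaries with $U_kU_q=e^{-\frac i2 k\cdot\Theta q}U_{k+q}$, $U_k^*=U_{-k}$ (here $k\cdot\Theta q=\sum_{\mu,\nu}k_\mu\Theta^{\mu\nu}q_\nu$). In the claim, $l_q$ and $r_q$ are the coefficients of $l$ and $r$ in this normalization. $\tau(a):=(2\pi)^{-n/2}a_0$, and $\mathcal{H}_\tau$ is the completion of $C^\infty(\mathbb{T}^n_\Theta)$ for $\langle a,b\rangle=\tau(a^*b)$, so $\{U_k\}$ is an orthonormal basis. $L(a)b=ab$ and $R(a)b=ba$ are the left and right regular representations on $\mathcal{H}_\tau$. $\delta_\mu(U_k)=ik_\mu U_k$. Metric and Laplacian. $g^{\mu\nu}$ is a constant positive definite symmetric matrix with inverse $g_{\mu\nu}$,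 $\sqrt g=\sqrt{\det(g_{\mu\nu})}$, and $\Delta:=-g^{\mu\nu}\delta_\mu\delta_\nu$, i.e. $\Delta U_k=g^{\mu\nu}k_\mu k_\nu U_k$. Block normal form and Diophantine condition. $n=l_0+m_1+m_2$ and $$\Theta=0_{l_0}\ \oplus\bigoplus_{i:\,\theta_i\in2\pi\mathbb{Q}\setminus\{0\}}\theta_i\begin{pmatrix}0&1\\-1&0\end{pmatrix}\ \oplus\bigoplus_{j:\,\theta_j\in\mathbb{R}\setminus2\pi\mathbb{Q}}\theta_j\begin{pmatrix}0&1\\-1&0\end{pmatrix},$$ where $0_{l_0}$ is the zero matrix of size $l_0$, the rational part has total size $m_1$ and the irrational part has total size $m_2$. $\mathcal{Z}:=\{q\in\mathbb{Z}^n:(2\pi)^{-1}\Theta q\in\mathbb{Z}^n\}$. $\mathcal{K}^{\rm inf}$ is the set of nonzero $q\in\mathbb{Z}^n$ whose only nonzero coordinates are among the last $m_2$ ones (so $\mathcal{K}^{\rm inf}\simeq\mathbb{Z}^{m_2}\setminus\{0\}$). The Diophantine condition: there are constants $C>0$, $\beta>0$ such that $\inf_{k\in\mathbb{Z}^n}|\Theta q-2\pi k|\ge C|q|^{-(1+\beta)}$ for all $q\in\mathcal{K}^{\rm inf}$. *)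

theory Defs
  imports
    "Jordan_Normal_Form.Determinant"
    "HOL-Analysis.Infinite_Sum"
    "HOL-Library.Landau_Symbols"
begin

section \<open>Lattice vectors\<close>

text \<open>\<open>\<int>\<^sup>n\<close> is \<^term>\<open>carrier_vec n :: int vec set\<close>, and \<open>M\<^sub>n(\<real>)\<close> is
  \<^term>\<open>carrier_mat n n :: real mat set\<close>; indices run over \<open>0, \<dots>, n - 1\<close>.\<close>

definition real_vec :: "int vec \<Rightarrow> real vec" where
  "real_vec k = map_vec real_of_int k"

definition eucl_norm :: "real vec \<Rightarrow> real" where
  "eucl_norm v = sqrt (v \<bullet> v)"


section \<open>Block normal form and the Diophantine condition\<close>

definition skew_block :: "real \<Rightarrow> real mat" where
  "skew_block \<theta> = mat_of_rows_list 2 [[0, \<theta>], [- \<theta>, 0]]"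

text \<open>\<^term>\<open>\<theta> / (2 * pi) \<in> \<rat>\<close> expresses \<open>\<theta> \<in> 2\<pi>\<rat>\<close>; \<open>m\<^sub>1\<close> and \<open>m\<^sub>2\<close> are sizes, i.e. twice the
  numbers of blocks.\<close>

definition block_normal_form :: "nat \<Rightarrow> nat \<Rightarrow> nat \<Rightarrow> real mat \<Rightarrow> bool" where
  "block_normal_form l\<^sub>0 m\<^sub>1 m\<^sub>2 \<Theta> \<longleftrightarrow>
     (\<exists>rats irrs.
        m\<^sub>1 = 2 * length rats \<and> m\<^sub>2 = 2 * length irrs \<and>
        (\<forall>\<theta>\<in>set rats. \<theta> / (2 * pi) \<in> \<rat> \<and> \<theta> \<noteq> 0) \<and>
        (\<forall>\<theta>\<in>set irrs. \<theta> / (2 * pi) \<notin> \<rat>) \<and>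
        \<Theta> = diag_block_mat (0\<^sub>m l\<^sub>0 l\<^sub>0 # map skew_block rats @ map skew_block irrs))"

definition K_inf :: "nat \<Rightarrow> nat \<Rightarrow> int vec set" where
  "K_inf n m\<^sub>2 = {q \<in> carrier_vec n. q \<noteq> 0\<^sub>v n \<and> (\<forall>i < n - m\<^sub>2. q $ i = 0)}"

definition diophantine :: "nat \<Rightarrow> nat \<Rightarrow> real mat \<Rightarrow> bool" where
  "diophantine n m\<^sub>2 \<Theta> \<longleftrightarrow>
     (\<exists>C>0. \<exists>\<beta>>0. \<forall>q \<in> K_inf n m\<^sub>2.
        (INF k \<in> carrier_vec n. eucl_norm (\<Theta> *\<^sub>v real_vec q - (2 * pi) \<cdot>\<^sub>v real_vec k))
          \<ge> C * eucl_norm (real_vec q) powr (- (1 + \<beta>)))"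

definition Z_lattice :: "nat \<Rightarrow> real mat \<Rightarrow> int vec set" where
  "Z_lattice n \<Theta> =
     {q \<in> carrier_vec n. \<exists>p \<in> carrier_vec n. (1 / (2 * pi)) \<cdot>\<^sub>v (\<Theta> *\<^sub>v real_vec q) = real_vec p}"


section \<open>The noncommutative torus\<close>

text \<open>An element \<open>a = (2\<pi>)\<^bsup>-n/2\<^esup> \<Sum>\<^sub>k a\<^sub>k U\<^sub>k\<close> is represented by its coefficient family
  \<open>k \<mapsto> a\<^sub>k\<close>, extended by \<open>0\<close> to vectors outside \<open>\<int>\<^sup>n\<close>.\<close>

type_synonym coeffs = "int vec \<Rightarrow> complex"

definition nc_norm_factor :: "nat \<Rightarrow> real" where
  "nc_norm_factor n = (2 * pi) powr (- real n / 2)"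

definition smooth_nc_torus :: "nat \<Rightarrow> coeffs set" where
  "smooth_nc_torus n =
     {a. (\<forall>k. k \<notin> carrier_vec n \<longrightarrow> a k = 0) \<and>
         (\<forall>N::nat. \<exists>C. \<forall>k \<in> carrier_vec n. (1 + eucl_norm (real_vec k)) ^ N * norm (a k) \<le> C)}"

definition nc_U :: "nat \<Rightarrow> int vec \<Rightarrow> coeffs" where
  "nc_U n k = (\<lambda>m. if m = k then of_real ((2 * pi) powr (real n / 2)) else 0)"

text \<open>The product determined by \<open>U\<^sub>k U\<^sub>q = exp(-(i/2) k \<cdot> \<Theta>q) U\<^bsub>k+q\<^esub>\<close>: in coefficients a
  twisted convolution, with one factor \<open>(2\<pi>)\<^bsup>-n/2\<^esup>\<close> left over from the normalisation. If one
  argument is smooth and the other square summable, the series converges absolutely, and the same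
  formula gives the continuous extension of left and right multiplication to \<open>H\<^sub>\<tau>\<close>.\<close>

definition nc_mult :: "nat \<Rightarrow> real mat \<Rightarrow> coeffs \<Rightarrow> coeffs \<Rightarrow> coeffs" where
  "nc_mult n \<Theta> a b = (\<lambda>m. if m \<in> carrier_vec n then
     of_real (nc_norm_factor n) *
     (\<Sum>\<^sub>\<infinity>k \<in> carrier_vec n.
        a k * b (m - k) * exp (- (\<i> / 2) * of_real (real_vec k \<bullet> (\<Theta> *\<^sub>v real_vec (m - k)))))
     else 0)"

definition nc_star :: "coeffs \<Rightarrow> coeffs" where
  "nc_star a = (\<lambda>k. cnj (a (- k)))"

definition nc_tau :: "nat \<Rightarrow> coeffs \<Rightarrow> complex" where
  "nc_tau n a = of_real (nc_norm_factor n) * a (0\<^sub>v n)"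

definition nc_delta :: "nat \<Rightarrow> coeffs \<Rightarrow> coeffs" where
  "nc_delta \<mu> a = (\<lambda>k. \<i> * of_int (k $ \<mu>) * a k)"


section \<open>The Hilbert space and operators on it\<close>

text \<open>The completion for \<open>\<langle>a, b\<rangle> = \<tau>(a\<^sup>* b)\<close> is the space of square summable coefficient families;
  lemma \<open>H_inner_eq_tau\<close> below identifies the inner product.\<close>

definition H_space :: "nat \<Rightarrow> coeffs set" where
  "H_space n = {a. (\<forall>k. k \<notin> carrier_vec n \<longrightarrow> a k = 0) \<and>
                   (\<lambda>k. (norm (a k))\<^sup>2) summable_on carrier_vec n}"

definition H_inner :: "nat \<Rightarrow> coeffs \<Rightarrow> coeffs \<Rightarrow> complex" where
  "H_inner n a b = of_real ((nc_norm_factor n)\<^sup>2) * (\<Sum>\<^sub>\<infinity>k \<in> carrier_vec n. cnj (a k) * b k)"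

definition H_norm :: "nat \<Rightarrow> coeffs \<Rightarrow> real" where
  "H_norm n a = sqrt (Re (H_inner n a a))"

definition orthonormal_basis :: "nat \<Rightarrow> coeffs set \<Rightarrow> bool" where
  "orthonormal_basis n E \<longleftrightarrow>
     E \<subseteq> H_space n \<and>
     (\<forall>e\<in>E. \<forall>f\<in>E. H_inner n e f = (if e = f then 1 else 0)) \<and>
     (\<forall>a\<in>H_space n. \<forall>\<epsilon>>0. \<exists>F c. finite F \<and> F \<subseteq> E \<and>
        H_norm n (\<lambda>k. a k - (\<Sum>e\<in>F. c e * e k)) < \<epsilon>)"

definition bounded_operator :: "nat \<Rightarrow> (coeffs \<Rightarrow> coeffs) \<Rightarrow> bool" where
  "bounded_operator n T \<longleftrightarrow>
     (\<forall>a\<in>H_space n. T a \<in> H_space n) \<and>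
     (\<forall>a\<in>H_space n. \<forall>b\<in>H_space n. \<forall>c d. T (\<lambda>k. c * a k + d * b k) = (\<lambda>k. c * T a k + d * T b k)) \<and>
     (\<exists>B. \<forall>a\<in>H_space n. H_norm n (T a) \<le> B * H_norm n a)"

text \<open>The operator trace: \<open>\<Sum>\<^sub>e \<langle>e, T e\<rangle>\<close> converges absolutely for every orthonormal basis, with a
  value independent of the basis. For a bounded operator this property is equivalent to being of
  trace class.\<close>

definition has_trace :: "nat \<Rightarrow> (coeffs \<Rightarrow> coeffs) \<Rightarrow> complex \<Rightarrow> bool" where
  "has_trace n T c \<longleftrightarrow>
     bounded_operator n T \<and>
     (\<forall>E. orthonormal_basis n E \<longrightarrow> ((\<lambda>e. H_inner n e (T e)) has_sum c) E)"

definition trace_class :: "nat \<Rightarrow> (coeffs \<Rightarrow> coeffs) \<Rightarrow> bool" where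
  "trace_class n T \<longleftrightarrow> (\<exists>c. has_trace n T c)"

definition Tr :: "nat \<Rightarrow> (coeffs \<Rightarrow> coeffs) \<Rightarrow> complex" where
  "Tr n T = (THE c. has_trace n T c)"

definition L_rep :: "nat \<Rightarrow> real mat \<Rightarrow> coeffs \<Rightarrow> coeffs \<Rightarrow> coeffs" where
  "L_rep n \<Theta> a b = nc_mult n \<Theta> a b"

definition R_rep :: "nat \<Rightarrow> real mat \<Rightarrow> coeffs \<Rightarrow> coeffs \<Rightarrow> coeffs" where
  "R_rep n \<Theta> a b = nc_mult n \<Theta> b a"


section \<open>Metric, Laplacian and heat semigroup\<close>

definition positive_definite :: "nat \<Rightarrow> real mat \<Rightarrow> bool" where
  "positive_definite n G \<longleftrightarrow> (\<forall>x \<in> carrier_vec n. x \<noteq> 0\<^sub>v n \<longrightarrow> x \<bullet> (G *\<^sub>v x) > 0)"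

text \<open>Here \<open>g\<close> is \<open>(g\<^sub>\<mu>\<^sub>\<nu>)\<close> and \<open>ginv\<close> is \<open>(g\<^bsup>\<mu>\<nu>\<^esup>)\<close>.\<close>

definition constant_metric :: "nat \<Rightarrow> real mat \<Rightarrow> real mat \<Rightarrow> bool" where
  "constant_metric n g ginv \<longleftrightarrow>
     g \<in> carrier_mat n n \<and> ginv \<in> carrier_mat n n \<and>
     transpose_mat ginv = ginv \<and> positive_definite n ginv \<and>
     ginv * g = 1\<^sub>m n \<and> g * ginv = 1\<^sub>m n"

definition nc_laplacian :: "nat \<Rightarrow> real mat \<Rightarrow> coeffs \<Rightarrow> coeffs" where
  "nc_laplacian n ginv a =
     (\<lambda>k. - (\<Sum>\<mu><n. \<Sum>\<nu><n. of_real (ginv $$ (\<mu>, \<nu>)) * nc_delta \<mu> (nc_delta \<nu> a) k))"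

definition laplacian_eigenvalue :: "nat \<Rightarrow> real mat \<Rightarrow> int vec \<Rightarrow> real" where
  "laplacian_eigenvalue n ginv k =
     (\<Sum>\<mu><n. \<Sum>\<nu><n. ginv $$ (\<mu>, \<nu>) * of_int (k $ \<mu>) * of_int (k $ \<nu>))"

text \<open>\<open>e\<^bsup>-t\<Delta>\<^esup>\<close> by functional calculus, \<open>\<Delta>\<close> being diagonal in the basis \<open>(U\<^sub>k)\<close> (lemma
  \<open>nc_laplacian_U\<close>).\<close>

definition heat_op :: "nat \<Rightarrow> real mat \<Rightarrow> real \<Rightarrow> coeffs \<Rightarrow> coeffs" where
  "heat_op n ginv t a = (\<lambda>k. of_real (exp (- t * laplacian_eigenvalue n ginv k)) * a k)"


section \<open>Exponentially small terms\<close>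

definition vanishes_to_all_orders :: "(real \<Rightarrow> complex) \<Rightarrow> bool" where
  "vanishes_to_all_orders E \<longleftrightarrow> (\<forall>N::nat. E \<in> o[at_right 0](\<lambda>t. of_real (t ^ N)))"


section \<open>Consistency of the coefficient model\<close>

lemma nc_norm_factor_inverse: "nc_norm_factor n * (2 * pi) powr (real n / 2) = 1"
  unfolding nc_norm_factor_def by (simp flip: powr_add)

lemma nc_U_mult:
  assumes "k \<in> carrier_vec n" "q \<in> carrier_vec n"
  shows "nc_mult n \<Theta> (nc_U n k) (nc_U n q) =
    (\<lambda>m. exp (- (\<i> / 2) * of_real (real_vec k \<bullet> (\<Theta> *\<^sub>v real_vec q))) * nc_U n (k + q) m)"
proof
  fix m :: "int vec"
  let ?e = "\<lambda>j. exp (- (\<i> / 2) * complex_of_real (real_vec j \<bullet> (\<Theta> *\<^sub>v real_vec (m - j))))"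
  show "nc_mult n \<Theta> (nc_U n k) (nc_U n q) m =
    exp (- (\<i> / 2) * of_real (real_vec k \<bullet> (\<Theta> *\<^sub>v real_vec q))) * nc_U n (k + q) m"
  proof (cases "m \<in> carrier_vec n")
    case True
    have "(\<Sum>\<^sub>\<infinity>j \<in> carrier_vec n. nc_U n k j * nc_U n q (m - j) * ?e j)
        = (\<Sum>\<^sub>\<infinity>j \<in> {k}. nc_U n k j * nc_U n q (m - j) * ?e j)"
      using assms by (intro infsum_cong_neutral) (auto simp: nc_U_def)
    also have "\<dots> = nc_U n k k * nc_U n q (m - k) * ?e k" by simp
    finally have s: "nc_mult n \<Theta> (nc_U n k) (nc_U n q) m =
        of_real (nc_norm_factor n) * (nc_U n k k * nc_U n q (m - k) * ?e k)"
      using True by (simp add: nc_mult_def)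
    have eq: "m - k = q \<longleftrightarrow> m = k + q" using True assms
      by (auto intro!: eq_vecI simp: vec_eq_iff) 
    have f: "complex_of_real (nc_norm_factor n) * complex_of_real ((2 * pi) powr (real n / 2)) = 1"
      by (metis nc_norm_factor_inverse of_real_1 of_real_mult)
    show ?thesis unfolding s
    proof (cases "m = k + q")
      case True
      then have "m - k = q" using eq by simp
      with True show "of_real (nc_norm_factor n) * (nc_U n k k * nc_U n q (m - k) * ?e k) =
        exp (- (\<i> / 2) * of_real (real_vec k \<bullet> (\<Theta> *\<^sub>v real_vec q))) * nc_U n (k + q) m"
        using f by (simp add: nc_U_def mult_ac)
    next
      case False
      then have "m - k \<noteq> q" using eq by simp
      with False show "of_real (nc_norm_factor n) * (nc_U n k k * nc_U n q (m - k) * ?e k) =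
        exp (- (\<i> / 2) * of_real (real_vec k \<bullet> (\<Theta> *\<^sub>v real_vec q))) * nc_U n (k + q) m"
        by (simp add: nc_U_def)
    qed
  next
    case False
    then have "m \<noteq> k + q" using assms by auto
    with False show ?thesis by (simp add: nc_mult_def nc_U_def)
  qed
qed

lemma nc_U_star: "nc_star (nc_U n k) = nc_U n (- k)"
  unfolding nc_star_def nc_U_def by (rule ext) auto

lemma nc_delta_U: "nc_delta \<mu> (nc_U n k) = (\<lambda>m. \<i> * of_int (k $ \<mu>) * nc_U n k m)"
  unfolding nc_delta_def nc_U_def by (rule ext) auto

lemma nc_laplacian_eq:
  "nc_laplacian n ginv a = (\<lambda>k. of_real (laplacian_eigenvalue n ginv k) * a k)"
proof
  fix k
  show "nc_laplacian n ginv a k = of_real (laplacian_eigenvalue n ginv k) * a k"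
    unfolding nc_laplacian_def laplacian_eigenvalue_def nc_delta_def
    by (simp add: sum_distrib_left sum_distrib_right mult_ac complex_i_mult_minus flip: sum_negf)
qed

lemma nc_laplacian_U:
  "nc_laplacian n ginv (nc_U n k) = (\<lambda>m. of_real (laplacian_eigenvalue n ginv k) * nc_U n k m)"
  unfolding nc_laplacian_eq by (rule ext) (auto simp: nc_U_def)

lemma H_inner_eq_tau:
  assumes \<Theta>: "\<Theta> \<in> carrier_mat n n" and skew: "transpose_mat \<Theta> = - \<Theta>"
  shows "H_inner n a b = nc_tau n (nc_mult n \<Theta> (nc_star a) b)"
proof -
  have ph: "real_vec k \<bullet> (\<Theta> *\<^sub>v real_vec (0\<^sub>v n - k)) = 0" if k: "k \<in> carrier_vec n" for k
  proof -
    let ?x = "real_vec k"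
    have x: "?x \<in> carrier_vec n" using k by (simp add: real_vec_def)
    have m: "real_vec (0\<^sub>v n - k) = - ?x" using k by (auto simp: real_vec_def)
    have "?x \<bullet> (\<Theta> *\<^sub>v ?x) = (transpose_mat \<Theta> *\<^sub>v ?x) \<bullet> ?x"
      using transpose_vec_mult_scalar[OF \<Theta> x x] by simp
    also have "\<dots> = - ((\<Theta> *\<^sub>v ?x) \<bullet> ?x)"
      using \<Theta> x unfolding skew by (simp add: uminus_mult_mat_vec)
    also have "\<dots> = - (?x \<bullet> (\<Theta> *\<^sub>v ?x))"
      using \<Theta> x by (metis comm_scalar_prod mult_mat_vec_carrier)
    finally have z: "?x \<bullet> (\<Theta> *\<^sub>v ?x) = 0" by simp
    have "\<Theta> *\<^sub>v (- ?x) = - (\<Theta> *\<^sub>v ?x)"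
      using \<Theta> x by (intro eq_vecI) (auto simp: scalar_prod_uminus_right)
    then show ?thesis using z \<Theta> x unfolding m by (simp add: scalar_prod_uminus_right)
  qed
  have "(\<Sum>\<^sub>\<infinity>k \<in> carrier_vec n. nc_star a k * b (0\<^sub>v n - k) *
          exp (- (\<i> / 2) * complex_of_real (real_vec k \<bullet> (\<Theta> *\<^sub>v real_vec (0\<^sub>v n - k)))))
      = (\<Sum>\<^sub>\<infinity>k \<in> carrier_vec n. cnj (a (- k)) * b (- k))"
    using ph by (intro infsum_cong) (simp add: nc_star_def)
  also have "\<dots> = (\<Sum>\<^sub>\<infinity>k \<in> carrier_vec n. cnj (a k) * b k)"
    by (rule infsum_reindex_bij_betw[of uminus "carrier_vec n" "carrier_vec n"
          "\<lambda>k. cnj (a k) * b k"])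
       (rule bij_betwI[where g = uminus], auto)
  finally show ?thesis
    by (simp add: H_inner_def nc_tau_def nc_mult_def power2_eq_square mult_ac)
qed

lemma H_norm_eq:
  assumes "a \<in> H_space n"
  shows "H_norm n a = nc_norm_factor n * sqrt (\<Sum>\<^sub>\<infinity>k \<in> carrier_vec n. (norm (a k))\<^sup>2)"
proof -
  let ?s = "\<Sum>\<^sub>\<infinity>k \<in> carrier_vec n. (norm (a k))\<^sup>2"
  have "((\<lambda>k. (norm (a k))\<^sup>2) has_sum ?s) (carrier_vec n)"
    using assms by (intro has_sum_infsum) (simp add: H_space_def)
  then have "((\<lambda>k. complex_of_real ((norm (a k))\<^sup>2)) has_sum of_real ?s) (carrier_vec n)"
    by (rule has_sum_of_real)
  moreover have "complex_of_real ((norm (a k))\<^sup>2) = cnj (a k) * a k" for k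
    by (simp only: complex_norm_square mult.commute)
  ultimately have "((\<lambda>k. cnj (a k) * a k) has_sum of_real ?s) (carrier_vec n)" by simp
  then have "H_inner n a a = of_real ((nc_norm_factor n)\<^sup>2 * ?s)"
    unfolding H_inner_def by (simp add: infsumI)
  then show ?thesis
    by (simp add: H_norm_def real_sqrt_mult nc_norm_factor_def)
qed

lemma H_space_restrict:
  assumes "a \<in> H_space n"
  shows "(\<lambda>k. if k \<in> F then 0 else a k) \<in> H_space n"
proof -
  have "(\<lambda>k. (norm (if k \<in> F then 0 else a k))\<^sup>2) summable_on carrier_vec n"
    by (rule summable_on_comparison_test[where f = "\<lambda>k. (norm (a k))\<^sup>2"])
       (use assms in \<open>auto simp: H_space_def\<close>)
  then show ?thesis using assms by (auto simp: H_space_def)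
qed

lemma nc_U_in_H_space: "k \<in> carrier_vec n \<Longrightarrow> nc_U n k \<in> H_space n"
proof -
  assume k: "k \<in> carrier_vec n"
  have "(\<lambda>m. (norm (nc_U n k m))\<^sup>2) summable_on carrier_vec n
      \<longleftrightarrow> (\<lambda>m. (norm (nc_U n k m))\<^sup>2) summable_on {k}"
    using k by (intro summable_on_cong_neutral) (auto simp: nc_U_def)
  then show ?thesis using k by (auto simp: H_space_def nc_U_def)
qed

lemma H_inner_nc_U_left:
  assumes "k \<in> carrier_vec n"
  shows "H_inner n (nc_U n k) a = of_real (nc_norm_factor n) * a k"
proof -
  have "(\<Sum>\<^sub>\<infinity>j \<in> carrier_vec n. cnj (nc_U n k j) * a j) = (\<Sum>\<^sub>\<infinity>j \<in> {k}. cnj (nc_U n k j) * a j)"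
    using assms by (intro infsum_cong_neutral) (auto simp: nc_U_def)
  also have "\<dots> = of_real ((2 * pi) powr (real n / 2)) * a k" by (simp add: nc_U_def)
  finally have "H_inner n (nc_U n k) a =
      of_real (nc_norm_factor n * (nc_norm_factor n * (2 * pi) powr (real n / 2))) * a k"
    unfolding H_inner_def by (simp add: power2_eq_square)
  then show ?thesis by (simp add: nc_norm_factor_inverse)
qed

lemma nc_U_orthonormal:
  assumes "k \<in> carrier_vec n" "q \<in> carrier_vec n"
  shows "H_inner n (nc_U n k) (nc_U n q) = (if k = q then 1 else 0)"
proof -
  have "complex_of_real (nc_norm_factor n) * of_real ((2 * pi) powr (real n / 2)) = 1"
    by (metis nc_norm_factor_inverse of_real_1 of_real_mult)
  then show ?thesis unfolding H_inner_nc_U_left[OF assms(1)] by (auto simp: nc_U_def)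
qed

lemma nc_U_inj: "inj (nc_U n)"
proof (rule injI)
  fix k q assume eq: "nc_U n k = nc_U n q"
  have "nc_U n k k \<noteq> 0" by (simp add: nc_U_def)
  then have "nc_U n q k \<noteq> 0" using eq by simp
  then show "k = q" by (auto simp: nc_U_def split: if_splits)
qed

lemma nc_U_orthonormal_basis: "orthonormal_basis n (nc_U n ` carrier_vec n)"
  unfolding orthonormal_basis_def
proof (intro conjI ballI allI impI)
  show "nc_U n ` carrier_vec n \<subseteq> H_space n" using nc_U_in_H_space by auto
  fix e f assume "e \<in> nc_U n ` carrier_vec n" "f \<in> nc_U n ` carrier_vec n"
  then show "H_inner n e f = (if e = f then 1 else 0)"
    using nc_U_orthonormal nc_U_inj by (auto simp: inj_def)
next
  fix a and \<epsilon> :: real assume a: "a \<in> H_space n" and \<epsilon>: "\<epsilon> > 0"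
  let ?h = "\<lambda>k. (norm (a k))\<^sup>2" and ?A = "carrier_vec n :: int vec set" and ?f = "nc_norm_factor n"
  let ?p = "(2 * pi) powr (real n / 2)"
  have fpos: "?f > 0" by (simp add: nc_norm_factor_def)
  have s: "?h summable_on ?A" using a by (simp add: H_space_def)
  define d where "d = (\<epsilon> / (2 * ?f))\<^sup>2"
  have "d > 0" using \<epsilon> fpos by (simp add: d_def)
  then obtain F where F: "finite F" "F \<subseteq> ?A" "dist (sum ?h F) (infsum ?h ?A) \<le> d"
    using infsum_finite_approximation[OF s] by blast
  let ?b = "\<lambda>k. if k \<in> F then 0 else a k"
  have bH: "?b \<in> H_space n" using a by (rule H_space_restrict)
  have "infsum (\<lambda>k. (norm (?b k))\<^sup>2) ?A = infsum ?h (?A - F)"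
    by (intro infsum_cong_neutral) auto
  also have "\<dots> = infsum ?h ?A - infsum ?h F"
    using F by (intro infsum_Diff s) auto
  also have "\<dots> \<le> d" using F by (simp add: dist_real_def)
  finally have "sqrt (infsum (\<lambda>k. (norm (?b k))\<^sup>2) ?A) \<le> sqrt d" by simp
  also have "sqrt d = \<epsilon> / (2 * ?f)" using \<epsilon> fpos by (simp add: d_def)
  finally have "H_norm n ?b \<le> ?f * (\<epsilon> / (2 * ?f))"
    unfolding H_norm_eq[OF bH] using fpos by (intro mult_left_mono) auto
  then have le: "H_norm n ?b < \<epsilon>" using fpos \<epsilon> by simp
  define c where "c e = a (inv_into UNIV (nc_U n) e) / of_real ?p" for e
  have "(\<lambda>k. a k - (\<Sum>e\<in>nc_U n ` F. c e * e k)) = ?b"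
  proof
    fix k
    have "(\<Sum>e\<in>nc_U n ` F. c e * e k) = (\<Sum>q\<in>F. c (nc_U n q) * nc_U n q k)"
      using nc_U_inj by (subst sum.reindex) (auto intro: inj_on_subset)
    also have "\<dots> = (\<Sum>q\<in>F. if k = q then a q else 0)"
    proof (intro sum.cong refl)
      fix q
      have "c (nc_U n q) = a q / of_real ?p" unfolding c_def using nc_U_inj by (simp add: inv_f_f)
      then show "c (nc_U n q) * nc_U n q k = (if k = q then a q else 0)" by (simp add: nc_U_def)
    qed
    also have "\<dots> = (if k \<in> F then a k else 0)" using F(1) by simp
    finally show "a k - (\<Sum>e\<in>nc_U n ` F. c e * e k) = ?b k" by auto
  qed
  then show "\<exists>F c. finite F \<and> F \<subseteq> nc_U n ` carrier_vec n \<and>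
      H_norm n (\<lambda>k. a k - (\<Sum>e\<in>F. c e * e k)) < \<epsilon>"
    using F le by (intro exI[of _ "nc_U n ` F"] exI[of _ c]) auto
qed

lemma has_trace_unique: "has_trace n T c \<Longrightarrow> has_trace n T d \<Longrightarrow> c = d"
  unfolding has_trace_def using nc_U_orthonormal_basis has_sum_unique by blast

lemma Tr_eqI: "has_trace n T c \<Longrightarrow> Tr n T = c"
  unfolding Tr_def using has_trace_unique by blast

end

theory Submission
  imports Defs "HOL-Probability.Characteristic_Functions"
begin

text \<open>In the basis \<open>U\<^sub>k\<close> the operator has an absolutely summable matrix, so its trace is the sum of
  the diagonal. Since \<open>U\<^sub>p U\<^sub>k U\<^bsub>-p\<^esub> = exp(i k \<cdot> \<Theta>p) U\<^sub>k\<close>, this sum is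
  \<open>(2\<pi>)\<^bsup>-n\<^esup> \<Sum>\<^sub>q l\<^sub>q r\<^bsub>-q\<^esub> \<Sum>\<^sub>k exp(-t \<lambda>\<^sub>k + i k \<cdot> \<Theta>q)\<close>. Poisson summation turns the inner sum into a Gaussian
  sum over the distances \<open>|\<Theta>q - 2\<pi>m|\<^sub>g\<close>, of width \<open>t\<^bsup>1/2\<^esup>\<close>. The terms with \<open>\<Theta>q = 2\<pi>m\<close>
  give the main term. All other distances are at least \<open>c (1 + |q|)\<^bsup>-K\<^esup>\<close>, by the Diophantine
  condition on the irrational blocks and by a common denominator on the rational ones; so these terms
  contribute \<open>O(t\<^sup>N (1 + |q|)\<^bsup>2KN\<^esup>)\<close> for every \<open>N\<close>, which is summable against the rapidly decreasing \<open>l\<close>.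

  The lattice Poisson formula is derived from the one-dimensional one by induction on \<open>n\<close>: summing over
  the first coordinate replaces the quadratic form by its Schur complement.\<close>

text \<open>The metric need not respect the block structure of \<Theta>, so the Gaussian sum does
  not factor into one-dimensional ones: completing the square couples the coordinates through a
  shift. Hence the formula on the line carries two parameters, a shift \<open>b\<close> of the
  summation variable and a frequency \<open>x\<close>. Poisson summation turns the shift into a
  phase, and this phase only moves the frequency of the remaining sum.

  \<open>has_trace\<close> ranges over all orthonormal bases, so summing the diagonal in the basis
  \<open>nc_U\<close> does not suffice. Absolute summability of the whole matrix, combined with
  Parseval's identity in an arbitrary basis, permits the exchange of sums.

  The gap between \<Theta>q and the points 2 pi m may shrink as q grows, so the argument has no
  exponential rate in 1/t common to all q. It trades exponentials for powers, paid for by the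
  Schwartz coefficients.\<close>

unbundle no vec_syntax
no_notation inner (infix "\<bullet>" 70)
hide_type (open) Finite_Cartesian_Product.vec
hide_const (open) Finite_Cartesian_Product.vec Finite_Cartesian_Product.mat
  Finite_Cartesian_Product.row Determinants.det

section \<open>Poisson summation for Gaussians on the line\<close>

lemma cis_int_2pi: "cis (2 * pi * real_of_int m) = 1"
  by (simp add: complex_eq_iff)

lemma periodic_int:
  fixes F :: "real \<Rightarrow> 'a"
  assumes per: "\<And>x. F (x + 2 * pi) = F x"
  shows "F (x + 2 * pi * real_of_int m) = F x"
proof -
  have nat: "F (y + 2 * pi * real k) = F y" for y and k :: nat
  proof (induction k)
    case (Suc k)
    have "F (y + 2 * pi * real (Suc k)) = F ((y + 2 * pi * real k) + 2 * pi)"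
      by (simp add: algebra_simps)
    then show ?case using per Suc by simp
  qed simp
  show ?thesis
  proof (cases "m \<ge> 0")
    case True
    then show ?thesis using nat[of x "nat m"] by simp
  next
    case False
    then show ?thesis using nat[of "x + 2 * pi * real_of_int m" "nat (- m)"] by simp
  qed
qed

text \<open>This turns a periodic function into a function of the point \<open>cis x\<close> of the
  circle, whichever branch of the argument is used to reach it.\<close>

lemma periodic_cis_cong:
  fixes F :: "real \<Rightarrow> 'a"
  assumes per: "\<And>x. F (x + 2 * pi) = F x" and "cis x = cis y"
  shows "F x = F y"
proof -
  have "sin x = sin y \<and> cos x = cos y" using assms(2) by (simp add: complex_eq_iff)
  then obtain m where "x = y + 2 * pi * real_of_int m"
    using sin_cos_eq_iff[of x y] by metis
  then show ?thesis using periodic_int[of F, OF per] by simp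
qed

text \<open>The trigonometric polynomials are the restrictions to the unit circle of real polynomials in
  the plane, so they are uniformly dense in the continuous periodic functions.\<close>

lemma zero_fourier_coefficients_imp_zero:
  fixes F :: "real \<Rightarrow> complex"
  assumes cont: "continuous_on UNIV F" and per: "\<And>x. F (x + 2 * pi) = F x"
    and coeff: "\<And>k::int. ((\<lambda>x. F x * cis (of_int k * x)) has_integral 0) {0..2 * pi}"
  shows "F x = 0"
proof -
  \<comment> \<open>The moments against all characters are kept together because multiplication by
    \<open>cis x\<close> or \<open>cis (- x)\<close> merely shifts \<open>k\<close>; this makes
    \<open>V\<close> stable under trigonometric polynomials.\<close>
  define V where "V = {G. continuous_on UNIV G \<and>
    (\<forall>k::int. ((\<lambda>x. G x * cis (of_int k * x)) has_integral 0) {0..2 * pi})}"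
  have V_comb: "(\<lambda>x. G x * (c * cis x + d * cis (- x))) \<in> V" if "G \<in> V" for G c d
  proof -
    have c: "continuous_on UNIV G"
      and i: "\<And>k::int. ((\<lambda>x. G x * cis (of_int k * x)) has_integral 0) {0..2 * pi}"
      using that by (auto simp: V_def)
    have "((\<lambda>x. G x * (c * cis x + d * cis (- x)) * cis (of_int k * x)) has_integral 0) {0..2 * pi}"
      for k :: int
    proof -
      have "((\<lambda>x. c * (G x * cis (of_int (k + 1) * x)) + d * (G x * cis (of_int (k - 1) * x)))
          has_integral (c * 0 + d * 0)) {0..2 * pi}"
        by (intro has_integral_add has_integral_mult_right i)
      moreover have "c * (G x * cis (of_int (k + 1) * x)) + d * (G x * cis (of_int (k - 1) * x)) =
          G x * (c * cis x + d * cis (- x)) * cis (of_int k * x)" for x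
      proof -
        have "cis (of_int (k + 1) * x) = cis x * cis (of_int k * x)"
          "cis (of_int (k - 1) * x) = cis (- x) * cis (of_int k * x)"
          by (simp_all add: cis_mult algebra_simps)
        then show ?thesis by (simp add: algebra_simps)
      qed
      ultimately show ?thesis by simp
    qed
    moreover have "continuous_on UNIV (\<lambda>x. G x * (c * cis x + d * cis (- x)))"
      by (intro continuous_intros c)
    ultimately show ?thesis by (simp add: V_def)
  qed
  \<comment> \<open>The quantifier over \<open>G\<close> belongs to the induction statement: in the
    product case the hypothesis for the second factor is applied to \<open>G\<close> times the
    first.\<close>
  have V_poly: "\<forall>G\<in>V. (\<lambda>x. G x * of_real (g (cis x))) \<in> V" if "real_polynomial_function g"
    for g :: "complex \<Rightarrow> real"
    using that
  proof induction
    case (linear f)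
    then interpret bounded_linear f .
    \<comment> \<open>On the circle a real linear functional is a combination of cos and sin, hence
      of \<open>cis x\<close> and \<open>cis (- x)\<close>.\<close>
    have eq: "complex_of_real (f (cis x)) = ((f 1 - \<i> * f \<i>) / 2) * cis x + ((f 1 + \<i> * f \<i>) / 2) * cis (- x)" for x
    proof -
      have "cis x = cos x *\<^sub>R 1 + sin x *\<^sub>R \<i>" by (simp add: complex_eq_iff)
      then have "f (cis x) = cos x * f 1 + sin x * f \<i>" by (simp add: add scale)
      then show ?thesis by (simp add: complex_eq_iff field_simps)
    qed
    show ?case unfolding eq using V_comb by blast
  next
    case (const c)
    have "(\<lambda>x. G x * of_real c) \<in> V" if "G \<in> V" for G
    proof -
      have "((\<lambda>x. of_real c * (G x * cis (of_int k * x))) has_integral (of_real c * 0)) {0..2 * pi}"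
        for k :: int
        using that by (intro has_integral_mult_right) (auto simp: V_def)
      then show ?thesis using that by (auto simp: V_def mult_ac intro!: continuous_intros)
    qed
    then show ?case by blast
  next
    case (add f g)
    show ?case
    proof
      fix G assume "G \<in> V"
      then have "(\<lambda>x. G x * of_real (f (cis x))) \<in> V" "(\<lambda>x. G x * of_real (g (cis x))) \<in> V"
        using add by auto
      then show "(\<lambda>x. G x * of_real (f (cis x) + g (cis x))) \<in> V"
        by (auto simp: V_def algebra_simps intro!: continuous_on_add dest: has_integral_add[of _ 0 _ _ 0, simplified])
    qed
  next
    case (mult f g)
    show ?case
    proof
      fix G assume "G \<in> V"
      then have "(\<lambda>x. G x * of_real (f (cis x)) * of_real (g (cis x))) \<in> V"
        using mult by auto
      then show "(\<lambda>x. G x * of_real (f (cis x) * g (cis x))) \<in> V" by (simp add: mult.assoc)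
    qed
  qed
  have FV: "F \<in> V" using cont coeff by (simp add: V_def)
  \<comment> \<open>\<open>F\<close> is carried to the punctured plane as a function of the
    argument. \<open>Arg\<close> jumps across the negative axis and \<open>Arg2pi\<close> across the
    positive one; by periodicity both branches give the same \<open>f\<close>, which is therefore
    continuous at every nonzero point.\<close>
  define f where "f z = F (Arg z)" for z
  have f_cis: "f (cis x) = F x" for x
    unfolding f_def by (rule periodic_cis_cong[where F = F, OF per]) (simp add: cis_Arg)
  have f2: "f z = F (Arg2pi z)" if "z \<noteq> 0" for z
    unfolding f_def
  proof (rule periodic_cis_cong[where F = F, OF per])
    have "cis (Arg2pi z) = sgn z"
      using Arg2pi_eq[of z] that by (simp add: cis_conv_exp sgn_eq field_simps)
    then show "cis (Arg z) = cis (Arg2pi z)" using that by (simp add: cis_Arg)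
  qed
  have isF: "isCont F x" for x using cont by (simp add: continuous_on_eq_continuous_at)
  have cf: "isCont f z" if "z \<noteq> 0" for z
  proof (cases "z \<in> \<real>\<^sub>\<le>\<^sub>0")
    case False
    then show ?thesis unfolding f_def
      using continuous_at_compose[OF continuous_at_Arg[of z], of F] isF by (simp add: o_def)
  next
    case True
    then have "z \<notin> \<real>\<^sub>\<ge>\<^sub>0" using that
      by (auto simp: complex_nonpos_Reals_iff complex_nonneg_Reals_iff complex_eq_iff)
    then have "isCont (\<lambda>z. F (Arg2pi z)) z"
      using continuous_at_compose[OF continuous_at_Arg2pi[of z], of F] isF by (simp add: o_def)
    moreover have "\<forall>\<^sub>F w in nhds z. f w = F (Arg2pi w)"
      using t1_space_nhds[OF that] f2 by (auto elim: eventually_mono)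
    ultimately show ?thesis by (metis isCont_cong)
  qed
  have cfS: "continuous_on (sphere 0 1) f"
    by (rule continuous_at_imp_continuous_on) (auto intro!: cf)
  define J where "J = integral {0..2 * pi} (\<lambda>x. norm (F x))"
  define I where "I = integral {0..2 * pi} (\<lambda>x. (norm (F x))\<^sup>2)"
  have contF: "continuous_on {0..2 * pi} F" using cont continuous_on_subset by blast
  \<comment> \<open>A trigonometric polynomial \<open>h\<close> is chosen within 2 e of the
    conjugate of \<open>F\<close>. As \<open>F * h\<close> has integral 0, the integral of |F|^2 is
    that of \<open>F x * (cnj (F x) - h x)\<close>, at most 2 e times the L1 norm
    \<open>J\<close>.\<close>
  have bound: "I \<le> 2 * e * J" if e: "e > 0" for e
  proof -
    obtain g1 where g1: "real_polynomial_function g1" "\<And>z. z \<in> sphere 0 1 \<Longrightarrow> \<bar>Re (f z) - g1 z\<bar> < e"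
      using Stone_Weierstrass_real_polynomial_function[of "sphere 0 1" "\<lambda>z. Re (f z)" e] cfS e
      by (auto intro: continuous_intros)
    obtain g2 where g2: "real_polynomial_function g2" "\<And>z. z \<in> sphere 0 1 \<Longrightarrow> \<bar>Im (f z) - g2 z\<bar> < e"
      using Stone_Weierstrass_real_polynomial_function[of "sphere 0 1" "\<lambda>z. Im (f z)" e] cfS e
      by (auto intro: continuous_intros)
    define h where "h x = complex_of_real (g1 (cis x)) - \<i> * complex_of_real (g2 (cis x))" for x
    have z: "((\<lambda>x. F x * of_real (g (cis x))) has_integral 0) {0..2 * pi}"
      if "real_polynomial_function g" for g
    proof -
      have "(\<lambda>x. F x * of_real (g (cis x))) \<in> V" using V_poly[OF that] FV by blast
      then have "((\<lambda>x. F x * of_real (g (cis x)) * cis (of_int 0 * x)) has_integral 0) {0..2 * pi}"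
        unfolding V_def by blast
      then show ?thesis by simp
    qed
    have "((\<lambda>x. F x * of_real (g1 (cis x)) - \<i> * (F x * of_real (g2 (cis x)))) has_integral (0 - \<i> * 0)) {0..2 * pi}"
      by (intro has_integral_diff has_integral_mult_right z g1 g2)
    then have h0: "((\<lambda>x. F x * h x) has_integral 0) {0..2 * pi}"
      by (simp add: h_def algebra_simps)
    have hb: "norm (cnj (F x) - h x) \<le> 2 * e" for x
    proof -
      have "\<bar>Re (F x) - g1 (cis x)\<bar> < e" "\<bar>Im (F x) - g2 (cis x)\<bar> < e"
        using g1(2)[of "cis x"] g2(2)[of "cis x"] by (simp_all add: f_cis)
      moreover have "norm (cnj (F x) - h x) \<le> \<bar>Re (cnj (F x) - h x)\<bar> + \<bar>Im (cnj (F x) - h x)\<bar>"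
        by (rule cmod_le)
      ultimately show ?thesis by (simp add: h_def)
    qed
    have sq: "complex_of_real ((norm (F x))\<^sup>2) = F x * (cnj (F x) - h x) + F x * h x" for x
      unfolding complex_norm_square by (simp add: algebra_simps)
    have iI: "((\<lambda>x. (norm (F x))\<^sup>2) has_integral I) {0..2 * pi}"
      unfolding I_def by (intro integrable_integral integrable_continuous_real continuous_intros contF)
    then have "((\<lambda>x. complex_of_real ((norm (F x))\<^sup>2)) has_integral of_real I) {0..2 * pi}"
      using has_integral_of_real by blast
    then have iD: "((\<lambda>x. F x * (cnj (F x) - h x)) has_integral of_real I) {0..2 * pi}"
      using has_integral_diff[OF _ h0] unfolding sq by fastforce
    have iJ: "((\<lambda>x. norm (F x)) has_integral J) {0..2 * pi}"
      unfolding J_def by (intro integrable_integral integrable_continuous_real continuous_intros contF)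
    have "((\<lambda>x. norm (F x) * (2 * e)) has_integral J * (2 * e)) {0..2 * pi}"
      using iJ by (rule has_integral_mult_left)
    moreover have "norm (F x * (cnj (F x) - h x)) \<le> norm (F x) * (2 * e)" for x
      using hb by (simp add: norm_mult mult_left_mono)
    ultimately have "norm (complex_of_real I) \<le> J * (2 * e)"
      using integral_norm_bound_integral[of "\<lambda>x. F x * (cnj (F x) - h x)" "{0..2*pi}"
            "\<lambda>x. norm (F x) * (2 * e)"] iD by (metis (no_types, lifting) has_integral_integrable integral_unique)
    then show ?thesis by (simp add: mult_ac)
  qed
  have "J \<ge> 0" unfolding J_def by (intro integral_nonneg integrable_continuous_real continuous_intros contF) auto
  have "I \<le> 0"
  proof (rule field_le_epsilon)
    fix e :: real assume "e > 0"
    \<comment> \<open>The denominator \<open>J + 1\<close> instead of \<open>J\<close> covers the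
      case J = 0.\<close>
    have "2 * (e / (2 * (J + 1))) * J = e * (J / (J + 1))" using \<open>J \<ge> 0\<close> by (simp add: field_simps)
    also have "\<dots> \<le> e * 1" using \<open>J \<ge> 0\<close> \<open>e > 0\<close> by (intro mult_left_mono) auto
    finally show "I \<le> 0 + e" using bound[of "e / (2 * (J + 1))"] \<open>J \<ge> 0\<close> \<open>e > 0\<close> by simp
  qed
  moreover have "I \<ge> 0" unfolding I_def
    by (intro integral_nonneg integrable_continuous_real continuous_intros contF) auto
  ultimately have "integral {0..2 * pi} (\<lambda>x. (norm (F x))\<^sup>2) = 0" by (simp add: I_def)
  then have "\<forall>x\<in>{0..2 * pi}. (norm (F x))\<^sup>2 = 0"
    by (subst integral_eq_0_iff[symmetric]) (auto intro!: continuous_intros contF)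
  then have z: "F y = 0" if "y \<in> {0..2 * pi}" for y using that by simp
  have "F x = F (Arg2pi (cis x))" using f2[of "cis x"] f_cis[of x] by simp
  also have "\<dots> = 0" using Arg2pi_ge_0[of "cis x"] Arg2pi_lt_2pi[of "cis x"] by (intro z) auto
  finally show ?thesis .
qed

section \<open>Gaussian series over the integers and the Gaussian Fourier transform\<close>

lemma summable_gauss_int:
  fixes c :: real
  assumes "c > 0"
  shows "(\<lambda>m::int. exp (- c * (of_int m)\<^sup>2)) summable_on UNIV"
proof -
  have nat: "(\<lambda>k::nat. exp (- c * (real k)\<^sup>2)) summable_on UNIV"
  proof -
    have s: "summable (\<lambda>k::nat. exp (- c) ^ k)" using assms by (intro summable_geometric) simp
    have le: "norm (exp (- c * (real k)\<^sup>2)) \<le> exp (- c) ^ k" for k :: nat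
    proof -
      have "real k \<le> (real k)\<^sup>2" by (cases k) (auto simp: power2_eq_square)
      then have "- c * (real k)\<^sup>2 \<le> real k * (- c)" using assms by (simp add: mult.commute)
      then show ?thesis by (simp flip: exp_of_nat_mult)
    qed
    have "summable (\<lambda>k::nat. norm (exp (- c * (real k)\<^sup>2)))"
      by (rule summable_comparison_test'[OF s, of 0], unfold real_norm_def abs_idempotent)
         (use le in \<open>unfold real_norm_def\<close>)
    then show ?thesis by (rule norm_summable_imp_summable_on)
  qed
  have "(\<lambda>m::int. exp (- c * (of_int m)\<^sup>2)) summable_on range int"
    using nat by (subst summable_on_reindex) (auto simp: o_def)
  moreover have "(\<lambda>m::int. exp (- c * (of_int m)\<^sup>2)) summable_on range (\<lambda>k. - int k)"
    using nat by (subst summable_on_reindex) (auto simp: o_def inj_def)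
  ultimately have "(\<lambda>m::int. exp (- c * (of_int m)\<^sup>2)) summable_on (range int \<union> range (\<lambda>k. - int k))"
    by (rule summable_on_union)
  moreover have "range int \<union> range (\<lambda>k. - int k) = UNIV"
    by (auto simp: image_iff) (metis int_cases2)
  ultimately show ?thesis by simp
qed

text \<open>From (m + 2 y)^2 >= 0 follows (m + y)^2 >= m^2 / 2 - y^2. Giving up half of the rate
  makes the bound uniform for y in a bounded interval, as the Weierstrass test requires.\<close>

lemma gauss_shift_le:
  fixes c m y :: real
  assumes "c \<ge> 0" "\<bar>y\<bar> \<le> R"
  shows "exp (- c * (m + y)\<^sup>2) \<le> exp (c * R\<^sup>2) * exp (- (c / 2) * m\<^sup>2)"
proof -
  have "y\<^sup>2 \<le> R\<^sup>2" using assms(2) by (simp add: abs_le_square_iff[symmetric])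
  moreover have "0 \<le> (m + 2 * y)\<^sup>2" by simp
  ultimately have "m\<^sup>2 / 2 - R\<^sup>2 \<le> (m + y)\<^sup>2" by (simp add: power2_eq_square algebra_simps)
  then have "c * (m\<^sup>2 / 2 - R\<^sup>2) \<le> c * (m + y)\<^sup>2" using assms(1) by (rule mult_left_mono)
  then show ?thesis by (simp add: algebra_simps flip: exp_add)
qed

lemma summable_gauss_int_shift:
  fixes c y :: real
  assumes "c > 0"
  shows "(\<lambda>m::int. exp (- c * (of_int m + y)\<^sup>2)) summable_on UNIV"
proof -
  have "(\<lambda>m::int. exp (c * \<bar>y\<bar>\<^sup>2) * exp (- (c / 2) * (of_int m)\<^sup>2)) summable_on UNIV"
    using assms by (intro summable_on_cmult_right summable_gauss_int) simp
  then show ?thesis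
    by (rule summable_on_comparison_test) (use assms gauss_shift_le[of c y "\<bar>y\<bar>"] in auto)
qed

text \<open>The substitution y = s x with s^2 = 2 a turns the integrand into sqrt (2 pi) times the
  standard normal density times a character, so the characteristic function of the normal
  distribution gives the value.\<close>

lemma gauss_fourier_transform:
  fixes a u :: real
  assumes a: "a > 0"
  shows "((\<lambda>y. of_real (exp (- y\<^sup>2 / (4 * a))) * cis (- u * y)) has_integral
           of_real (2 * sqrt (pi * a) * exp (- a * u\<^sup>2))) UNIV"
proof -
  define s where "s = sqrt (2 * a)"
  have s: "s > 0" "s\<^sup>2 = 2 * a" using a by (auto simp: s_def)
  define \<psi> where "\<psi> y = complex_of_real (exp (- y\<^sup>2 / (4 * a))) * cis (- u * y)" for y :: real
  define t where "t = - u * s"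
  have int: "integrable lborel (\<lambda>x. std_normal_density x *\<^sub>R iexp (t * x))"
  proof -
    have "integrable std_normal_distribution (\<lambda>x. iexp (t * x))"
      using prob_space.integrable_iexp[OF prob_space_normal_density[of 1 0], of "\<lambda>x. t * x"] by simp
    then show ?thesis
      by (subst (asm) integrable_density) (auto simp: normal_density_nonneg)
  qed
  have "(LINT x|lborel. std_normal_density x *\<^sub>R iexp (t * x)) = char std_normal_distribution t"
    unfolding char_def by (subst integral_density) (auto simp: normal_density_nonneg)
  also have "\<dots> = of_real (exp (- (t\<^sup>2) / 2))" by (simp add: char_std_normal_distribution)
  also have "t\<^sup>2 / 2 = a * u\<^sup>2" by (simp add: t_def power_mult_distrib s)
  then have "- (t\<^sup>2) / 2 = - a * u\<^sup>2" by simp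
  finally have val: "has_bochner_integral lborel (\<lambda>x. std_normal_density x *\<^sub>R iexp (t * x)) (of_real (exp (- a * u\<^sup>2)))"
    using int by (simp add: has_bochner_integral_iff)
  have eq: "std_normal_density x *\<^sub>R iexp (t * x) = (1 / sqrt (2 * pi)) *\<^sub>R \<psi> (0 + s * x)" for x
  proof -
    have "(s * x)\<^sup>2 / (4 * a) = x\<^sup>2 / 2" using a by (simp add: power_mult_distrib s field_simps)
    then show ?thesis
      by (simp add: \<psi>_def std_normal_density_def cis_conv_exp t_def scaleR_conv_of_real mult_ac)
  qed
  have "has_bochner_integral lborel (\<lambda>x. sqrt (2 * pi) *\<^sub>R (std_normal_density x *\<^sub>R iexp (t * x)))
      (sqrt (2 * pi) *\<^sub>R of_real (exp (- a * u\<^sup>2)))"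
    by (intro has_bochner_integral_scaleR_right val)
  moreover have "sqrt (2 * pi) *\<^sub>R (std_normal_density x *\<^sub>R iexp (t * x)) = \<psi> (0 + s * x)" for x
    unfolding eq by simp
  ultimately have "has_bochner_integral lborel (\<lambda>x. \<psi> (0 + s * x)) (sqrt (2 * pi) *\<^sub>R of_real (exp (- a * u\<^sup>2)))"
    by simp
  moreover have "sqrt (2 * pi) *\<^sub>R complex_of_real (exp (- a * u\<^sup>2)) =
      complex_of_real (s * sqrt (2 * pi) * exp (- a * u\<^sup>2)) /\<^sub>R \<bar>s\<bar>"
    using s by (simp add: complex_eq_iff)
  ultimately have "has_bochner_integral lborel (\<lambda>x. \<psi> (0 + s * x))
      (complex_of_real (s * sqrt (2 * pi) * exp (- a * u\<^sup>2)) /\<^sub>R \<bar>s\<bar>)"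
    by simp
  then have "has_bochner_integral lborel \<psi> (of_real (s * sqrt (2 * pi) * exp (- a * u\<^sup>2)))"
    using lborel_has_bochner_integral_real_affine_iff[of s \<psi> "of_real (s * sqrt (2 * pi) * exp (- a * u\<^sup>2))" 0] s
    by simp
  moreover have "s * sqrt (2 * pi) = 2 * sqrt (pi * a)"
  proof -
    have "s * sqrt (2 * pi) = sqrt (2\<^sup>2 * (pi * a))" by (simp add: s_def flip: real_sqrt_mult)
    then show ?thesis by (simp add: real_sqrt_mult)
  qed
  ultimately have "has_bochner_integral lborel \<psi> (of_real (2 * sqrt (pi * a) * exp (- a * u\<^sup>2)))"
    by simp
  then have "integrable lborel \<psi>" "integral\<^sup>L lborel \<psi> = of_real (2 * sqrt (pi * a) * exp (- a * u\<^sup>2))"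
    by (simp_all only: has_bochner_integral_iff)
  then have "(\<psi> has_integral of_real (2 * sqrt (pi * a) * exp (- a * u\<^sup>2))) UNIV"
    using has_integral_integral_lborel[of \<psi>] by simp
  then show ?thesis by (simp add: \<psi>_def[abs_def])
qed

section \<open>Termwise integration, periodization and the Poisson formula\<close>

lemma has_integral_infsum:
  fixes f :: "'i \<Rightarrow> real \<Rightarrow> complex"
  assumes M: "\<And>i x. x \<in> {a..b} \<Longrightarrow> norm (f i x) \<le> M i" "M summable_on A"
    and c: "\<And>i. continuous_on {a..b} (f i)"
    and I: "\<And>i. (f i has_integral I i) {a..b}"
  shows "\<exists>J. ((\<lambda>x. \<Sum>\<^sub>\<infinity>i\<in>A. f i x) has_integral J) {a..b} \<and> (I has_sum J) A"
proof -
  have u: "uniform_limit {a..b} (\<lambda>X x. \<Sum>i\<in>X. f i x) (\<lambda>x. \<Sum>\<^sub>\<infinity>i\<in>A. f i x) (finite_subsets_at_top A)"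
    by (rule Weierstrass_m_test_general) (use M in auto)
  obtain I' J where I': "\<And>X. ((\<lambda>x. \<Sum>i\<in>X. f i x) has_integral I' X) {a..b}"
    and J: "((\<lambda>x. \<Sum>\<^sub>\<infinity>i\<in>A. f i x) has_integral J) {a..b}"
    and lim: "(I' \<longlongrightarrow> J) (finite_subsets_at_top A)"
    by (rule uniform_limit_integral[OF u]) (auto intro!: continuous_on_sum c)
  have "I' X = sum I X" if "finite X" for X
    using I'[of X] has_integral_sum[OF that, of f I "{a..b}"] I has_integral_unique by blast
  then have "\<forall>\<^sub>F X in finite_subsets_at_top A. I' X = sum I X"
    by (intro eventually_finite_subsets_at_top_weakI) auto
  then have "(sum I \<longlongrightarrow> J) (finite_subsets_at_top A)" using lim tendsto_cong by blast
  then show ?thesis using J by (auto simp: has_sum_def)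
qed

lemma continuous_on_infsum:
  fixes f :: "'i \<Rightarrow> real \<Rightarrow> complex"
  assumes M: "\<And>i x. x \<in> S \<Longrightarrow> norm (f i x) \<le> M i" "M summable_on A"
    and c: "\<And>i. continuous_on S (f i)"
  shows "continuous_on S (\<lambda>x. \<Sum>\<^sub>\<infinity>i\<in>A. f i x)"
proof -
  have u: "uniform_limit S (\<lambda>X x. \<Sum>i\<in>X. f i x) (\<lambda>x. \<Sum>\<^sub>\<infinity>i\<in>A. f i x) (finite_subsets_at_top A)"
    by (rule Weierstrass_m_test_general) (use M in auto)
  show ?thesis
    by (rule uniform_limit_theorem[OF _ u]) (auto intro!: always_eventually continuous_on_sum c)
qed

text \<open>The translates of [0, 2 pi] tile the line. A sum that converges over finite subsets may
  be evaluated along any exhausting sequence of them; the one used here tiles symmetric intervals,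
  on which dominated convergence yields the integral over the line.\<close>

lemma has_integral_periodization:
  fixes \<psi> :: "real \<Rightarrow> complex"
  assumes c: "continuous_on UNIV \<psi>" and K: "(\<psi> has_integral K) UNIV"
    and ai: "(\<lambda>x. norm (\<psi> x)) integrable_on UNIV"
    and S: "((\<lambda>m::int. integral {0..2 * pi} (\<lambda>x. \<psi> (x - 2 * pi * of_int m))) has_sum J) UNIV"
  shows "J = K"
proof -
  let ?I = "\<lambda>m::int. integral {0..2 * pi} (\<lambda>x. \<psi> (x - 2 * pi * of_int m))"
  have c': "continuous_on A \<psi>" for A using c continuous_on_subset by blast
  have shift: "?I m = integral {- (2 * pi * of_int m)..2 * pi - 2 * pi * of_int m} \<psi>" for m
    using integral_shift_real_ivl[of "- (2 * pi * of_int m)" "- (2 * pi * of_int m)" "2 * pi - 2 * pi * of_int m" \<psi>] by simp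
  \<comment> \<open>The term for \<open>m\<close> covers the interval from -2 pi m to 2 pi (1 - m).
    The lopsided index range -N + 1, ..., N therefore fills exactly the symmetric interval of radius
    2 pi N.\<close>
  have partial: "sum ?I {- int N + 1..int N} = integral {- (2 * pi * N)..2 * pi * N} \<psi>" for N :: nat
  proof (induction N)
    case (Suc N)
    let ?a = "2 * pi * real N" and ?b = "2 * pi * real (Suc N)"
    have ab: "0 \<le> ?a" "?a \<le> ?b" "- ?b \<le> - ?a" "- ?a \<le> ?a" "- ?b \<le> ?a"
      by (auto simp: mult_left_mono intro: order_trans[of _ 0])
    have int: "\<psi> integrable_on {u..v}" for u v by (intro integrable_continuous_real c')
    have "{- int (Suc N) + 1..int (Suc N)} = insert (- int N) (insert (int N + 1) {- int N + 1..int N})"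
      by auto
    then have "sum ?I {- int (Suc N) + 1..int (Suc N)} = ?I (- int N) + (?I (int N + 1) + sum ?I {- int N + 1..int N})"
      by simp
    also have "?I (- int N) = integral {?a..?b} \<psi>" unfolding shift by (simp add: algebra_simps)
    also have "?I (int N + 1) = integral {- ?b..- ?a} \<psi>" unfolding shift by (simp add: algebra_simps)
    also have "integral {?a..?b} \<psi> + (integral {- ?b..- ?a} \<psi> + sum ?I {- int N + 1..int N})
        = (integral {- ?b..- ?a} \<psi> + integral {- ?a..?a} \<psi>) + integral {?a..?b} \<psi>"
      unfolding Suc by simp
    also have "\<dots> = integral {- ?b..?b} \<psi>"
      unfolding Henstock_Kurzweil_Integration.integral_combine[OF ab(3,4) int]
      by (rule Henstock_Kurzweil_Integration.integral_combine[OF ab(5,2) int])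
    finally show ?case by simp
  qed simp
  have "filterlim (\<lambda>N. {- int N + 1..int N}) (finite_subsets_at_top UNIV) sequentially"
    unfolding filterlim_finite_subsets_at_top
  proof (intro allI impI)
    fix X :: "int set" assume X: "finite X \<and> X \<subseteq> UNIV"
    define N0 where "N0 = (\<Sum>x\<in>X. nat \<bar>x\<bar>) + 1"
    have "X \<subseteq> {- int N + 1..int N}" if "N \<ge> N0" for N
    proof
      fix x assume "x \<in> X"
      then have "nat \<bar>x\<bar> \<le> (\<Sum>x\<in>X. nat \<bar>x\<bar>)" using X by (intro member_le_sum) auto
      then show "x \<in> {- int N + 1..int N}" using that by (auto simp: N0_def)
    qed
    then show "\<forall>\<^sub>F N in sequentially. finite {- int N + 1..int N} \<and> X \<subseteq> {- int N + 1..int N} \<and> {- int N + 1..int N} \<subseteq> UNIV"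
      by (auto simp: eventually_sequentially)
  qed
  then have 1: "(\<lambda>N. integral {- (2 * pi * real N)..2 * pi * real N} \<psi>) \<longlonglongrightarrow> J"
    using S filterlim_compose[of "sum ?I" "nhds J"] unfolding has_sum_def partial[symmetric] by blast
  have 2: "(\<lambda>N. integral UNIV (\<lambda>x. if x \<in> {- (2 * pi * real N)..2 * pi * real N} then \<psi> x else 0)) \<longlonglongrightarrow> integral UNIV \<psi>"
  proof (rule dominated_convergence[OF _ ai])
    fix N :: nat
    show "(\<lambda>x. if x \<in> {- (2 * pi * real N)..2 * pi * real N} then \<psi> x else 0) integrable_on UNIV"
      unfolding integrable_restrict_UNIV by (intro integrable_continuous_real c')
  next
    fix x :: real
    obtain N0 where "\<bar>x\<bar> \<le> real N0" using real_arch_simple by blast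
    have "x \<in> {- (2 * pi * real N)..2 * pi * real N}" if "N \<ge> N0" for N
    proof -
      have "1 * real N \<le> 2 * pi * real N" using pi_ge_two by (intro mult_right_mono) auto
      then show ?thesis using \<open>\<bar>x\<bar> \<le> real N0\<close> that by (auto simp: abs_le_iff)
    qed
    then show "(\<lambda>N. if x \<in> {- (2 * pi * real N)..2 * pi * real N} then \<psi> x else 0) \<longlonglongrightarrow> \<psi> x"
      by (intro tendsto_eventually) (auto simp: eventually_sequentially)
  qed auto
  then have "(\<lambda>N. integral {- (2 * pi * real N)..2 * pi * real N} \<psi>) \<longlonglongrightarrow> K"
    using K unfolding integral_restrict_UNIV by (simp add: integral_unique)
  with 1 show ?thesis using LIMSEQ_unique by blast
qed

text \<open>As functions of \<open>x\<close> both sides are continuous and 2 pi periodic, so it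
  suffices to compare Fourier coefficients: against \<open>cis (j * x)\<close> each side integrates
  to 2 pi exp(-a (b - j)^2), on the left by orthogonality of characters and on the right by
  unfolding to an integral over the line.\<close>

lemma poisson_gauss_line:
  fixes a b x :: real
  assumes a: "a > 0"
  shows summable_gauss_dual: "(\<lambda>m::int. exp (- (x - 2 * pi * of_int m)\<^sup>2 / (4 * a))) summable_on UNIV"
    and "(\<Sum>\<^sub>\<infinity>k::int. of_real (exp (- a * (of_int k + b)\<^sup>2)) * cis (of_int k * x)) =
      of_real (sqrt (pi / a)) *
      (\<Sum>\<^sub>\<infinity>m::int. of_real (exp (- (x - 2 * pi * of_int m)\<^sup>2 / (4 * a))) * cis (- b * (x - 2 * pi * of_int m)))"
proof -
  \<comment> \<open>The rate of the dual Gaussian in the integer variable: (x - 2 pi m)^2 / (4 a) =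
    (pi^2 / a) (m - x / (2 pi))^2.\<close>
  define c where "c = pi\<^sup>2 / a"
  have c: "c > 0" using a by (simp add: c_def)
  define \<phi> where "\<phi> y = complex_of_real (exp (- y\<^sup>2 / (4 * a))) * cis (- b * y)" for y
  have ex: "exp (- (x - 2 * pi * of_int m)\<^sup>2 / (4 * a)) = exp (- c * (of_int m + - x / (2 * pi))\<^sup>2)" for m :: int and x
    using a by (simp add: c_def power2_eq_square field_simps)
  show "(\<lambda>m::int. exp (- (x - 2 * pi * of_int m)\<^sup>2 / (4 * a))) summable_on UNIV"
    unfolding ex using c by (rule summable_gauss_int_shift)
  define F where "F x = (\<Sum>\<^sub>\<infinity>m::int. \<phi> (x - 2 * pi * of_int m))" for x
  define g where "g k x = complex_of_real (exp (- a * (of_int k + b)\<^sup>2)) * cis (of_int k * x)" for k :: int and x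
  define G where "G x = (\<Sum>\<^sub>\<infinity>k::int. g k x)" for x
  \<comment> \<open>Translation by \<open>x\<close> allows a summable majorant of the dual series
    only for bounded \<open>x\<close>, whence the radius \<open>R\<close> and the local proof of
    continuity for \<open>F\<close>; the majorant \<open>MG\<close> of the primal series does not
    involve \<open>x\<close>.\<close>
  define MF where "MF R m = exp (c * (R / (2 * pi))\<^sup>2) * exp (- (c / 2) * (of_int m)\<^sup>2)" for R and m :: int
  have MF: "norm (\<phi> (x - 2 * pi * of_int m)) \<le> MF R m" if "\<bar>x\<bar> \<le> R" for x R m
  proof -
    have "\<bar>- x / (2 * pi)\<bar> \<le> R / (2 * pi)" using that by (simp add: divide_right_mono)
    then show ?thesis using gauss_shift_le[of c "- x / (2 * pi)" "R / (2 * pi)" "of_int m"] c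
      unfolding \<phi>_def norm_mult ex MF_def by simp
  qed
  have MFs: "MF R summable_on UNIV" for R
    unfolding MF_def using c by (intro summable_on_cmult_right summable_gauss_int) simp
  define MG where "MG k = exp (- a * (of_int k + b)\<^sup>2)" for k :: int
  have MG: "norm (g k x) \<le> MG k" for k x by (simp add: g_def MG_def norm_mult)
  have MGs: "MG summable_on UNIV" unfolding MG_def using a by (rule summable_gauss_int_shift)
  have c\<phi>: "continuous_on A (\<lambda>x. \<phi> (x - t))" for A t
    unfolding \<phi>_def using a by (auto intro!: continuous_intros)
  have cg: "continuous_on A (g k)" for A k
    unfolding g_def by (intro continuous_intros)
  have cF: "continuous_on UNIV F"
  proof -
    have "isCont F x" for x
    proof -
      have "continuous_on {- (\<bar>x\<bar> + 1)..\<bar>x\<bar> + 1} F" unfolding F_def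
        by (rule continuous_on_infsum[OF _ MFs[of "\<bar>x\<bar> + 1"]]) (auto intro!: MF c\<phi>)
      moreover have "x \<in> interior {- (\<bar>x\<bar> + 1)..\<bar>x\<bar> + 1}" by auto
      ultimately show ?thesis by (rule continuous_on_interior)
    qed
    then show ?thesis by (simp add: continuous_at_imp_continuous_on)
  qed
  have cG: "continuous_on UNIV G" unfolding G_def
    by (rule continuous_on_infsum[OF MG MGs cg])
  have pF: "F (x + 2 * pi) = F x" for x
    unfolding F_def
    by (rule infsum_reindex_bij_witness[where i = "\<lambda>m. m + 1" and j = "\<lambda>m. m - 1"]) (auto simp: algebra_simps)
  have pG: "G (x + 2 * pi) = G x" for x
  proof -
    have "g k (x + 2 * pi) = g k x" for k
      using cis_int_2pi[of k] by (simp add: g_def distrib_left mult.commute flip: cis_mult)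
    then show ?thesis by (simp add: G_def)
  qed
  have coeffG: "((\<lambda>x. G x * cis (of_int j * x)) has_integral of_real (2 * pi * exp (- a * (b - of_int j)\<^sup>2))) {0..2 * pi}"
    for j :: int
  proof -
    \<comment> \<open>Integrating \<open>cis (of_int (k + j) * x)\<close> over a period leaves only
      the frequency k = -j.\<close>
    define I where "I k = (if k = - j then complex_of_real (2 * pi * exp (- a * (b - of_int j)\<^sup>2)) else 0)" for k
    have I: "((\<lambda>x. g k x * cis (of_int j * x)) has_integral I k) {0..2 * pi}" for k
    proof -
      have eq: "g k x * cis (of_int j * x) = of_real (exp (- a * (of_int k + b)\<^sup>2)) * cis (of_int (k + j) * x)" for x
        by (simp add: g_def cis_mult algebra_simps)
      show ?thesis
      proof (cases "k = - j")
        case True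
        then show ?thesis using has_integral_const_real[of "complex_of_real (exp (- a * (of_int k + b)\<^sup>2))" 0 "2 * pi"]
          unfolding eq by (simp add: I_def scaleR_conv_of_real algebra_simps)
      next
        case False
        define p where "p = real_of_int (k + j)"
        have p: "p \<noteq> 0" using False unfolding p_def of_int_eq_0_iff by presburger
        have "((\<lambda>x. cis (p * x)) has_integral (cis (p * (2 * pi)) / (\<i> * of_real p) - cis (p * 0) / (\<i> * of_real p))) {0..2 * pi}"
        proof (rule fundamental_theorem_of_calculus)
          fix x
          have "((\<lambda>z. exp (\<i> * of_real p * z) / (\<i> * of_real p)) has_field_derivative exp (\<i> * of_real p * of_real x)) (at (of_real x))"
            using p by (auto intro!: derivative_eq_intros)
          from has_vector_derivative_real_field[OF this]
          show "((\<lambda>x. cis (p * x) / (\<i> * of_real p)) has_vector_derivative cis (p * x)) (at x within {0..2*pi})"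
            by (simp add: cis_conv_exp mult.assoc)
        qed simp
        moreover have "cis (p * (2 * pi)) = 1" using cis_int_2pi[of "k + j"] by (simp add: p_def mult.commute)
        ultimately have "((\<lambda>x. cis (p * x)) has_integral 0) {0..2 * pi}" by simp
        then have "((\<lambda>x. of_real (exp (- a * (of_int k + b)\<^sup>2)) * cis (p * x)) has_integral
            of_real (exp (- a * (of_int k + b)\<^sup>2)) * 0) {0..2 * pi}"
          by (rule has_integral_mult_right)
        then show ?thesis using False unfolding eq p_def I_def by simp
      qed
    qed
    have cgj: "continuous_on A (\<lambda>x. g k x * cis (of_int j * x))" for A k
      by (intro continuous_intros cg)
    obtain J where J: "((\<lambda>x. \<Sum>\<^sub>\<infinity>k. g k x * cis (of_int j * x)) has_integral J) {0..2 * pi}" "(I has_sum J) UNIV"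
      using has_integral_infsum[of 0 "2 * pi" "\<lambda>k x. g k x * cis (of_int j * x)" MG UNIV I, OF _ MGs _ I] MG cgj
      by (auto simp: norm_mult)
    have "(I has_sum I (- j)) {- j}" by (rule has_sum_finiteI) auto
    then have "(I has_sum I (- j)) UNIV"
      by (rule has_sum_cong_neutral[THEN iffD1, rotated 3]) (auto simp: I_def)
    then have "J = I (- j)" using J(2) has_sum_unique by blast
    moreover have "(\<Sum>\<^sub>\<infinity>k. g k x * cis (of_int j * x)) = G x * cis (of_int j * x)" for x
      unfolding G_def by (rule infsum_cmult_left')
    ultimately show ?thesis using J(1) by (simp add: I_def)
  qed
  have coeffF: "((\<lambda>x. F x * cis (of_int j * x)) has_integral of_real (2 * sqrt (pi * a) * exp (- a * (b - of_int j)\<^sup>2))) {0..2 * pi}"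
    for j :: int
  proof -
    define \<psi> where "\<psi> y = \<phi> y * cis (of_int j * y)" for y
    have \<psi>: "\<psi> y = of_real (exp (- y\<^sup>2 / (4 * a))) * cis (- (b - of_int j) * y)" for y
      by (simp add: \<psi>_def \<phi>_def cis_mult algebra_simps)
    have K: "(\<psi> has_integral of_real (2 * sqrt (pi * a) * exp (- a * (b - of_int j)\<^sup>2))) UNIV"
      unfolding \<psi> by (rule gauss_fourier_transform[OF a])
    \<comment> \<open>Dropping the phase leaves the Gaussian itself, whose integrability is the case
      u = 0 of the Fourier transform.\<close>
    have n: "norm (\<psi> y) = Re (of_real (exp (- y\<^sup>2 / (4 * a))) * cis (- 0 * y))" for y
      by (simp add: \<psi> norm_mult)
    have ai: "(\<lambda>x. norm (\<psi> x)) integrable_on UNIV"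
      unfolding n using has_integral_Re[OF gauss_fourier_transform[OF a, of 0]] by (auto simp: integrable_on_def)
    have c\<psi>: "continuous_on A (\<lambda>x. \<psi> (x - t))" for A t
      unfolding \<psi>_def by (intro continuous_intros c\<phi>)
    \<comment> \<open>The character \<open>cis (j * x)\<close> does not see translations by 2 pi m,
      so it can be moved inside the periodized function before unfolding.\<close>
    have eq: "\<psi> (x - 2 * pi * of_int m) = \<phi> (x - 2 * pi * of_int m) * cis (of_int j * x)" for x and m :: int
    proof -
      have "cis (of_int j * (x - 2 * pi * of_int m)) = cis (of_int j * x) * cis (2 * pi * of_int (- j * m))"
        by (simp add: cis_mult algebra_simps)
      then show ?thesis by (simp only: \<psi>_def cis_int_2pi mult_1_right)
    qed
    define I where "I m = integral {0..2 * pi} (\<lambda>x. \<psi> (x - 2 * pi * of_int m))" for m :: int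
    have I: "((\<lambda>x. \<psi> (x - 2 * pi * of_int m)) has_integral I m) {0..2 * pi}" for m
      unfolding I_def by (intro integrable_integral integrable_continuous_real c\<psi>)
    obtain J where J: "((\<lambda>x. \<Sum>\<^sub>\<infinity>m. \<psi> (x - 2 * pi * of_int m)) has_integral J) {0..2 * pi}" "(I has_sum J) UNIV"
      using has_integral_infsum[of 0 "2 * pi" "\<lambda>m x. \<psi> (x - 2 * pi * of_int m)" "MF (2 * pi)" UNIV I, OF _ MFs c\<psi> I]
        MF[where R = "2 * pi"]
      by (auto simp: eq norm_mult)
    have "J = of_real (2 * sqrt (pi * a) * exp (- a * (b - of_int j)\<^sup>2))"
      using has_integral_periodization[OF _ K ai, of J] J(2) c\<psi>[of UNIV 0] unfolding I_def by simp
    moreover have "(\<Sum>\<^sub>\<infinity>m. \<psi> (x - 2 * pi * of_int m)) = F x * cis (of_int j * x)" for x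
      unfolding F_def eq by (rule infsum_cmult_left')
    ultimately show ?thesis using J(1) by simp
  qed
  have "G x - of_real (sqrt (pi / a)) * F x = 0"
  proof (rule zero_fourier_coefficients_imp_zero[where F = "\<lambda>x. G x - of_real (sqrt (pi / a)) * F x"])
    show "continuous_on UNIV (\<lambda>x. G x - of_real (sqrt (pi / a)) * F x)"
      by (intro continuous_intros cF cG)
    show "G (x + 2 * pi) - of_real (sqrt (pi / a)) * F (x + 2 * pi) = G x - of_real (sqrt (pi / a)) * F x" for x
      by (simp add: pF pG)
    fix j :: int
    have "sqrt (pi / a) * (2 * sqrt (pi * a)) = 2 * sqrt (pi\<^sup>2)"
      using a by (simp add: power2_eq_square flip: real_sqrt_mult)
    then have sq: "sqrt (pi / a) * (2 * sqrt (pi * a)) = 2 * pi" by simp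
    have "((\<lambda>x. G x * cis (of_int j * x) - of_real (sqrt (pi / a)) * (F x * cis (of_int j * x))) has_integral
        (of_real (2 * pi * exp (- a * (b - of_int j)\<^sup>2)) - of_real (sqrt (pi / a)) * of_real (2 * sqrt (pi * a) * exp (- a * (b - of_int j)\<^sup>2))))
        {0..2 * pi}"
      by (intro has_integral_diff has_integral_mult_right coeffF coeffG)
    moreover have "complex_of_real (2 * pi * exp (- a * (b - of_int j)\<^sup>2)) - of_real (sqrt (pi / a)) * of_real (2 * sqrt (pi * a) * exp (- a * (b - of_int j)\<^sup>2)) = 0"
    proof -
      have "sqrt (pi / a) * (2 * sqrt (pi * a) * exp (- a * (b - of_int j)\<^sup>2)) = 2 * pi * exp (- a * (b - of_int j)\<^sup>2)"
        using sq by (metis mult.assoc)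
      then show ?thesis by (simp only: of_real_mult[symmetric]) simp
    qed
    ultimately show "((\<lambda>x. (G x - of_real (sqrt (pi / a)) * F x) * cis (of_int j * x)) has_integral 0) {0..2 * pi}"
      by (simp add: algebra_simps)
  qed
  then show "(\<Sum>\<^sub>\<infinity>k::int. of_real (exp (- a * (of_int k + b)\<^sup>2)) * cis (of_int k * x)) =
      of_real (sqrt (pi / a)) *
      (\<Sum>\<^sub>\<infinity>m::int. of_real (exp (- (x - 2 * pi * of_int m)\<^sup>2 / (4 * a))) * cis (- b * (x - 2 * pi * of_int m)))"
    by (simp add: G_def F_def g_def \<phi>_def)
qed

section \<open>Poisson summation for Gaussians on a lattice\<close>

lemma real_vec_carrier [simp]: "real_vec k \<in> carrier_vec n \<longleftrightarrow> k \<in> carrier_vec n"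
  by (simp add: real_vec_def)

lemma dim_real_vec [simp]: "dim_vec (real_vec k) = dim_vec k"
  by (simp add: real_vec_def)

lemma index_real_vec [simp]: "i < dim_vec k \<Longrightarrow> real_vec k $ i = of_int (k $ i)"
  by (simp add: real_vec_def)

lemma real_vec_vCons: "real_vec (vCons a v) = vCons (of_int a) (real_vec v)"
  by (rule eq_vecI) (auto simp: vec_index_vCons)

lemma vCons_carrier_cases:
  assumes "v \<in> carrier_vec (Suc n)"
  obtains a w where "v = vCons a w" "w \<in> carrier_vec n"
  using assms by (cases v) auto

lemma bij_betw_vCons: "bij_betw (\<lambda>(v, a). vCons a v) (carrier_vec n \<times> UNIV) (carrier_vec (Suc n))"
  unfolding bij_betw_def
  by (auto simp: inj_on_def image_iff elim!: vCons_carrier_cases)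

lemma vCons_minus:
  "vCons (a::'a::ab_group_add) v - vCons b w = vCons (a - b) (v - w)" if "dim_vec v = dim_vec w"
  using that by (intro eq_vecI) (auto simp: vec_index_vCons)

lemma smult_vCons: "c \<cdot>\<^sub>v vCons a v = vCons (c * a) (c \<cdot>\<^sub>v v)"
  by (rule eq_vecI) (auto simp: vec_index_vCons)

section \<open>Schur complement of the leading entry of a positive definite matrix\<close>

locale schur_complement =
  fixes n :: nat and A :: "real mat"
  assumes A: "A \<in> carrier_mat (Suc n) (Suc n)" and sym: "transpose_mat A = A"
    and pos: "positive_definite (Suc n) A"
begin

text \<open>\<open>A\<close> is read as a block matrix with rows (a, b^T) and (b, D); then
  \<open>S\<close> is D - b b^T / a.\<close>

definition a where "a = A $$ (0, 0)"
definition b where "b = Matrix.vec n (\<lambda>j. A $$ (0, Suc j))"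
definition D where "D = mat n n (\<lambda>(i, j). A $$ (Suc i, Suc j))"
definition S where "S = mat n n (\<lambda>(i, j). A $$ (Suc i, Suc j) - b $ i * b $ j / a)"

lemma b [simp]: "b \<in> carrier_vec n" by (simp add: b_def)
lemma D [simp]: "D \<in> carrier_mat n n" by (simp add: D_def)
lemma S [simp]: "S \<in> carrier_mat n n" by (simp add: S_def)
lemma dims [simp]: "dim_vec b = n" "dim_row D = n" "dim_col D = n" "dim_row S = n" "dim_col S = n"
  by (simp_all add: b_def D_def S_def)

lemma A_index_sym: "i < Suc n \<Longrightarrow> j < Suc n \<Longrightarrow> A $$ (i, j) = A $$ (j, i)"
  using A sym by (metis carrier_matD index_transpose_mat(1))

lemma A_mult:
  assumes w: "w \<in> carrier_vec n"
  shows "A *\<^sub>v vCons v0 w = vCons (a * v0 + b \<bullet> w) (v0 \<cdot>\<^sub>v b + D *\<^sub>v w)"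
proof (rule eq_vecI)
  show "dim_vec (A *\<^sub>v vCons v0 w) = dim_vec (vCons (a * v0 + b \<bullet> w) (v0 \<cdot>\<^sub>v b + D *\<^sub>v w))"
    using A by simp
  fix i assume "i < dim_vec (vCons (a * v0 + b \<bullet> w) (v0 \<cdot>\<^sub>v b + D *\<^sub>v w))"
  then have i: "i < Suc n" by simp
  show "(A *\<^sub>v vCons v0 w) $ i = vCons (a * v0 + b \<bullet> w) (v0 \<cdot>\<^sub>v b + D *\<^sub>v w) $ i"
  proof (cases i)
    case 0
    have "row A 0 = vCons a b" using A
      by (intro eq_vecI) (auto simp: a_def b_def vec_index_vCons)
    then show ?thesis using 0 A by simp
  next
    case (Suc j)
    have "row A (Suc j) = vCons (b $ j) (row D j)" using A Suc i
      by (intro eq_vecI) (auto simp: b_def D_def vec_index_vCons A_index_sym[of "Suc j" 0])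
    then show ?thesis using Suc i A w by (simp add: mult.commute)
  qed
qed

lemma S_mult:
  assumes w: "w \<in> carrier_vec n"
  shows "S *\<^sub>v w = D *\<^sub>v w - ((b \<bullet> w) / a) \<cdot>\<^sub>v b"
proof (rule eq_vecI)
  fix i assume "i < dim_vec (D *\<^sub>v w - ((b \<bullet> w) / a) \<cdot>\<^sub>v b)"
  then have i: "i < n" by simp
  have "row S i = row D i - (b $ i / a) \<cdot>\<^sub>v b"
    using i by (intro eq_vecI) (auto simp: S_def D_def)
  then have "row S i \<bullet> w = row D i \<bullet> w - (b $ i / a) * (b \<bullet> w)"
    using w i by (simp add: minus_scalar_prod_distrib[of _ n] row_carrier_vec[of _ n])
  then show "(S *\<^sub>v w) $ i = (D *\<^sub>v w - ((b \<bullet> w) / a) \<cdot>\<^sub>v b) $ i"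
    using i by (simp add: mult.commute)
qed simp

lemma a_pos: "a > 0"
proof -
  have "vCons 1 (0\<^sub>v n) \<noteq> (0\<^sub>v (Suc n) :: real vec)" by (simp add: zero_vec_Suc)
  then have "vCons 1 (0\<^sub>v n) \<bullet> (A *\<^sub>v vCons 1 (0\<^sub>v n)) > 0"
    using pos unfolding positive_definite_def by auto
  moreover have "b \<bullet> 0\<^sub>v n = 0" "0\<^sub>v n \<bullet> (b + D *\<^sub>v 0\<^sub>v n) = 0"
    by (auto intro!: scalar_prod_right_zero scalar_prod_left_zero add_carrier_vec mult_mat_vec_carrier[of _ n n])
  ultimately show ?thesis by (simp add: A_mult)
qed

lemma form_S: "w \<in> carrier_vec n \<Longrightarrow> w \<bullet> (S *\<^sub>v w) = w \<bullet> (D *\<^sub>v w) - (b \<bullet> w)\<^sup>2 / a"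
  by (simp add: S_mult scalar_prod_minus_distrib[of _ n] mult_mat_vec_carrier[of _ n n] comm_scalar_prod[of w n b]
      power2_eq_square)

text \<open>Completing the square in the first coordinate. The shift (b . w) / a is what becomes the
  parameter \<open>b\<close> of the one-dimensional Poisson formula.\<close>

lemma form_A:
  assumes w: "w \<in> carrier_vec n"
  shows "vCons v0 w \<bullet> (A *\<^sub>v vCons v0 w) = a * (v0 + (b \<bullet> w) / a)\<^sup>2 + w \<bullet> (S *\<^sub>v w)"
proof -
  have "vCons v0 w \<bullet> (A *\<^sub>v vCons v0 w) = v0 * (a * v0 + b \<bullet> w) + (v0 * (b \<bullet> w) + w \<bullet> (D *\<^sub>v w))"
    using w by (simp add: A_mult scalar_prod_add_distrib[of _ n] mult_mat_vec_carrier[of _ n n] comm_scalar_prod[of w n b])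
  also have "\<dots> = a * (v0 + (b \<bullet> w) / a)\<^sup>2 + w \<bullet> (S *\<^sub>v w)"
    using a_pos by (simp add: form_S[OF w] power2_eq_square field_simps)
  finally show ?thesis .
qed

lemma S_sym: "transpose_mat S = S"
proof (rule eq_matI)
  fix i j assume "i < dim_row S" "j < dim_col S"
  then show "transpose_mat S $$ (i, j) = S $$ (i, j)"
    using A_index_sym[of "Suc i" "Suc j"] by (simp add: S_def)
qed simp_all

text \<open>The form of \<open>S\<close> at \<open>w\<close> is that of \<open>A\<close> at the
  vector whose first coordinate -(b . w) / a makes the completed square vanish.\<close>

lemma S_pos: "positive_definite n S"
  unfolding positive_definite_def
proof (intro ballI impI)
  fix w :: "real vec" assume w: "w \<in> carrier_vec n" and "w \<noteq> 0\<^sub>v n"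
  then have "vCons (- (b \<bullet> w) / a) w \<noteq> 0\<^sub>v (Suc n)" by (simp add: zero_vec_Suc)
  then have "vCons (- (b \<bullet> w) / a) w \<bullet> (A *\<^sub>v vCons (- (b \<bullet> w) / a) w) > 0"
    using pos w unfolding positive_definite_def by simp
  then show "w \<bullet> (S *\<^sub>v w) > 0" using w by (simp add: form_A)
qed

text \<open>Block elimination: \<open>A\<close> is a unipotent lower triangular matrix times an
  upper block triangular one with diagonal blocks \<open>a\<close> and \<open>S\<close>.\<close>

lemma det_A: "Determinant.det A = a * Determinant.det S"
proof -
  define Lo where "Lo = four_block_mat (1\<^sub>m 1) (0\<^sub>m 1 n) (mat n 1 (\<lambda>(i, _). b $ i / a)) (1\<^sub>m n)"
  define Up where "Up = four_block_mat (mat 1 1 (\<lambda>_. a)) (mat 1 n (\<lambda>(_, j). b $ j)) (0\<^sub>m n 1) S"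
  have "Lo * Up = four_block_mat (mat 1 1 (\<lambda>_. a)) (mat 1 n (\<lambda>(_, j). b $ j))
      (mat n 1 (\<lambda>(i, _). b $ i)) (mat n n (\<lambda>(i, j). b $ i * b $ j / a) + S)"
    unfolding Lo_def Up_def using a_pos
    by (subst mult_four_block_mat[of _ 1 1 _ n _ n _ _ 1 _ n])
       (auto intro!: arg_cong4[of _ _ _ _ _ _ _ _ four_block_mat] eq_matI simp: scalar_prod_def one_smult_vec)
  also have "\<dots> = A"
  proof (rule eq_matI)
    fix i j assume "i < dim_row A" "j < dim_col A"
    then have "i < Suc n" "j < Suc n" using A by auto
    then show "four_block_mat (mat 1 1 (\<lambda>_. a)) (mat 1 n (\<lambda>(_, j). b $ j))
      (mat n 1 (\<lambda>(i, _). b $ i)) (mat n n (\<lambda>(i, j). b $ i * b $ j / a) + S) $$ (i, j) = A $$ (i, j)"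
      by (cases i; cases j) (simp_all add: a_def b_def S_def A_index_sym[of "Suc _" 0])
  qed (use A in auto)
  finally have "A = Lo * Up" by simp
  moreover have "Lo \<in> carrier_mat (Suc n) (Suc n)" "Up \<in> carrier_mat (Suc n) (Suc n)"
    unfolding Lo_def Up_def by (auto intro!: four_block_carrier_mat[of _ 1 1 _ n, simplified])
  ultimately have "Determinant.det A = Determinant.det Lo * Determinant.det Up"
    by (simp add: Determinant.det_mult)
  also have "Determinant.det Lo = 1" unfolding Lo_def
    by (subst det_four_block_mat_upper_right_zero[of _ 1 _ n]) auto
  also have "Determinant.det Up = a * Determinant.det S" unfolding Up_def
    by (subst det_four_block_mat_lower_left_zero[of _ 1 _ n]) (auto simp: det_single)
  finally show ?thesis by simp
qed

context
  fixes B :: "real mat"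
  assumes B: "B \<in> carrier_mat (Suc n) (Suc n)"
    and AB: "\<And>v. v \<in> carrier_vec (Suc n) \<Longrightarrow> A *\<^sub>v (B *\<^sub>v v) = v"
    and BA: "\<And>v. v \<in> carrier_vec (Suc n) \<Longrightarrow> B *\<^sub>v (A *\<^sub>v v) = v"
begin

text \<open>The lower right block of the inverse \<open>B\<close> of \<open>A\<close>; by block
  inversion it is the inverse of \<open>S\<close>.\<close>

definition T where "T = mat n n (\<lambda>(i, j). B $$ (Suc i, Suc j))"

lemma T [simp]: "T \<in> carrier_mat n n" by (simp add: T_def)

lemma B_mult_zero:
  assumes z: "z \<in> carrier_vec n"
  obtains v0 where "B *\<^sub>v vCons 0 z = vCons v0 (T *\<^sub>v z)"
proof -
  have "B *\<^sub>v vCons 0 z = vCons ((B *\<^sub>v vCons 0 z) $ 0) (T *\<^sub>v z)"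
  proof (rule eq_vecI)
    show "dim_vec (B *\<^sub>v vCons 0 z) = dim_vec (vCons ((B *\<^sub>v vCons 0 z) $ 0) (T *\<^sub>v z))"
      using B by (simp add: T_def)
    fix i assume "i < dim_vec (vCons ((B *\<^sub>v vCons 0 z) $ 0) (T *\<^sub>v z))"
    then have i: "i < Suc n" by (simp add: T_def)
    show "(B *\<^sub>v vCons 0 z) $ i = vCons ((B *\<^sub>v vCons 0 z) $ 0) (T *\<^sub>v z) $ i"
    proof (cases i)
      case (Suc j)
      have "row B (Suc j) = vCons (B $$ (Suc j, 0)) (row T j)"
        using B Suc i by (intro eq_vecI) (auto simp: T_def vec_index_vCons)
      then show ?thesis using Suc i B by (simp add: T_def)
    qed simp
  qed
  then show ?thesis by (rule that)
qed

text \<open>With first coordinate -(b . w) / a, \<open>A\<close> sends the extended vector to (0, S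
  w). Applying \<open>B\<close> and reading off the tail recovers \<open>w\<close>.\<close>

lemma T_S:
  assumes w: "w \<in> carrier_vec n"
  shows "T *\<^sub>v (S *\<^sub>v w) = w"
proof -
  have Sw: "S *\<^sub>v w \<in> carrier_vec n" using w by (simp add: mult_mat_vec_carrier[of _ n n])
  obtain v0 where v0: "B *\<^sub>v vCons 0 (S *\<^sub>v w) = vCons v0 (T *\<^sub>v (S *\<^sub>v w))"
    using B_mult_zero[OF Sw] .
  have "(- (b \<bullet> w) / a) \<cdot>\<^sub>v b + D *\<^sub>v w = S *\<^sub>v w"
    unfolding S_mult[OF w] using w by (intro eq_vecI) (auto simp: algebra_simps)
  then have "A *\<^sub>v vCons (- (b \<bullet> w) / a) w = vCons 0 (S *\<^sub>v w)"
    using a_pos by (simp add: A_mult[OF w])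
  then have "B *\<^sub>v vCons 0 (S *\<^sub>v w) = vCons (- (b \<bullet> w) / a) w"
    using BA[of "vCons (- (b \<bullet> w) / a) w"] w by simp
  with v0 show ?thesis by simp
qed

lemma S_T:
  assumes z: "z \<in> carrier_vec n"
  shows "S *\<^sub>v (T *\<^sub>v z) = z"
proof -
  have Tz: "T *\<^sub>v z \<in> carrier_vec n" using z by (simp add: mult_mat_vec_carrier[of _ n n])
  obtain v0 where v0: "B *\<^sub>v vCons 0 z = vCons v0 (T *\<^sub>v z)"
    using B_mult_zero[OF z] .
  have "A *\<^sub>v vCons v0 (T *\<^sub>v z) = vCons 0 z"
    using AB[of "vCons 0 z"] z unfolding v0 by simp
  then have *: "a * v0 + b \<bullet> (T *\<^sub>v z) = 0" "v0 \<cdot>\<^sub>v b + D *\<^sub>v (T *\<^sub>v z) = z"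
    by (simp_all add: A_mult[OF Tz])
  have "- ((b \<bullet> (T *\<^sub>v z)) / a) = v0" using *(1) a_pos by (simp add: field_simps)
  have "S *\<^sub>v (T *\<^sub>v z) = (- ((b \<bullet> (T *\<^sub>v z)) / a)) \<cdot>\<^sub>v b + D *\<^sub>v (T *\<^sub>v z)"
    unfolding S_mult[OF Tz] using Tz by (intro eq_vecI) (auto simp: algebra_simps simp del: index_mult_mat_vec)
  also have "\<dots> = z" unfolding \<open>- ((b \<bullet> (T *\<^sub>v z)) / a) = v0\<close> by (rule *(2))
  finally show ?thesis .
qed

text \<open>The dual of \<open>form_A\<close>, obtained by evaluating the form of \<open>A\<close>
  at \<open>B\<close> times the vector. The first summand is the exponent of the one-dimensional
  dual Gaussian, the second is the dual form for \<open>S\<close> at the tail displaced by (y0 / a)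
  b.\<close>

lemma form_B:
  assumes z: "z \<in> carrier_vec n"
  shows "vCons y0 z \<bullet> (B *\<^sub>v vCons y0 z) =
    y0\<^sup>2 / a + (z - (y0 / a) \<cdot>\<^sub>v b) \<bullet> (T *\<^sub>v (z - (y0 / a) \<cdot>\<^sub>v b))"
proof -
  let ?y = "vCons y0 z"
  have y: "?y \<in> carrier_vec (Suc n)" using z by simp
  then have By: "B *\<^sub>v ?y \<in> carrier_vec (Suc n)" using B by (simp add: mult_mat_vec_carrier[of _ "Suc n" "Suc n"])
  then obtain v0 w where v: "B *\<^sub>v ?y = vCons v0 w" and w: "w \<in> carrier_vec n"
    by (rule vCons_carrier_cases)
  have Av: "A *\<^sub>v vCons v0 w = ?y" using AB[OF y] v by simp
  then have *: "a * v0 + b \<bullet> w = y0" "v0 \<cdot>\<^sub>v b + D *\<^sub>v w = z"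
    by (simp_all add: A_mult[OF w])
  have q: "y0 / a = v0 + (b \<bullet> w) / a" using *(1) a_pos by (simp add: field_simps)
  have Sw: "z - (y0 / a) \<cdot>\<^sub>v b = S *\<^sub>v w"
    unfolding q S_mult[OF w] *(2)[symmetric] using w
    by (intro eq_vecI) (auto simp: algebra_simps simp del: index_mult_mat_vec)
  have "?y \<bullet> (B *\<^sub>v ?y) = vCons v0 w \<bullet> (A *\<^sub>v vCons v0 w)"
    unfolding v Av using y w by (intro comm_scalar_prod[of _ "Suc n"]) auto
  also have "\<dots> = a * (y0 / a)\<^sup>2 + w \<bullet> (S *\<^sub>v w)" unfolding form_A[OF w] q ..
  also have "a * (y0 / a)\<^sup>2 = y0\<^sup>2 / a" using a_pos by (simp add: power2_eq_square)
  also have "w \<bullet> (S *\<^sub>v w) = (S *\<^sub>v w) \<bullet> (T *\<^sub>v (S *\<^sub>v w))"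
    unfolding T_S[OF w] using w by (intro comm_scalar_prod[of _ n]) (auto simp: mult_mat_vec_carrier[of _ n n])
  finally show ?thesis unfolding Sw .
qed

end

end

section \<open>The lattice formula by splitting off one coordinate\<close>

lemma summable_on_Times_mult:
  fixes f :: "'a \<Rightarrow> real" and g :: "'b \<Rightarrow> real"
  assumes "f summable_on X" "g summable_on Y" "\<And>x. x \<in> X \<Longrightarrow> f x \<ge> 0" "\<And>y. y \<in> Y \<Longrightarrow> g y \<ge> 0"
  shows "(\<lambda>(x, y). f x * g y) summable_on X \<times> Y"
proof (rule summable_on_SigmaI[where g = "\<lambda>x. f x * infsum g Y"])
  fix x assume "x \<in> X"
  show "((\<lambda>y. case (x, y) of (x, y) \<Rightarrow> f x * g y) has_sum f x * infsum g Y) Y"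
    using assms(2) by (auto intro!: has_sum_cmult_right has_sum_infsum)
qed (use assms in \<open>auto intro!: summable_on_cmult_left mult_nonneg_nonneg\<close>)

lemma summable_on_norm_comparison:
  fixes f :: "'a \<Rightarrow> 'b::banach"
  assumes "g summable_on X" "\<And>x. x \<in> X \<Longrightarrow> norm (f x) \<le> g x"
  shows "f summable_on X"
  using Infinite_Sum.abs_summable_on_comparison_test'[OF assms] by (rule abs_summable_summable)

lemma infsum_complex_of_real:
  "(\<Sum>\<^sub>\<infinity>x\<in>X. complex_of_real (f x)) = of_real (infsum f X)"
proof (cases "f summable_on X")
  case True
  then show ?thesis by (intro infsumI has_sum_of_real has_sum_infsum)
next
  case False
  then have "\<not> (\<lambda>x. complex_of_real (f x)) summable_on X"
    using summable_on_Re[of "\<lambda>x. complex_of_real (f x)" X] by auto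
  then show ?thesis using False by (simp add: infsum_not_exists)
qed

text \<open>After Poisson summation at x = 0 the shift \<open>b\<close> survives only in phases of
  modulus one, so the dual series bounds all shifted sums at once.\<close>

lemma gauss_row_sum_bounded:
  fixes a :: real
  assumes a: "a > 0"
  shows "\<exists>M. \<forall>b. (\<Sum>\<^sub>\<infinity>k::int. exp (- a * (of_int k + b)\<^sup>2)) \<le> M"
proof -
  let ?d = "\<lambda>m::int. exp (- (0 - 2 * pi * of_int m)\<^sup>2 / (4 * a))"
  have "(\<Sum>\<^sub>\<infinity>k::int. exp (- a * (of_int k + b)\<^sup>2)) \<le> sqrt (pi / a) * infsum ?d UNIV" for b
  proof -
    let ?f = "\<lambda>m::int. complex_of_real (?d m) * cis (- b * (0 - 2 * pi * of_int m))"
    have nf: "norm (?f m) = ?d m" for m by (simp add: norm_mult)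
    have s: "(\<lambda>m. norm (?f m)) summable_on UNIV" unfolding nf by (rule summable_gauss_dual[OF a])
    have "complex_of_real (\<Sum>\<^sub>\<infinity>k::int. exp (- a * (of_int k + b)\<^sup>2)) =
        (\<Sum>\<^sub>\<infinity>k::int. of_real (exp (- a * (of_int k + b)\<^sup>2)) * cis (of_int k * 0))"
      by (simp add: infsum_complex_of_real)
    also have "\<dots> = of_real (sqrt (pi / a)) * infsum ?f UNIV" by (rule poisson_gauss_line[OF a])
    finally have "norm (complex_of_real (\<Sum>\<^sub>\<infinity>k::int. exp (- a * (of_int k + b)\<^sup>2))) = sqrt (pi / a) * norm (infsum ?f UNIV)"
      using a by (simp add: norm_mult)
    also have "\<dots> \<le> sqrt (pi / a) * (\<Sum>\<^sub>\<infinity>m. norm (?f m))"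
      using a by (intro mult_left_mono norm_infsum_bound s) auto
    finally show ?thesis unfolding nf by simp
  qed
  then show ?thesis by blast
qed

text \<open>Positivity of the determinant, both summability claims and the identity form a single
  induction statement, since the step for the identity uses all of them in the lower dimension. The
  inverse is specified by its action on vectors, which is the form in which \<open>T_S\<close> and
  \<open>S_T\<close> pass it on to the Schur complement.\<close>

lemma poisson_gauss_lattice:
  fixes A B :: "real mat"
  assumes "A \<in> carrier_mat n n" "transpose_mat A = A" "positive_definite n A" "B \<in> carrier_mat n n"
    and "\<And>v. v \<in> carrier_vec n \<Longrightarrow> A *\<^sub>v (B *\<^sub>v v) = v"
    and "\<And>v. v \<in> carrier_vec n \<Longrightarrow> B *\<^sub>v (A *\<^sub>v v) = v"
  shows "Determinant.det A > 0 \<and>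
    (\<lambda>k. exp (- (real_vec k \<bullet> (A *\<^sub>v real_vec k)))) summable_on carrier_vec n \<and>
    (\<forall>x \<in> carrier_vec n.
      (\<lambda>m. exp (- ((x - (2 * pi) \<cdot>\<^sub>v real_vec m) \<bullet> (B *\<^sub>v (x - (2 * pi) \<cdot>\<^sub>v real_vec m)) / 4)))
        summable_on carrier_vec n \<and>
      (\<Sum>\<^sub>\<infinity>k\<in>carrier_vec n. of_real (exp (- (real_vec k \<bullet> (A *\<^sub>v real_vec k)))) * cis (real_vec k \<bullet> x)) =
      complex_of_real (sqrt (pi ^ n / Determinant.det A) * (\<Sum>\<^sub>\<infinity>m\<in>carrier_vec n.
        exp (- ((x - (2 * pi) \<cdot>\<^sub>v real_vec m) \<bullet> (B *\<^sub>v (x - (2 * pi) \<cdot>\<^sub>v real_vec m)) / 4)))))"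
  using assms
proof (induction n arbitrary: A B)
  case 0
  have c0: "carrier_vec 0 = {vNil :: 'z Matrix.vec}" by auto
  have "A = 1\<^sub>m 0" using 0(1) by (intro eq_matI) auto
  then have "Determinant.det A = 1" by simp
  moreover have "v \<bullet> (A *\<^sub>v w) = 0" "v \<bullet> (B *\<^sub>v w) = 0" for v w
    using 0(1,4) by (simp_all add: scalar_prod_def)
  moreover have "v \<bullet> vNil = (0 :: real)" for v by (simp add: scalar_prod_def)
  ultimately show ?case unfolding c0 by simp
next
  case (Suc n)
  interpret schur_complement n A using Suc.prems by unfold_locales
  note B = Suc.prems(4) and AB = Suc.prems(5) and BA = Suc.prems(6)
  define T' where "T' = T B"
  have T': "T' \<in> carrier_mat n n" by (simp add: T'_def T_def[OF B AB BA])
  have TS: "\<And>w. w \<in> carrier_vec n \<Longrightarrow> T' *\<^sub>v (S *\<^sub>v w) = w" 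
    and ST: "\<And>w. w \<in> carrier_vec n \<Longrightarrow> S *\<^sub>v (T' *\<^sub>v w) = w"
    using T_S[OF B AB BA] S_T[OF B AB BA] by (simp_all add: T'_def)
  define E where "E k = exp (- (real_vec k \<bullet> (S *\<^sub>v real_vec k)))" for k
  define H where "H z m = exp (- ((z - (2 * pi) \<cdot>\<^sub>v real_vec m) \<bullet> (T' *\<^sub>v (z - (2 * pi) \<cdot>\<^sub>v real_vec m)) / 4))" for z m
  define C where "C = sqrt (pi ^ n / Determinant.det S)"
  note IH = Suc.IH[OF S S_sym S_pos T' ST TS, folded E_def H_def C_def]
  have detS: "Determinant.det S > 0" and Es: "E summable_on carrier_vec n"
    and Hs: "\<And>z. z \<in> carrier_vec n \<Longrightarrow> H z summable_on carrier_vec n"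
    and EH: "\<And>z. z \<in> carrier_vec n \<Longrightarrow> (\<Sum>\<^sub>\<infinity>k\<in>carrier_vec n. of_real (E k) * cis (real_vec k \<bullet> z)) =
      complex_of_real (C * (\<Sum>\<^sub>\<infinity>m\<in>carrier_vec n. H z m))"
    using IH by auto
  have C: "C > 0" using detS by (simp add: C_def)
  have E0: "E k \<ge> 0" and H0: "H z m \<ge> 0" for k z m by (simp_all add: E_def H_def)
  \<comment> \<open>The induction hypothesis, read from right to left, bounds the dual sum uniformly
    in \<open>z\<close>: the primal series has terms of modulus \<open>E k\<close>.\<close>
  define M' where "M' = infsum E (carrier_vec n) / C"
  have Hbound: "(\<Sum>\<^sub>\<infinity>m\<in>carrier_vec n. H z m) \<le> M'" if z: "z \<in> carrier_vec n" for z
  proof -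
    have nE: "norm (complex_of_real (E k) * cis (real_vec k \<bullet> z)) = E k" for k using E0 by (simp add: norm_mult)
    have "C * (\<Sum>\<^sub>\<infinity>m\<in>carrier_vec n. H z m) \<le> norm (complex_of_real (C * (\<Sum>\<^sub>\<infinity>m\<in>carrier_vec n. H z m)))"
      unfolding norm_of_real by simp
    also have "\<dots> \<le> infsum E (carrier_vec n)"
      unfolding EH[OF z, symmetric]
      using norm_infsum_bound[of "\<lambda>k. complex_of_real (E k) * cis (real_vec k \<bullet> z)" "carrier_vec n"] Es
      unfolding nE by blast
    finally show ?thesis using C by (simp add: M'_def field_simps)
  qed
  obtain M where M: "\<And>b. (\<Sum>\<^sub>\<infinity>k::int. exp (- a * (of_int k + b)\<^sup>2)) \<le> M"
    using gauss_row_sum_bounded[OF a_pos] by blast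
  define \<beta> where "\<beta> k = (b \<bullet> real_vec k) / a" for k
  have form: "exp (- (real_vec (vCons k0 k) \<bullet> (A *\<^sub>v real_vec (vCons k0 k)))) = E k * exp (- a * (of_int k0 + \<beta> k)\<^sup>2)"
    if "k \<in> carrier_vec n" for k0 k
    using that by (simp add: real_vec_vCons form_A E_def \<beta>_def flip: exp_add)
  note bij = bij_betw_vCons[where 'a = int, of n]
  have primal: "(\<lambda>(k, k0). E k * exp (- a * (of_int k0 + \<beta> k)\<^sup>2)) summable_on carrier_vec n \<times> (UNIV :: int set)"
  proof (rule summable_on_SigmaI[where g = "\<lambda>k. E k * (\<Sum>\<^sub>\<infinity>k0::int. exp (- a * (of_int k0 + \<beta> k)\<^sup>2))"])
    fix k :: "int vec"
    show "((\<lambda>y::int. case (k, y) of (k, k0) \<Rightarrow> E k * exp (- a * (of_int k0 + \<beta> k)\<^sup>2)) has_sum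
         E k * (\<Sum>\<^sub>\<infinity>k0::int. exp (- a * (of_int k0 + \<beta> k)\<^sup>2))) UNIV"
      unfolding case_prod_conv using a_pos by (intro has_sum_cmult_right has_sum_infsum summable_gauss_int_shift)
  next
    show "(\<lambda>k. E k * (\<Sum>\<^sub>\<infinity>k0::int. exp (- a * (of_int k0 + \<beta> k)\<^sup>2))) summable_on carrier_vec n"
      by (rule summable_on_norm_comparison[where g = "\<lambda>k. E k * M"])
         (use E0 M Es in \<open>auto simp: infsum_nonneg intro!: mult_left_mono summable_on_cmult_left\<close>)
  qed (use E0 in auto)
  have pA: "(\<lambda>k. exp (- (real_vec k \<bullet> (A *\<^sub>v real_vec k)))) summable_on carrier_vec (Suc n)"
    using primal unfolding summable_on_reindex_bij_betw[OF bij, symmetric]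
    by (rule summable_on_cong[THEN iffD1, rotated]) (auto simp: form)
  have dual: "(\<lambda>m. exp (- ((x - (2 * pi) \<cdot>\<^sub>v real_vec m) \<bullet> (B *\<^sub>v (x - (2 * pi) \<cdot>\<^sub>v real_vec m)) / 4)))
        summable_on carrier_vec (Suc n) \<and>
      (\<Sum>\<^sub>\<infinity>k\<in>carrier_vec (Suc n). of_real (exp (- (real_vec k \<bullet> (A *\<^sub>v real_vec k)))) * cis (real_vec k \<bullet> x)) =
      complex_of_real (sqrt (pi ^ Suc n / Determinant.det A) * (\<Sum>\<^sub>\<infinity>m\<in>carrier_vec (Suc n).
        exp (- ((x - (2 * pi) \<cdot>\<^sub>v real_vec m) \<bullet> (B *\<^sub>v (x - (2 * pi) \<cdot>\<^sub>v real_vec m)) / 4))))"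
    if "x \<in> carrier_vec (Suc n)" for x
  proof -
    obtain x0 x' where x: "x = vCons x0 x'" and x': "x' \<in> carrier_vec n"
      using \<open>x \<in> carrier_vec (Suc n)\<close> by (rule vCons_carrier_cases)
    \<comment> \<open>Summing over the first coordinate by the formula on the line produces the
      phase -\<beta>(k) y(m). As \<beta> is linear in \<open>k\<close>, this phase merges with k .
      x' into k . z(m), and the sum over \<open>k\<close> becomes the induction hypothesis at the
      displaced point \<open>z m\<close>.\<close>
    define y where "y m = x0 - 2 * pi * of_int m" for m :: int
    define z where "z m = x' - (y m / a) \<cdot>\<^sub>v b" for m
    have z: "z m \<in> carrier_vec n" for m using x' by (simp add: z_def)
    define g where "g m = exp (- (y m)\<^sup>2 / (4 * a))" for m
    have gs: "g summable_on UNIV" unfolding g_def y_def by (rule summable_gauss_dual[OF a_pos])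
    have g0: "g m \<ge> 0" for m by (simp add: g_def)
    define f where "f m = exp (- ((x - (2 * pi) \<cdot>\<^sub>v real_vec m) \<bullet> (B *\<^sub>v (x - (2 * pi) \<cdot>\<^sub>v real_vec m)) / 4))" for m
    have f: "f (vCons m0 m) = g m0 * H (z m0) m" if m: "m \<in> carrier_vec n" for m0 m
    proof -
      have "x - (2 * pi) \<cdot>\<^sub>v real_vec (vCons m0 m) = vCons (y m0) (x' - (2 * pi) \<cdot>\<^sub>v real_vec m)"
        using x' m by (simp add: x real_vec_vCons smult_vCons y_def vCons_minus)
      moreover have "(x' - (2 * pi) \<cdot>\<^sub>v real_vec m) - (y m0 / a) \<cdot>\<^sub>v b = z m0 - (2 * pi) \<cdot>\<^sub>v real_vec m"
        using x' m by (intro eq_vecI) (auto simp: z_def)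
      moreover have "x' - (2 * pi) \<cdot>\<^sub>v real_vec m \<in> carrier_vec n" using x' m by simp
      ultimately show ?thesis
        using form_B[OF B AB BA, of "x' - (2 * pi) \<cdot>\<^sub>v real_vec m" "y m0"]
        by (simp add: f_def g_def H_def T'_def add_divide_distrib flip: exp_add)
    qed
    have ds: "(\<lambda>(m0, m). g m0 * H (z m0) m) summable_on UNIV \<times> carrier_vec n"
    proof (rule summable_on_SigmaI[where g = "\<lambda>m0. g m0 * infsum (H (z m0)) (carrier_vec n)"])
      fix m0 :: int
      show "((\<lambda>m. case (m0, m) of (m0, m) \<Rightarrow> g m0 * H (z m0) m) has_sum
          g m0 * infsum (H (z m0)) (carrier_vec n)) (carrier_vec n)"
        unfolding case_prod_conv by (intro has_sum_cmult_right has_sum_infsum Hs z)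
    next
      show "(\<lambda>m0. g m0 * infsum (H (z m0)) (carrier_vec n)) summable_on UNIV"
        by (rule summable_on_norm_comparison[where g = "\<lambda>m0. g m0 * M'"])
           (use g0 H0 Hbound[OF z] gs in \<open>auto simp: infsum_nonneg abs_mult intro!: mult_left_mono summable_on_cmult_left\<close>)
    qed (use g0 H0 in auto)
    \<comment> \<open>The bijection \<open>bij_betw_vCons\<close> takes the tail as first component,
      whereas the summability estimate sums over the tail inside.\<close>
    have ds': "(\<lambda>(m, m0). g m0 * H (z m0) m) summable_on carrier_vec n \<times> UNIV"
      using ds by (subst (asm) summable_on_swap) simp
    have fs: "f summable_on carrier_vec (Suc n)"
      unfolding summable_on_reindex_bij_betw[OF bij, symmetric]
      by (rule summable_on_cong[THEN iffD1, OF _ ds']) (auto simp: f)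
    have "infsum f (carrier_vec (Suc n)) = (\<Sum>\<^sub>\<infinity>(m, m0)\<in>carrier_vec n \<times> UNIV. g m0 * H (z m0) m)"
      unfolding infsum_reindex_bij_betw[OF bij, symmetric] by (rule infsum_cong) (auto simp: f)
    also have "\<dots> = (\<Sum>\<^sub>\<infinity>m\<in>carrier_vec n. \<Sum>\<^sub>\<infinity>m0. g m0 * H (z m0) m)"
      by (rule infsum_Sigma'_banach[OF ds', symmetric])
    also have "\<dots> = (\<Sum>\<^sub>\<infinity>m0. \<Sum>\<^sub>\<infinity>m\<in>carrier_vec n. g m0 * H (z m0) m)"
      by (rule infsum_swap_banach[OF ds'])
    also have "\<dots> = (\<Sum>\<^sub>\<infinity>m0. g m0 * infsum (H (z m0)) (carrier_vec n))"
      by (simp add: infsum_cmult_right')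
    finally have sumf: "infsum f (carrier_vec (Suc n)) = (\<Sum>\<^sub>\<infinity>m0. g m0 * infsum (H (z m0)) (carrier_vec n))" .
    \<comment> \<open>In this mixed series the first coordinate is already dual and the others are
      still primal. Its absolute summability licenses the exchange that puts the sum over
      \<open>k\<close> inside.\<close>
    have prod: "(\<lambda>(k, m). complex_of_real (E k * g m) * cis (real_vec k \<bullet> x' - \<beta> k * y m)) summable_on carrier_vec n \<times> UNIV"
      by (rule summable_on_norm_comparison[OF summable_on_Times_mult[OF Es gs]])
         (use E0 g0 in \<open>auto simp: norm_mult\<close>)
    have zk: "real_vec k \<bullet> x' - \<beta> k * y m = real_vec k \<bullet> z m" if "k \<in> carrier_vec n" for k m
      using that x' by (simp add: z_def scalar_prod_minus_distrib[of _ n] \<beta>_def comm_scalar_prod[of "real_vec k" n b])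
    have "(\<Sum>\<^sub>\<infinity>k\<in>carrier_vec (Suc n). of_real (exp (- (real_vec k \<bullet> (A *\<^sub>v real_vec k)))) * cis (real_vec k \<bullet> x)) =
        (\<Sum>\<^sub>\<infinity>(k, k0)\<in>carrier_vec n \<times> UNIV. complex_of_real (E k * exp (- a * (of_int k0 + \<beta> k)\<^sup>2)) * cis (of_int k0 * x0 + real_vec k \<bullet> x'))"
      unfolding infsum_reindex_bij_betw[OF bij, symmetric]
      by (rule infsum_cong) (auto simp: form[unfolded real_vec_vCons] x real_vec_vCons simp del: of_real_mult)
    also have "\<dots> = (\<Sum>\<^sub>\<infinity>k\<in>carrier_vec n. \<Sum>\<^sub>\<infinity>k0. complex_of_real (E k * exp (- a * (of_int k0 + \<beta> k)\<^sup>2)) * cis (of_int k0 * x0 + real_vec k \<bullet> x'))"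
      by (rule infsum_Sigma'_banach[symmetric], rule summable_on_norm_comparison[OF primal])
         (use E0 in \<open>auto simp: norm_mult\<close>)
    also have "\<dots> = (\<Sum>\<^sub>\<infinity>k\<in>carrier_vec n. \<Sum>\<^sub>\<infinity>m. of_real (sqrt (pi / a)) * (of_real (E k * g m) * cis (real_vec k \<bullet> x' - \<beta> k * y m)))"
    proof (rule infsum_cong)
      fix k :: "int vec"
      have "(\<Sum>\<^sub>\<infinity>k0::int. complex_of_real (E k * exp (- a * (of_int k0 + \<beta> k)\<^sup>2)) * cis (of_int k0 * x0 + real_vec k \<bullet> x')) =
          (\<Sum>\<^sub>\<infinity>k0::int. (of_real (E k) * cis (real_vec k \<bullet> x')) * (of_real (exp (- a * (of_int k0 + \<beta> k)\<^sup>2)) * cis (of_int k0 * x0)))"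
        by (simp add: mult_ac flip: cis_mult)
      also have "\<dots> = (of_real (E k) * cis (real_vec k \<bullet> x')) *
          (of_real (sqrt (pi / a)) * (\<Sum>\<^sub>\<infinity>m. of_real (g m) * cis (- \<beta> k * y m)))"
        unfolding infsum_cmult_right' poisson_gauss_line(2)[OF a_pos] g_def y_def ..
      also have "\<dots> = (\<Sum>\<^sub>\<infinity>m. (of_real (E k) * cis (real_vec k \<bullet> x')) * (of_real (sqrt (pi / a)) * (of_real (g m) * cis (- \<beta> k * y m))))"
        unfolding infsum_cmult_right' ..
      also have "\<dots> = (\<Sum>\<^sub>\<infinity>m. of_real (sqrt (pi / a)) * (of_real (E k * g m) * cis (real_vec k \<bullet> x' - \<beta> k * y m)))"
        by (rule infsum_cong) (simp add: mult_ac diff_conv_add_uminus flip: cis_mult del: add_uminus_conv_diff)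
      finally show "(\<Sum>\<^sub>\<infinity>k0::int. complex_of_real (E k * exp (- a * (of_int k0 + \<beta> k)\<^sup>2)) * cis (of_int k0 * x0 + real_vec k \<bullet> x')) =
        (\<Sum>\<^sub>\<infinity>m. of_real (sqrt (pi / a)) * (of_real (E k * g m) * cis (real_vec k \<bullet> x' - \<beta> k * y m)))" .
    qed
    also have "\<dots> = of_real (sqrt (pi / a)) * (\<Sum>\<^sub>\<infinity>k\<in>carrier_vec n. \<Sum>\<^sub>\<infinity>m. of_real (E k * g m) * cis (real_vec k \<bullet> x' - \<beta> k * y m))"
      unfolding infsum_cmult_right' ..
    also have "(\<Sum>\<^sub>\<infinity>k\<in>carrier_vec n. \<Sum>\<^sub>\<infinity>m. complex_of_real (E k * g m) * cis (real_vec k \<bullet> x' - \<beta> k * y m)) =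
       (\<Sum>\<^sub>\<infinity>m. \<Sum>\<^sub>\<infinity>k\<in>carrier_vec n. of_real (E k * g m) * cis (real_vec k \<bullet> x' - \<beta> k * y m))"
      by (rule infsum_swap_banach[OF prod])
    also have "\<dots> = (\<Sum>\<^sub>\<infinity>m. \<Sum>\<^sub>\<infinity>k\<in>carrier_vec n. of_real (g m) * (of_real (E k) * cis (real_vec k \<bullet> z m)))"
      by (intro infsum_cong) (simp add: zk mult_ac)
    also have "\<dots> = (\<Sum>\<^sub>\<infinity>m. of_real (C * (g m * infsum (H (z m)) (carrier_vec n))))"
      unfolding infsum_cmult_right' EH[OF z] by (simp add: mult_ac)
    also have "\<dots> = of_real (C * infsum f (carrier_vec (Suc n)))"
      unfolding infsum_complex_of_real infsum_cmult_right' sumf ..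
    also have "complex_of_real (sqrt (pi / a)) * of_real (C * infsum f (carrier_vec (Suc n))) =
      of_real (sqrt (pi ^ Suc n / Determinant.det A) * infsum f (carrier_vec (Suc n)))"
    proof -
      have "sqrt (pi / a) * C = sqrt (pi ^ Suc n / Determinant.det A)"
        unfolding C_def det_A by (simp flip: real_sqrt_mult)
      then show ?thesis by (metis mult.assoc of_real_mult)
    qed
    finally show ?thesis using fs unfolding f_def by blast
  qed
  show ?case using pA dual detS a_pos by (simp add: det_A)
qed

section \<open>Coercivity of the metric and small denominators\<close>

lemma scalar_prod_self_nonneg: "0 \<le> v \<bullet> (v :: real vec)"
  unfolding scalar_prod_def by (intro sum_nonneg) simp

lemma eucl_norm_sq: "v \<in> carrier_vec n \<Longrightarrow> (eucl_norm v)\<^sup>2 = v \<bullet> v"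
  by (simp add: eucl_norm_def scalar_prod_self_nonneg)

lemma eucl_norm_nonneg [simp]: "eucl_norm v \<ge> 0"
  by (simp add: eucl_norm_def scalar_prod_self_nonneg)

lemma abs_index_le_eucl_norm:
  assumes "i < dim_vec v"
  shows "\<bar>v $ i\<bar> \<le> eucl_norm v"
proof -
  have "(v $ i) * (v $ i) \<le> v \<bullet> v"
    unfolding scalar_prod_def using assms by (intro member_le_sum[of i _ "\<lambda>i. v $ i * v $ i"]) auto
  then have "sqrt ((v $ i)\<^sup>2) \<le> eucl_norm v"
    unfolding eucl_norm_def by (intro real_sqrt_le_mono) (simp add: power2_eq_square)
  then show ?thesis by simp
qed

lemma eucl_norm_mono:
  assumes "dim_vec u = dim_vec v" "\<And>i. i < dim_vec v \<Longrightarrow> \<bar>u $ i\<bar> \<le> \<bar>v $ i\<bar>"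
  shows "eucl_norm u \<le> eucl_norm v"
  unfolding eucl_norm_def scalar_prod_def assms(1)
  by (intro real_sqrt_le_mono sum_mono) (use assms in \<open>auto simp: abs_le_square_iff power2_eq_square\<close>)

lemma form_le_norm:
  fixes A :: "real mat"
  assumes A: "A \<in> carrier_mat n n" and v: "v \<in> carrier_vec n"
  shows "v \<bullet> (A *\<^sub>v v) \<le> (\<Sum>i<n. \<Sum>j<n. \<bar>A $$ (i, j)\<bar>) * (v \<bullet> v)"
proof -
  have "v \<bullet> (A *\<^sub>v v) = (\<Sum>i<n. \<Sum>j<n. v $ i * (A $$ (i, j) * v $ j))"
    using A v by (simp add: scalar_prod_def sum_distrib_left atLeast0LessThan)
  also have "\<dots> \<le> (\<Sum>i<n. \<Sum>j<n. \<bar>A $$ (i, j)\<bar> * (v \<bullet> v))"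
  proof (intro sum_mono)
    fix i j assume ij: "i \<in> {..<n}" "j \<in> {..<n}"
    have "v $ i * (A $$ (i, j) * v $ j) \<le> \<bar>A $$ (i, j)\<bar> * (\<bar>v $ i\<bar> * \<bar>v $ j\<bar>)"
      by (metis abs_ge_self abs_mult mult.left_commute)
    also have "\<bar>v $ i\<bar> * \<bar>v $ j\<bar> \<le> eucl_norm v * eucl_norm v"
      using ij v by (intro mult_mono abs_index_le_eucl_norm) auto
    finally show "v $ i * (A $$ (i, j) * v $ j) \<le> \<bar>A $$ (i, j)\<bar> * (v \<bullet> v)"
      unfolding eucl_norm_sq[OF v, symmetric] power2_eq_square by (simp add: mult_left_mono)
  qed
  finally show ?thesis by (simp add: sum_distrib_right)
qed

lemma constant_metric_cancel:
  assumes "constant_metric n g ginv" and v: "v \<in> carrier_vec n"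
  shows "ginv *\<^sub>v (g *\<^sub>v v) = v" "g *\<^sub>v (ginv *\<^sub>v v) = v"
  using assms unfolding constant_metric_def
  by (metis assoc_mult_mat_vec one_mult_mat_vec)+

text \<open>The inequality is the positivity of \<open>g\<^sup>-\<^sup>1\<close> at \<open>g y - y / M\<close>, where \<open>M\<close> bounds \<open>g\<^sup>-\<^sup>1\<close> from above.\<close>

lemma constant_metric_coercive:
  assumes m: "constant_metric n g ginv"
  shows "\<exists>c>0. \<forall>y\<in>carrier_vec n. c * (y \<bullet> y) \<le> y \<bullet> (g *\<^sub>v y)"
proof -
  have g: "g \<in> carrier_mat n n" and gi: "ginv \<in> carrier_mat n n" and sym: "transpose_mat ginv = ginv"
    and pos: "positive_definite n ginv"
    using m by (auto simp: constant_metric_def)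
  define M where "M = 1 + (\<Sum>i<n. \<Sum>j<n. \<bar>ginv $$ (i, j)\<bar>)"
  have M: "M > 0" unfolding M_def by (intro add_pos_nonneg sum_nonneg) auto
  have "(1 / M) * (y \<bullet> y) \<le> y \<bullet> (g *\<^sub>v y)" if y: "y \<in> carrier_vec n" for y
  proof -
    define w where "w = g *\<^sub>v y"
    have w: "w \<in> carrier_vec n" using g y by (simp add: w_def mult_mat_vec_carrier[of _ n n])
    have giw: "ginv *\<^sub>v w = y" unfolding w_def by (rule constant_metric_cancel[OF m y])
    have giy: "ginv *\<^sub>v y \<in> carrier_vec n" using gi y by (simp add: mult_mat_vec_carrier[of _ n n])
    define e where "e = 1 / M"
    define u where "u = w - e \<cdot>\<^sub>v y"
    have u: "u \<in> carrier_vec n" using w y by (simp add: u_def)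
    have "0 \<le> u \<bullet> (ginv *\<^sub>v u)"
    proof (cases "u = 0\<^sub>v n")
      case True
      then show ?thesis using gi by (simp add: scalar_prod_left_zero[of _ n] mult_mat_vec_carrier[of _ n n])
    next
      case False
      then show ?thesis using pos u unfolding positive_definite_def by (meson less_imp_le)
    qed
    also have "ginv *\<^sub>v u = y - e \<cdot>\<^sub>v (ginv *\<^sub>v y)"
      unfolding u_def using gi w y giw
      by (simp add: mult_minus_distrib_mat_vec[of _ n n] mult_mat_vec[of _ n n])
    also have "u \<bullet> (y - e \<cdot>\<^sub>v (ginv *\<^sub>v y)) = w \<bullet> y - e * (w \<bullet> (ginv *\<^sub>v y)) - e * (y \<bullet> y) + e * e * (y \<bullet> (ginv *\<^sub>v y))"
      unfolding u_def using w y giy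
      by (simp add: minus_scalar_prod_distrib[of _ n] scalar_prod_minus_distrib[of _ n] algebra_simps)
    also have "w \<bullet> (ginv *\<^sub>v y) = y \<bullet> y"
      using transpose_vec_mult_scalar[OF gi y w] giw unfolding sym by simp
    also have "w \<bullet> y = y \<bullet> w" using w y by (rule comm_scalar_prod)
    finally have 1: "2 * e * (y \<bullet> y) - e * e * (y \<bullet> (ginv *\<^sub>v y)) \<le> y \<bullet> w" by simp
    have "y \<bullet> (ginv *\<^sub>v y) \<le> M * (y \<bullet> y)"
      using form_le_norm[OF gi y] scalar_prod_self_nonneg[of y] by (simp add: M_def algebra_simps)
    then have "e * e * (y \<bullet> (ginv *\<^sub>v y)) \<le> e * e * (M * (y \<bullet> y))" by (intro mult_left_mono) auto
    also have "\<dots> = e * (y \<bullet> y)" using M by (simp add: e_def)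
    finally show ?thesis using 1 by (simp add: w_def e_def)
  qed
  then show ?thesis using M by (intro exI[of _ "1 / M"]) auto
qed

section \<open>Small denominators\<close>

lemma common_denominator:
  "finite X \<Longrightarrow> (\<forall>x\<in>X. x \<in> \<rat>) \<Longrightarrow> \<exists>D::nat. D > 0 \<and> (\<forall>x\<in>X. real D * x \<in> \<int>)"
proof (induction rule: finite_induct)
  case (insert x X)
  then obtain D where D: "D > 0" "\<forall>x\<in>X. real D * x \<in> \<int>" by auto
  obtain a :: int and b :: nat where "b > 0" "x = of_int a / of_nat b"
    using insert.prems by (auto elim!: Rats_cases' simp: of_nat_nat intro: that[of "nat _"])
  then have x: "real b * x = of_int a" by simp
  have "real (D * b) * y \<in> \<int>" if "y \<in> insert x X" for y
  proof (cases "y = x")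
    case True
    then have "real (D * b) * y = of_int (int D * a)" using x by (simp add: mult.assoc)
    then show ?thesis by (metis Ints_of_int)
  next
    case False
    then have "real D * y \<in> \<int>" using D that by simp
    then have "real b * (real D * y) \<in> \<int>" using Ints_mult[of "real b" "real D * y"] by simp
    then show ?thesis by (simp add: mult_ac)
  qed
  then show ?case using D \<open>b > 0\<close> by (intro exI[of _ "D * b"]) auto
qed auto

text \<open>This extracts what the gap estimate takes from the normal form: a common denominator
  \<open>D\<close> for the zero and rational part divided by 2 pi, and the decoupling of these
  coordinates from the irrational ones.\<close>

lemma block_normal_form_entries:
  assumes "block_normal_form l0 m1 m2 \<Theta>"
  obtains D :: nat where "D > 0"
    "\<And>i j. i < l0 + m1 \<Longrightarrow> j < l0 + m1 \<Longrightarrow> real D * (\<Theta> $$ (i, j) / (2 * pi)) \<in> \<int>"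
    "\<And>i j. i < l0 + m1 \<Longrightarrow> l0 + m1 \<le> j \<Longrightarrow> j < l0 + m1 + m2 \<Longrightarrow> \<Theta> $$ (i, j) = 0"
    "\<And>i j. j < l0 + m1 \<Longrightarrow> l0 + m1 \<le> i \<Longrightarrow> i < l0 + m1 + m2 \<Longrightarrow> \<Theta> $$ (i, j) = 0"
proof -
  obtain rats irrs where m: "m1 = 2 * length rats" "m2 = 2 * length irrs"
    and rat: "\<forall>\<theta>\<in>set rats. \<theta> / (2 * pi) \<in> \<rat>"
    and \<Theta>: "\<Theta> = diag_block_mat (0\<^sub>m l0 l0 # map skew_block rats @ map skew_block irrs)"
    using assms unfolding block_normal_form_def by blast
  define P where "P = diag_block_mat (0\<^sub>m l0 l0 # map skew_block rats)"
  define Q where "Q = diag_block_mat (map skew_block irrs)"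
  have sb: "dim_row (skew_block \<theta>) = 2" "dim_col (skew_block \<theta>) = 2" for \<theta>
    by (simp_all add: skew_block_def mat_of_rows_list_def)
  have sb_elem: "elements_mat (skew_block \<theta>) \<subseteq> {0, \<theta>, - \<theta>}" for \<theta>
  proof
    fix x assume "x \<in> elements_mat (skew_block \<theta>)"
    then obtain i j where "i < 2" "j < 2" "x = skew_block \<theta> $$ (i, j)"
      by (auto dest!: elements_matD simp: sb)
    then show "x \<in> {0, \<theta>, - \<theta>}"
      by (auto simp: skew_block_def mat_of_rows_list_def less_2_cases_iff)
  qed
  have sl: "sum_list (map (dim_row \<circ> skew_block) xs) = 2 * length xs"
    "sum_list (map (dim_col \<circ> skew_block) xs) = 2 * length xs" for xs
    by (induction xs) (simp_all add: sb)
  have P: "dim_row P = l0 + m1" "dim_col P = l0 + m1"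
    unfolding P_def dim_diag_block_mat by (simp_all add: m sl)
  have Q: "dim_row Q = m2" "dim_col Q = m2"
    unfolding Q_def dim_diag_block_mat by (simp_all add: m sl)
  have \<Theta>4: "\<Theta> = four_block_mat P (0\<^sub>m (l0 + m1) m2) (0\<^sub>m m2 (l0 + m1)) Q"
    unfolding \<Theta> append_Cons[symmetric] diag_block_mat_append P_def[symmetric] Q_def[symmetric] Let_def P Q ..
  obtain D :: nat where D: "D > 0" "\<And>\<theta>. \<theta> \<in> set rats \<Longrightarrow> real D * (\<theta> / (2 * pi)) \<in> \<int>"
    using common_denominator[of "(\<lambda>\<theta>. \<theta> / (2 * pi)) ` set rats"] rat by auto
  have "real D * (P $$ (i, j) / (2 * pi)) \<in> \<int>" if ij: "i < l0 + m1" "j < l0 + m1" for i j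
  proof -
    have "P $$ (i, j) \<in> elements_mat P" using ij P by (intro elements_matI[of _ "l0 + m1" "l0 + m1"]) auto
    also have "\<dots> \<subseteq> {0} \<union> (\<Union>\<theta>\<in>set rats. elements_mat (skew_block \<theta>))"
    proof -
      have e0: "elements_mat (0\<^sub>m l0 l0 :: real mat) \<subseteq> {0}" by auto
      have "elements_mat P \<subseteq> {0} \<union> (elements_mat (0\<^sub>m l0 l0) \<union> (\<Union>\<theta>\<in>set rats. elements_mat (skew_block \<theta>)))"
        unfolding P_def using elements_diag_block_mat[of "0\<^sub>m l0 l0 # map skew_block rats"]
        by (simp del: diag_block_mat.simps)
      also have "\<dots> \<subseteq> {0} \<union> ({0} \<union> (\<Union>\<theta>\<in>set rats. elements_mat (skew_block \<theta>)))"
        by (intro Un_mono e0 order_refl)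
      finally show ?thesis by (simp only: Un_left_absorb)
    qed
    also have "\<dots> \<subseteq> {0} \<union> (\<Union>\<theta>\<in>set rats. {0, \<theta>, - \<theta>})"
      using sb_elem by (intro Un_mono UN_mono order_refl)
    finally consider "P $$ (i, j) = 0" | \<theta> where "\<theta> \<in> set rats" "P $$ (i, j) = \<theta> \<or> P $$ (i, j) = - \<theta>" by blast
    then show ?thesis
    proof cases
      case (2 \<theta>)
      then show ?thesis using D(2)[of \<theta>] Ints_minus[of "real D * (\<theta> / (2 * pi))"] by auto
    qed simp
  qed
  then show ?thesis using D(1) P Q by (intro that[of D]) (auto simp: \<Theta>4)
qed

text \<open>If \<open>q\<close> vanishes on the irrational coordinates, D / (2 pi) times the
  difference is a nonzero integer vector and so has an entry of modulus at least 1. Otherwise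
  \<open>q\<close> and \<open>m\<close> are truncated to those coordinates: since the blocks
  decouple, this does not increase the distance, and the truncated \<open>q\<close> is subject to
  the Diophantine bound.\<close>

lemma nonresonance:
  assumes n: "n = l0 + m1 + m2" and \<Theta>: "\<Theta> \<in> carrier_mat n n"
    and nf: "block_normal_form l0 m1 m2 \<Theta>" and dio: "diophantine n m2 \<Theta>"
  shows "\<exists>c>0. \<exists>K::nat. \<forall>q\<in>carrier_vec n. \<forall>m\<in>carrier_vec n.
    \<Theta> *\<^sub>v real_vec q \<noteq> (2 * pi) \<cdot>\<^sub>v real_vec m \<longrightarrow>
    c \<le> eucl_norm (\<Theta> *\<^sub>v real_vec q - (2 * pi) \<cdot>\<^sub>v real_vec m) * (1 + eucl_norm (real_vec q)) ^ K"
proof -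
  obtain C \<beta> where C: "C > 0" and \<beta>: "\<beta> > 0" and dio': "\<And>q. q \<in> K_inf n m2 \<Longrightarrow>
    C * eucl_norm (real_vec q) powr (- (1 + \<beta>)) \<le> (INF k \<in> carrier_vec n. eucl_norm (\<Theta> *\<^sub>v real_vec q - (2 * pi) \<cdot>\<^sub>v real_vec k))"
    using dio unfolding diophantine_def by blast
  obtain D :: nat where D: "D > 0"
    and rat: "\<And>i j. i < l0 + m1 \<Longrightarrow> j < l0 + m1 \<Longrightarrow> real D * (\<Theta> $$ (i, j) / (2 * pi)) \<in> \<int>"
    and z1: "\<And>i j. i < l0 + m1 \<Longrightarrow> l0 + m1 \<le> j \<Longrightarrow> j < n \<Longrightarrow> \<Theta> $$ (i, j) = 0"
    and z2: "\<And>i j. j < l0 + m1 \<Longrightarrow> l0 + m1 \<le> i \<Longrightarrow> i < n \<Longrightarrow> \<Theta> $$ (i, j) = 0"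
    using block_normal_form_entries[OF nf] unfolding n by blast
  \<comment> \<open>\<open>C\<close> serves the case with an irrational component, 2 pi / D the
    purely rational one.\<close>
  define c where "c = min C (2 * pi / D)"
  define K where "K = nat \<lceil>1 + \<beta>\<rceil>"
  have c: "c > 0" using C D by (simp add: c_def)
  have K: "1 + \<beta> \<le> real K" unfolding K_def by linarith
  have mv: "(\<Theta> *\<^sub>v real_vec q) $ i = (\<Sum>j<n. \<Theta> $$ (i, j) * of_int (q $ j))"
    if "q \<in> carrier_vec n" "i < n" for q i
    using that \<Theta> by (simp add: scalar_prod_def atLeast0LessThan)
  have "c \<le> eucl_norm (\<Theta> *\<^sub>v real_vec q - (2 * pi) \<cdot>\<^sub>v real_vec m) * (1 + eucl_norm (real_vec q)) ^ K"
    if q: "q \<in> carrier_vec n" and m: "m \<in> carrier_vec n"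
      and ne: "\<Theta> *\<^sub>v real_vec q \<noteq> (2 * pi) \<cdot>\<^sub>v real_vec m" for q m
  proof -
    let ?d = "\<Theta> *\<^sub>v real_vec q - (2 * pi) \<cdot>\<^sub>v real_vec m" and ?N = "1 + eucl_norm (real_vec q)"
    have dim: "dim_vec ?d = n" using m by simp
    have N1: "?N ^ K \<ge> 1" by (intro one_le_power) simp
    show ?thesis
    proof (cases "\<forall>i. l0 + m1 \<le> i \<longrightarrow> i < n \<longrightarrow> q $ i = 0")
      case True
      \<comment> \<open>In a rational row the denominator \<open>D\<close> clears the entries that
        meet \<open>q\<close>; in an irrational row all products vanish, by the block structure or
        because \<open>q\<close> does.\<close>
      have int: "real D * ?d $ i / (2 * pi) \<in> \<int>" if i: "i < n" for i
      proof -
        have "real D * ?d $ i / (2 * pi) = (\<Sum>j<n. real D * (\<Theta> $$ (i, j) / (2 * pi)) * of_int (q $ j)) - of_int (int D * m $ i)"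
        proof -
          have "?d $ i = (\<Sum>j<n. \<Theta> $$ (i, j) * of_int (q $ j)) - 2 * pi * of_int (m $ i)"
            using i q m \<Theta> mv[OF q i] by simp
          then show ?thesis by (simp add: right_diff_distrib diff_divide_distrib sum_distrib_left sum_divide_distrib mult_ac)
        qed
        moreover have "real D * (\<Theta> $$ (i, j) / (2 * pi)) * of_int (q $ j) \<in> \<int>" if "j < n" for j
        proof (cases "l0 + m1 \<le> j")
          case False
          then show ?thesis
            using rat[of i j] z2[of j i] i by (cases "i < l0 + m1") (simp_all del: times_divide_eq_right add: Ints_mult)
        qed (use True that in simp)
        ultimately show ?thesis by (auto intro!: Ints_diff Ints_sum simp del: of_int_mult)
      qed
      have "\<exists>i<n. ?d $ i \<noteq> 0"
      proof (rule ccontr)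
        assume *: "\<not> (\<exists>i<n. ?d $ i \<noteq> 0)"
        have "\<Theta> *\<^sub>v real_vec q = (2 * pi) \<cdot>\<^sub>v real_vec m"
        proof (rule eq_vecI)
          fix i assume "i < dim_vec ((2 * pi) \<cdot>\<^sub>v real_vec m)"
          then have "i < n" using m by simp
          then show "(\<Theta> *\<^sub>v real_vec q) $ i = ((2 * pi) \<cdot>\<^sub>v real_vec m) $ i"
            using * m \<Theta> by (auto simp del: index_mult_mat_vec)
        qed (use \<Theta> m in simp)
        with ne show False by contradiction
      qed
      then obtain i where i: "i < n" "?d $ i \<noteq> 0" by blast
      then have "1 \<le> \<bar>real D * ?d $ i / (2 * pi)\<bar>" using D by (intro Ints_nonzero_abs_ge1 int) auto
      then have "2 * pi / D \<le> \<bar>?d $ i\<bar>" using D by (simp add: abs_mult field_simps)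
      also have "\<dots> \<le> eucl_norm ?d" using i dim by (intro abs_index_le_eucl_norm) simp
      finally have "c \<le> eucl_norm ?d" by (simp add: c_def)
      also have "\<dots> \<le> eucl_norm ?d * ?N ^ K" using mult_left_mono[OF N1, of "eucl_norm ?d"] by simp
      finally show ?thesis .
    next
      case False
      \<comment> \<open>The Diophantine condition bounds an infimum over all integer vectors, so it
        may be evaluated at the truncation of the given \<open>m\<close>.\<close>
      define q' where "q' = Matrix.vec n (\<lambda>i. if i < l0 + m1 then 0 else q $ i)"
      define m' where "m' = Matrix.vec n (\<lambda>i. if i < l0 + m1 then 0 else m $ i)"
      have q': "q' \<in> carrier_vec n" and m': "m' \<in> carrier_vec n" by (simp_all add: q'_def m'_def)
      have "q' \<noteq> 0\<^sub>v n"
      proof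
        assume z: "q' = 0\<^sub>v n"
        have "q $ i = 0" if "l0 + m1 \<le> i" "i < n" for i
          using arg_cong[OF z, of "\<lambda>v. v $ i"] that by (simp add: q'_def)
        with False show False by blast
      qed
      then have "q' \<in> K_inf n m2" using n by (auto simp: K_inf_def q'_def)
      then have "C * eucl_norm (real_vec q') powr (- (1 + \<beta>)) \<le> (INF k \<in> carrier_vec n. eucl_norm (\<Theta> *\<^sub>v real_vec q' - (2 * pi) \<cdot>\<^sub>v real_vec k))"
        by (rule dio')
      also have "\<dots> \<le> eucl_norm (\<Theta> *\<^sub>v real_vec q' - (2 * pi) \<cdot>\<^sub>v real_vec m')"
        by (intro cINF_lower m' bdd_belowI[of _ 0]) auto
      also have "\<dots> \<le> eucl_norm ?d"
      proof (rule eucl_norm_mono)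
        fix i assume "i < dim_vec ?d"
        then have i: "i < n" using dim by simp
        have e1: "?d $ i = (\<Sum>j<n. \<Theta> $$ (i, j) * of_int (q $ j)) - 2 * pi * of_int (m $ i)"
          using i q m \<Theta> mv[OF q i] by simp
        have e2: "(\<Theta> *\<^sub>v real_vec q' - (2 * pi) \<cdot>\<^sub>v real_vec m') $ i = (\<Sum>j<n. \<Theta> $$ (i, j) * of_int (q' $ j)) - 2 * pi * of_int (m' $ i)"
          using i q' m' \<Theta> mv[OF q' i] by simp
        show "\<bar>(\<Theta> *\<^sub>v real_vec q' - (2 * pi) \<cdot>\<^sub>v real_vec m') $ i\<bar> \<le> \<bar>?d $ i\<bar>"
        proof (cases "i < l0 + m1")
          case True
          have "(\<Sum>j<n. \<Theta> $$ (i, j) * of_int (q' $ j)) = 0"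
            by (rule sum.neutral) (use True z1 in \<open>auto simp: q'_def\<close>)
          then show ?thesis unfolding e2 using True i by (simp add: m'_def)
        next
          case False
          have "(\<Sum>j<n. \<Theta> $$ (i, j) * of_int (q' $ j)) = (\<Sum>j<n. \<Theta> $$ (i, j) * of_int (q $ j))"
            by (rule sum.cong) (use False i z2 in \<open>auto simp: q'_def\<close>)
          then show ?thesis unfolding e1 e2 using False i by (simp add: m'_def)
        qed
      qed (use dim m' in simp)
      finally have le: "C * eucl_norm (real_vec q') powr (- (1 + \<beta>)) \<le> eucl_norm ?d" .
      have qq: "eucl_norm (real_vec q') \<le> eucl_norm (real_vec q)"
        by (rule eucl_norm_mono) (use q in \<open>auto simp: q'_def\<close>)
      obtain i where i: "i < n" "q' $ i \<noteq> 0"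
        using \<open>q' \<noteq> 0\<^sub>v n\<close> q' by (metis carrier_vecD eq_vecI index_zero_vec)
      have "0 < \<bar>real_vec q' $ i\<bar>" using i q' by simp
      also have "\<dots> \<le> eucl_norm (real_vec q')" using i q' by (intro abs_index_le_eucl_norm) simp
      finally have pos: "eucl_norm (real_vec q') > 0" .
      have "eucl_norm (real_vec q') powr (1 + \<beta>) \<le> ?N powr (1 + \<beta>)"
        using qq pos \<beta> by (intro powr_mono2) auto
      \<comment> \<open>Rounding the exponent up to a natural number requires a base of at least 1,
        which the summand 1 in the weight ensures.\<close>
      also have "\<dots> \<le> ?N powr (real K)" using K by (intro powr_mono) auto
      also have "\<dots> = ?N ^ K" by (intro powr_realpow add_pos_nonneg) auto
      finally have "eucl_norm (real_vec q') powr (1 + \<beta>) \<le> ?N ^ K" .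
      have "c \<le> C" by (simp add: c_def)
      also have "C = C * eucl_norm (real_vec q') powr (- (1 + \<beta>)) * eucl_norm (real_vec q') powr (1 + \<beta>)"
        using pos by (simp add: mult.assoc flip: powr_add)
      also have "\<dots> \<le> eucl_norm ?d * ?N ^ K"
        by (rule mult_mono) (use le \<open>eucl_norm (real_vec q') powr (1 + \<beta>) \<le> ?N ^ K\<close> C in auto)
      finally show ?thesis .
    qed
  qed
  then show ?thesis using c by blast
qed

section \<open>Traces of absolutely summable matrices\<close>

lemma nc_norm_factor_pos: "nc_norm_factor n > 0"
  by (simp add: nc_norm_factor_def)

lemma H_space_summable: "a \<in> H_space n \<Longrightarrow> (\<lambda>k. (norm (a k))\<^sup>2) summable_on carrier_vec n"
  by (simp add: H_space_def)

lemma H_inner_summable: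
  assumes "a \<in> H_space n" "b \<in> H_space n"
  shows "(\<lambda>k. cnj (a k) * b k) summable_on carrier_vec n"
proof (rule summable_on_norm_comparison)
  show "(\<lambda>k. (norm (a k))\<^sup>2 + (norm (b k))\<^sup>2) summable_on carrier_vec n"
    using assms by (intro summable_on_add H_space_summable)
  fix k
  have "2 * norm (a k) * norm (b k) \<le> (norm (a k))\<^sup>2 + (norm (b k))\<^sup>2" by (rule sum_squares_bound)
  moreover have "0 \<le> norm (a k) * norm (b k)" by simp
  ultimately show "norm (cnj (a k) * b k) \<le> (norm (a k))\<^sup>2 + (norm (b k))\<^sup>2"
    unfolding norm_mult complex_mod_cnj by linarith
qed

lemma H_space_lincomb:
  assumes "a \<in> H_space n" "b \<in> H_space n"
  shows "(\<lambda>k. c * a k + d * b k) \<in> H_space n"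
proof -
  have "(\<lambda>k. norm ((norm (c * a k + d * b k))\<^sup>2)) summable_on carrier_vec n"
  proof (rule Infinite_Sum.abs_summable_on_comparison_test')
    show "(\<lambda>k. 2 * (norm c)\<^sup>2 * (norm (a k))\<^sup>2 + 2 * (norm d)\<^sup>2 * (norm (b k))\<^sup>2) summable_on carrier_vec n"
      using assms by (intro summable_on_add summable_on_cmult_right H_space_summable)
    fix k
    have "(norm (c * a k + d * b k))\<^sup>2 \<le> (norm (c * a k) + norm (d * b k))\<^sup>2"
      by (intro power_mono norm_triangle_ineq) simp
    also have "\<dots> \<le> 2 * (norm (c * a k))\<^sup>2 + 2 * (norm (d * b k))\<^sup>2"
      using sum_squares_bound[of "norm (c * a k)" "norm (d * b k)"] by (simp add: power2_sum)
    finally show "norm ((norm (c * a k + d * b k))\<^sup>2) \<le> 2 * (norm c)\<^sup>2 * (norm (a k))\<^sup>2 + 2 * (norm d)\<^sup>2 * (norm (b k))\<^sup>2"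
      by (simp add: norm_mult power_mult_distrib)
  qed
  then show ?thesis using assms by (simp add: H_space_def)
qed

lemma H_inner_lincomb_right:
  assumes "e \<in> H_space n" "a \<in> H_space n" "b \<in> H_space n"
  shows "H_inner n e (\<lambda>k. c * a k + d * b k) = c * H_inner n e a + d * H_inner n e b"
proof -
  have "(\<Sum>\<^sub>\<infinity>k\<in>carrier_vec n. cnj (e k) * (c * a k + d * b k)) =
      (\<Sum>\<^sub>\<infinity>k\<in>carrier_vec n. c * (cnj (e k) * a k) + d * (cnj (e k) * b k))"
    by (simp add: algebra_simps)
  also have "\<dots> = c * (\<Sum>\<^sub>\<infinity>k\<in>carrier_vec n. cnj (e k) * a k) + d * (\<Sum>\<^sub>\<infinity>k\<in>carrier_vec n. cnj (e k) * b k)"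
    using assms by (subst infsum_add) (auto intro!: summable_on_cmult_right H_inner_summable simp: infsum_cmult_right')
  finally show ?thesis by (simp add: H_inner_def algebra_simps)
qed

lemma H_inner_cnj: "cnj (H_inner n a b) = H_inner n b a"
  by (simp add: H_inner_def mult.commute flip: infsum_cnj)

lemma H_inner_self:
  assumes "a \<in> H_space n"
  shows "H_inner n a a = of_real ((H_norm n a)\<^sup>2)"
proof -
  have "complex_of_real ((norm (a k))\<^sup>2) = cnj (a k) * a k" for k
    by (simp only: complex_norm_square mult.commute)
  then have "H_inner n a a = of_real ((nc_norm_factor n)\<^sup>2 * (\<Sum>\<^sub>\<infinity>k\<in>carrier_vec n. (norm (a k))\<^sup>2))"
    by (simp add: H_inner_def infsum_complex_of_real[symmetric])
  moreover have "(H_norm n a)\<^sup>2 = (nc_norm_factor n)\<^sup>2 * (\<Sum>\<^sub>\<infinity>k\<in>carrier_vec n. (norm (a k))\<^sup>2)"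
    unfolding H_norm_eq[OF assms] power_mult_distrib by (simp add: infsum_nonneg)
  ultimately show ?thesis by simp
qed

lemma H_norm_lincomb:
  assumes a: "a \<in> H_space n" and b: "b \<in> H_space n"
  shows "complex_of_real ((H_norm n (\<lambda>k. a k + c * b k))\<^sup>2) =
    of_real ((H_norm n a)\<^sup>2) + c * H_inner n a b + cnj c * H_inner n b a + c * cnj c * of_real ((H_norm n b)\<^sup>2)"
proof -
  let ?u = "\<lambda>k. 1 * a k + c * b k"
  have u: "?u \<in> H_space n" by (rule H_space_lincomb[OF a b])
  have l: "H_inner n ?u x = H_inner n a x + cnj c * H_inner n b x" if "x \<in> H_space n" for x
  proof -
    have "H_inner n ?u x = cnj (H_inner n x ?u)" by (rule H_inner_cnj[symmetric])
    also have "\<dots> = cnj (1 * H_inner n x a + c * H_inner n x b)"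
      unfolding H_inner_lincomb_right[OF that a b] ..
    finally show ?thesis by (simp add: H_inner_cnj)
  qed
  have "complex_of_real ((H_norm n ?u)\<^sup>2) = H_inner n ?u ?u" by (rule H_inner_self[OF u, symmetric])
  also have "\<dots> = 1 * H_inner n ?u a + c * H_inner n ?u b"
    by (rule H_inner_lincomb_right[OF u a b])
  finally have "complex_of_real ((H_norm n ?u)\<^sup>2) =
      (H_inner n a a + cnj c * H_inner n b a) + c * (H_inner n a b + cnj c * H_inner n b b)"
    unfolding l[OF a] l[OF b] by simp
  then show ?thesis unfolding H_inner_self[OF a] H_inner_self[OF b] by (simp add: algebra_simps)
qed

text \<open>Pythagoras, with the excess caused by coefficients other than the Fourier ones. They are
  arbitrary because the definition of a basis supplies approximations with unspecified coefficients.
  The second conjunct carries the induction: subtracting some components leaves the other Fourier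
  coefficients unchanged.\<close>

lemma H_norm_diff_orthonormal:
  assumes E: "E \<subseteq> H_space n" "\<forall>e\<in>E. \<forall>f\<in>E. H_inner n e f = (if e = f then 1 else 0)"
    and a: "a \<in> H_space n" and F: "finite F" "F \<subseteq> E"
  shows "(\<lambda>k. a k - (\<Sum>e\<in>F. c e * e k)) \<in> H_space n \<and>
    (\<forall>f\<in>E - F. H_inner n f (\<lambda>k. a k - (\<Sum>e\<in>F. c e * e k)) = H_inner n f a) \<and>
    (H_norm n (\<lambda>k. a k - (\<Sum>e\<in>F. c e * e k)))\<^sup>2 =
      (H_norm n a)\<^sup>2 - (\<Sum>e\<in>F. (norm (H_inner n e a))\<^sup>2) + (\<Sum>e\<in>F. (norm (c e - H_inner n e a))\<^sup>2)"
  using F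
proof (induction F rule: finite_induct)
  case empty
  then show ?case using a by simp
next
  case (insert f F)
  let ?b = "\<lambda>k. a k - (\<Sum>e\<in>F. c e * e k)"
  have f: "f \<in> H_space n" "f \<in> E" using insert.prems E by auto
  have b: "?b \<in> H_space n" and fb: "H_inner n f ?b = H_inner n f a"
    using insert f by auto
  have eq: "(\<lambda>k. a k - (\<Sum>e\<in>insert f F. c e * e k)) = (\<lambda>k. 1 * ?b k + (- c f) * f k)"
    using insert.hyps by (auto simp: fun_eq_iff)
  have "(\<lambda>k. 1 * ?b k + (- c f) * f k) \<in> H_space n" by (rule H_space_lincomb[OF b f(1)])
  moreover have "H_inner n g (\<lambda>k. 1 * ?b k + (- c f) * f k) = H_inner n g a" if "g \<in> E - insert f F" for g
    using that insert E f b by (subst H_inner_lincomb_right) auto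
  moreover have "(H_norm n (\<lambda>k. 1 * ?b k + (- c f) * f k))\<^sup>2 =
      (H_norm n ?b)\<^sup>2 - (norm (H_inner n f a))\<^sup>2 + (norm (c f - H_inner n f a))\<^sup>2"
  proof -
    have "H_norm n f ^ 2 = 1" using H_inner_self[OF f(1)] E(2) f(2) by (metis of_real_eq_1_iff)
    then have "complex_of_real ((H_norm n (\<lambda>k. ?b k + (- c f) * f k))\<^sup>2) =
      of_real ((H_norm n ?b)\<^sup>2) - c f * cnj (H_inner n f a) - cnj (c f) * H_inner n f a + c f * cnj (c f)"
      unfolding H_norm_lincomb[OF b f(1)] fb[symmetric] H_inner_cnj by simp
    also have "\<dots> = of_real ((H_norm n ?b)\<^sup>2) - H_inner n f a * cnj (H_inner n f a)
        + (c f - H_inner n f a) * cnj (c f - H_inner n f a)"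
      by (simp add: algebra_simps)
    also have "\<dots> = of_real ((H_norm n ?b)\<^sup>2 - (norm (H_inner n f a))\<^sup>2 + (norm (c f - H_inner n f a))\<^sup>2)"
      unfolding complex_norm_square[symmetric] by simp
    finally show ?thesis unfolding of_real_eq_iff by simp
  qed
  ultimately show ?case using insert unfolding eq by simp
qed

text \<open>Fourier coefficients give Bessel's inequality. Conversely, an approximating combination
  is never closer than the projection with the same finite support, so density forces
  equality.\<close>

lemma parseval:
  assumes E: "orthonormal_basis n E" and a: "a \<in> H_space n"
  shows "((\<lambda>e. (norm (H_inner n e a))\<^sup>2) has_sum (H_norm n a)\<^sup>2) E"
proof -
  have E': "E \<subseteq> H_space n" "\<forall>e\<in>E. \<forall>f\<in>E. H_inner n e f = (if e = f then 1 else 0)"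
    using E unfolding orthonormal_basis_def by blast+
  note H = H_norm_diff_orthonormal[OF E' a]
  let ?w = "\<lambda>e. (norm (H_inner n e a))\<^sup>2"
  have bessel: "sum ?w F \<le> (H_norm n a)\<^sup>2" if F: "finite F" "F \<subseteq> E" for F
  proof -
    have "0 \<le> (H_norm n (\<lambda>k. a k - (\<Sum>e\<in>F. H_inner n e a * e k)))\<^sup>2" by simp
    also have "\<dots> = (H_norm n a)\<^sup>2 - sum ?w F"
      using H[OF F, of "\<lambda>e. H_inner n e a"] by simp
    finally show ?thesis by simp
  qed
  have s: "?w summable_on E"
    by (rule nonneg_bdd_above_summable_on) (use bessel in \<open>auto intro!: bdd_aboveI[of _ "(H_norm n a)\<^sup>2"]\<close>)
  have "(H_norm n a)\<^sup>2 \<le> infsum ?w E"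
  proof (rule field_le_epsilon)
    fix d :: real assume d: "d > 0"
    then obtain F c where F: "finite F" "F \<subseteq> E" and lt: "H_norm n (\<lambda>k. a k - (\<Sum>e\<in>F. c e * e k)) < sqrt d"
      using E a unfolding orthonormal_basis_def by (meson real_sqrt_gt_0_iff)
    have "0 \<le> H_norm n (\<lambda>k. a k - (\<Sum>e\<in>F. c e * e k))"
      using H[OF F, of c] nc_norm_factor_pos[of n]
      by (subst H_norm_eq) (auto intro!: mult_nonneg_nonneg infsum_nonneg)
    then have "(H_norm n (\<lambda>k. a k - (\<Sum>e\<in>F. c e * e k)))\<^sup>2 \<le> (sqrt d)\<^sup>2"
      using lt by (intro power_mono) auto
    then have "(H_norm n a)\<^sup>2 - sum ?w F + (\<Sum>e\<in>F. (norm (c e - H_inner n e a))\<^sup>2) \<le> d"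
      using H[OF F, of c] d by simp
    moreover have "0 \<le> (\<Sum>e\<in>F. (norm (c e - H_inner n e a))\<^sup>2)" by (intro sum_nonneg) simp
    moreover have "sum ?w F \<le> infsum ?w E" by (rule finite_sum_le_infsum[OF s F]) simp
    ultimately show "(H_norm n a)\<^sup>2 \<le> infsum ?w E + d" by linarith
  qed
  moreover have "infsum ?w E \<le> (H_norm n a)\<^sup>2"
    by (rule infsum_le_finite_sums[OF s bessel])
  ultimately have "infsum ?w E = (H_norm n a)\<^sup>2" by simp
  then show ?thesis using has_sum_infsum[OF s] by simp
qed

text \<open>Over the fourth roots of unity the sums of c and of c^2 vanish while that of |c|^2 is 4,
  which isolates one of the two cross terms.\<close>

lemma four_roots_polarization:
  fixes w v :: complex
  shows "4 * (w * cnj v) = (\<Sum>c\<leftarrow>[1, -1, \<i>, -\<i>]. c * of_real ((norm (w + c * v))\<^sup>2))"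
  unfolding complex_norm_square by (simp add: algebra_simps)

lemma parseval_inner:
  assumes E: "orthonormal_basis n E" and a: "a \<in> H_space n" and b: "b \<in> H_space n"
  shows "((\<lambda>e. H_inner n e a * cnj (H_inner n e b)) has_sum H_inner n b a) E"
proof -
  have EH: "e \<in> H_space n" if "e \<in> E" for e using E that by (auto simp: orthonormal_basis_def)
  have *: "((\<lambda>e. c * of_real ((norm (H_inner n e a + c * H_inner n e b))\<^sup>2)) has_sum
      c * of_real ((H_norm n (\<lambda>k. a k + c * b k))\<^sup>2)) E" for c
  proof -
    have u: "(\<lambda>k. a k + c * b k) \<in> H_space n" using H_space_lincomb[OF a b, of 1 c] by simp
    have eq: "H_inner n e (\<lambda>k. a k + c * b k) = H_inner n e a + c * H_inner n e b" if "e \<in> E" for e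
      using H_inner_lincomb_right[OF EH[OF that] a b, of 1 c] by simp
    have "((\<lambda>e. c * of_real ((norm (H_inner n e (\<lambda>k. a k + c * b k)))\<^sup>2)) has_sum
      c * of_real ((H_norm n (\<lambda>k. a k + c * b k))\<^sup>2)) E"
      by (intro has_sum_cmult_right has_sum_of_real parseval[OF E u])
    then show ?thesis
      by (rule has_sum_cong[THEN iffD1, rotated]) (simp add: eq)
  qed
  have "((\<lambda>e. \<Sum>c\<leftarrow>[1, -1, \<i>, -\<i>]. c * of_real ((norm (H_inner n e a + c * H_inner n e b))\<^sup>2)) has_sum
      (\<Sum>c\<leftarrow>[1, -1, \<i>, -\<i>]. c * of_real ((H_norm n (\<lambda>k. a k + c * b k))\<^sup>2))) E"
    unfolding list.map sum_list.Cons sum_list.Nil by (intro has_sum_add * has_sum_0) auto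
  moreover have "(\<Sum>c\<leftarrow>[1, -1, \<i>, -\<i>]. c * of_real ((H_norm n (\<lambda>k. a k + c * b k))\<^sup>2)) = 4 * H_inner n b a"
    unfolding H_norm_lincomb[OF a b] by (simp add: algebra_simps)
  ultimately have "((\<lambda>e. 4 * (H_inner n e a * cnj (H_inner n e b))) has_sum 4 * H_inner n b a) E"
    unfolding four_roots_polarization by simp
  from has_sum_cmult_right[OF this, of "1 / 4"] show ?thesis by simp
qed

section \<open>From an absolutely summable matrix to the trace in every basis\<close>

lemma H_space_abs_le:
  assumes a: "a \<in> H_space n"
  shows "norm (a k) \<le> sqrt (\<Sum>\<^sub>\<infinity>k\<in>carrier_vec n. (norm (a k))\<^sup>2)"
proof (cases "k \<in> carrier_vec n")
  case True
  have "(norm (a k))\<^sup>2 = sum (\<lambda>k. (norm (a k))\<^sup>2) {k}" by simp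
  also have "\<dots> \<le> (\<Sum>\<^sub>\<infinity>k\<in>carrier_vec n. (norm (a k))\<^sup>2)"
    by (rule finite_sum_le_infsum[OF H_space_summable[OF a]]) (use True in auto)
  finally show ?thesis by (rule real_le_rsqrt)
next
  case False
  then show ?thesis using a by (simp add: H_space_def infsum_nonneg)
qed

lemma summable_on_Times_rows:
  fixes f :: "'a \<Rightarrow> 'b \<Rightarrow> real"
  assumes "(\<lambda>(x, y). f x y) summable_on X \<times> Y"
  shows "\<And>x. x \<in> X \<Longrightarrow> f x summable_on Y" "(\<lambda>x. infsum (f x) Y) summable_on X"
  using summable_on_SigmaD1[OF assms] summable_on_Sigma_banach[OF assms] by auto

text \<open>For a basis E, <e, T e> is the sum over j, k of M(j, k) <e, U_j> <U_k, e>. Parseval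
  gives sum 1 over e if j = k and 0 otherwise, so exchanging the sums leaves the diagonal of
  \<open>M\<close>.\<close>

lemma has_trace_matrix:
  fixes M :: "int vec \<Rightarrow> int vec \<Rightarrow> complex"
  assumes M: "(\<lambda>(j, k). norm (M j k)) summable_on carrier_vec n \<times> carrier_vec n"
    and T: "\<And>a. a \<in> H_space n \<Longrightarrow>
      T a = (\<lambda>j. if j \<in> carrier_vec n then \<Sum>\<^sub>\<infinity>k\<in>carrier_vec n. M j k * a k else 0)"
  shows "has_trace n T (\<Sum>\<^sub>\<infinity>k\<in>carrier_vec n. M k k)"
proof -
  let ?A = "carrier_vec n :: int vec set" and ?f = "nc_norm_factor n"
  define N where "N a = sqrt (\<Sum>\<^sub>\<infinity>k\<in>?A. (norm (a k))\<^sup>2)" for a :: coeffs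
  have N: "norm (a k) \<le> N a" if "a \<in> H_space n" for a k
    unfolding N_def by (rule H_space_abs_le[OF that])
  have N0: "0 \<le> N a" for a by (simp add: N_def infsum_nonneg)
  \<comment> \<open>The row sums \<rho> are summable, hence bounded by their total, hence square
    summable. With |(T a) j| <= N(a) \<rho>(j) this yields boundedness of \<open>T\<close>.\<close>
  define \<rho> where "\<rho> j = (\<Sum>\<^sub>\<infinity>k\<in>?A. norm (M j k))" for j
  have rows: "(\<lambda>k. norm (M j k)) summable_on ?A" if "j \<in> ?A" for j
    using summable_on_Times_rows(1)[OF M that] .
  have \<rho>s: "\<rho> summable_on ?A" unfolding \<rho>_def using summable_on_Times_rows(2)[OF M] .
  have \<rho>0: "0 \<le> \<rho> j" for j by (simp add: \<rho>_def infsum_nonneg)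
  have row_le: "norm (M j k * a k) \<le> norm (M j k) * N a" if "a \<in> H_space n" for a j k
    using N[OF that, of k] by (simp add: norm_mult mult_left_mono)
  have Ms: "(\<lambda>k. M j k * a k) summable_on ?A" if "a \<in> H_space n" "j \<in> ?A" for a j
    by (rule summable_on_norm_comparison[OF summable_on_cmult_left[OF rows[OF that(2)], of "N a"] row_le[OF that(1)]])
  have Tb: "norm (T a j) \<le> N a * \<rho> j" if a: "a \<in> H_space n" for a j
  proof (cases "j \<in> ?A")
    case True
    have "norm (T a j) = norm (\<Sum>\<^sub>\<infinity>k\<in>?A. M j k * a k)" using True by (simp add: T[OF a])
    also have "\<dots> \<le> (\<Sum>\<^sub>\<infinity>k\<in>?A. norm (M j k) * N a)"
      by (rule norm_infsum_le[OF has_sum_infsum[OF Ms[OF a True]] has_sum_infsum row_le[OF a]])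
         (rule summable_on_cmult_left[OF rows[OF True]])
    finally show ?thesis unfolding infsum_cmult_left' \<rho>_def by (simp add: mult.commute)
  next
    case False
    then show ?thesis using N0 \<rho>0 by (simp add: T[OF a])
  qed
  have \<rho>_le: "\<rho> j \<le> infsum \<rho> ?A" if "j \<in> ?A" for j
    using finite_sum_le_infsum[OF \<rho>s, of "{j}"] \<rho>0 that by simp
  have \<rho>2: "(\<lambda>j. (\<rho> j)\<^sup>2) summable_on ?A"
    by (rule summable_on_norm_comparison[OF summable_on_cmult_right[OF \<rho>s, of "infsum \<rho> ?A"]])
       (use \<rho>0 \<rho>_le in \<open>auto simp: power2_eq_square intro!: mult_right_mono\<close>)
  define R where "R = (\<Sum>\<^sub>\<infinity>j\<in>?A. (\<rho> j)\<^sup>2)"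
  have T2s: "(\<lambda>j. (norm (T a j))\<^sup>2) summable_on ?A" and T2: "(\<Sum>\<^sub>\<infinity>j\<in>?A. (norm (T a j))\<^sup>2) \<le> (N a)\<^sup>2 * R"
    if a: "a \<in> H_space n" for a
  proof -
    have le: "(norm (T a j))\<^sup>2 \<le> (N a)\<^sup>2 * (\<rho> j)\<^sup>2" for j
      using power_mono[OF Tb[OF a, of j], of 2] by (simp add: power_mult_distrib)
    have s: "(\<lambda>j. (N a)\<^sup>2 * (\<rho> j)\<^sup>2) summable_on ?A" by (rule summable_on_cmult_right[OF \<rho>2])
    show s': "(\<lambda>j. (norm (T a j))\<^sup>2) summable_on ?A"
      by (rule summable_on_norm_comparison[OF s]) (use le in simp)
    show "(\<Sum>\<^sub>\<infinity>j\<in>?A. (norm (T a j))\<^sup>2) \<le> (N a)\<^sup>2 * R"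
      unfolding R_def infsum_cmult_right'[symmetric] by (rule infsum_mono[OF s' s le])
  qed
  have TH: "T a \<in> H_space n" if "a \<in> H_space n" for a
    using T2s[OF that] T[OF that] by (simp add: H_space_def)
  have R0: "0 \<le> R" by (simp add: R_def infsum_nonneg)
  have bounded: "bounded_operator n T"
    unfolding bounded_operator_def
  proof (intro conjI ballI allI)
    fix a b c d assume a: "a \<in> H_space n" and b: "b \<in> H_space n"
    show "T (\<lambda>k. c * a k + d * b k) = (\<lambda>k. c * T a k + d * T b k)"
    proof
      fix j
      show "T (\<lambda>k. c * a k + d * b k) j = c * T a j + d * T b j"
      proof (cases "j \<in> ?A")
        case True
        have "(\<Sum>\<^sub>\<infinity>k\<in>?A. M j k * (c * a k + d * b k)) = (\<Sum>\<^sub>\<infinity>k\<in>?A. c * (M j k * a k) + d * (M j k * b k))"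
          by (simp add: algebra_simps)
        also have "\<dots> = c * (\<Sum>\<^sub>\<infinity>k\<in>?A. M j k * a k) + d * (\<Sum>\<^sub>\<infinity>k\<in>?A. M j k * b k)"
          by (subst infsum_add) (auto intro!: summable_on_cmult_right Ms a b True simp: infsum_cmult_right')
        finally show ?thesis using True by (simp add: T[OF a] T[OF b] T[OF H_space_lincomb[OF a b]])
      qed (simp add: T[OF a] T[OF b] T[OF H_space_lincomb[OF a b]])
    qed
  next
    show "\<exists>B. \<forall>a\<in>H_space n. H_norm n (T a) \<le> B * H_norm n a"
    proof (intro exI ballI)
      fix a assume a: "a \<in> H_space n"
      have "sqrt (\<Sum>\<^sub>\<infinity>j\<in>?A. (norm (T a j))\<^sup>2) \<le> sqrt ((N a)\<^sup>2 * R)" by (rule real_sqrt_le_mono[OF T2[OF a]])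
      also have "\<dots> = N a * sqrt R" using N0 by (simp add: real_sqrt_mult)
      finally have "?f * sqrt (\<Sum>\<^sub>\<infinity>j\<in>?A. (norm (T a j))\<^sup>2) \<le> ?f * (N a * sqrt R)"
        using nc_norm_factor_pos[of n] by (intro mult_left_mono) auto
      then show "H_norm n (T a) \<le> sqrt R * H_norm n a"
        unfolding H_norm_eq[OF a] H_norm_eq[OF TH[OF a]] N_def[symmetric] by (simp add: mult_ac)
    qed
  qed (rule TH)
  moreover have "((\<lambda>e. H_inner n e (T e)) has_sum (\<Sum>\<^sub>\<infinity>k\<in>?A. M k k)) E" if E: "orthonormal_basis n E" for E
  proof -
    have EH: "e \<in> H_space n" if "e \<in> E" for e using E that by (auto simp: orthonormal_basis_def)
    define w where "w e k = H_inner n e (nc_U n k)" for e k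
    have w: "w e k = of_real ?f * cnj (e k)" if "k \<in> ?A" for e k
      unfolding w_def H_inner_cnj[symmetric, of n e] H_inner_nc_U_left[OF that] by simp
    have ww: "((\<lambda>e. w e j * cnj (w e k)) has_sum (if j = k then 1 else 0)) E" if "j \<in> ?A" "k \<in> ?A" for j k
      using parseval_inner[OF E nc_U_in_H_space nc_U_in_H_space, OF that] nc_U_orthonormal[OF that(2,1)]
      unfolding w_def by (auto split: if_splits)
    have w1: "((\<lambda>e. (norm (w e k))\<^sup>2) has_sum 1) E" if k: "k \<in> ?A" for k
    proof -
      have "((\<lambda>e. complex_of_real ((norm (w e k))\<^sup>2)) has_sum of_real 1) E"
        unfolding complex_norm_square using ww[OF k k] by simp
      then show ?thesis using has_sum_Re by fastforce
    qed
    define \<Phi> where "\<Phi> p e = (case p of (j, k) \<Rightarrow> M j k * (w e j * cnj (w e k)))" for p e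
    have \<Phi>n: "norm (\<Phi> (j, k) e) \<le> norm (M j k) * ((norm (w e j))\<^sup>2 + (norm (w e k))\<^sup>2)" for j k e
    proof -
      have "norm (w e j) * norm (w e k) \<le> (norm (w e j))\<^sup>2 + (norm (w e k))\<^sup>2"
        using sum_squares_bound[of "norm (w e j)" "norm (w e k)"]
          mult_nonneg_nonneg[OF norm_ge_zero[of "w e j"] norm_ge_zero[of "w e k"]] by linarith
      then show ?thesis by (simp add: \<Phi>_def norm_mult mult_left_mono)
    qed
    \<comment> \<open>The product |w(e, j)| |w(e, k)| is replaced by a sum of squares, and each
      square has sum 1 over the basis. The resulting total 2 |M(j, k)| is summable by
      hypothesis.\<close>
    have dom: "(\<lambda>(p, e). case p of (j, k) \<Rightarrow> norm (M j k) * ((norm (w e j))\<^sup>2 + (norm (w e k))\<^sup>2)) summable_on (?A \<times> ?A) \<times> E"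
    proof (rule summable_on_SigmaI[where g = "\<lambda>(j, k). norm (M j k) * (1 + 1)"])
      fix p assume "p \<in> ?A \<times> ?A"
      then obtain j k where p: "p = (j, k)" "j \<in> ?A" "k \<in> ?A" by auto
      show "((\<lambda>e. case (p, e) of (p, e) \<Rightarrow> case p of (j, k) \<Rightarrow> norm (M j k) * ((norm (w e j))\<^sup>2 + (norm (w e k))\<^sup>2))
         has_sum (case p of (j, k) \<Rightarrow> norm (M j k) * (1 + 1))) E"
        unfolding p case_prod_conv by (intro has_sum_cmult_right has_sum_add w1 p)
    next
      have "(\<lambda>p. (case p of (j, k) \<Rightarrow> norm (M j k)) * (1 + 1)) summable_on ?A \<times> ?A"
        by (rule summable_on_cmult_left[OF M])
      then show "(\<lambda>(j, k). norm (M j k) * (1 + 1)) summable_on ?A \<times> ?A"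
        by (simp add: case_prod_unfold)
    qed auto
    have s\<Phi>: "(\<lambda>(p, e). \<Phi> p e) summable_on (?A \<times> ?A) \<times> E"
      by (rule summable_on_norm_comparison[OF dom]) (use \<Phi>n in auto)
    then have s\<Phi>': "(\<lambda>(e, p). \<Phi> p e) summable_on E \<times> (?A \<times> ?A)"
      by (subst (asm) summable_on_swap) simp
    have total: "((\<lambda>e. \<Sum>\<^sub>\<infinity>p\<in>?A \<times> ?A. \<Phi> p e) has_sum infsum (\<lambda>(e, p). \<Phi> p e) (E \<times> (?A \<times> ?A))) E"
      using has_sum_SigmaD[OF has_sum_infsum[OF s\<Phi>'], of "\<lambda>e. \<Sum>\<^sub>\<infinity>p\<in>?A \<times> ?A. \<Phi> p e"]
        summable_on_SigmaD1[OF s\<Phi>'] by (simp add: has_sum_infsum)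
    have "infsum (\<lambda>(e, p). \<Phi> p e) (E \<times> (?A \<times> ?A)) = (\<Sum>\<^sub>\<infinity>p\<in>?A \<times> ?A. \<Sum>\<^sub>\<infinity>e\<in>E. \<Phi> p e)"
      using infsum_Sigma'_banach[OF s\<Phi>'] infsum_swap_banach[OF s\<Phi>'] by simp
    also have "\<dots> = (\<Sum>\<^sub>\<infinity>p\<in>?A \<times> ?A. case p of (j, k) \<Rightarrow> M j k * (if j = k then 1 else 0))"
      by (rule infsum_cong) (auto simp: \<Phi>_def intro!: infsumI has_sum_cmult_right ww[THEN has_sum_cong[THEN iffD1, rotated]])
    also have "\<dots> = (\<Sum>\<^sub>\<infinity>p\<in>(\<lambda>k. (k, k)) ` ?A. case p of (j, k) \<Rightarrow> M j k)"
      by (rule infsum_cong_neutral) auto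
    also have "\<dots> = (\<Sum>\<^sub>\<infinity>k\<in>?A. M k k)"
      by (subst infsum_reindex) (auto simp: inj_on_def o_def)
    finally have val: "infsum (\<lambda>(e, p). \<Phi> p e) (E \<times> (?A \<times> ?A)) = (\<Sum>\<^sub>\<infinity>k\<in>?A. M k k)" .
    have eq: "(\<Sum>\<^sub>\<infinity>p\<in>?A \<times> ?A. \<Phi> p e) = H_inner n e (T e)" if e: "e \<in> E" for e
    proof -
      have "(\<lambda>(j, k). \<Phi> (j, k) e) summable_on ?A \<times> ?A"
        using summable_on_SigmaD1[OF s\<Phi>' e] by (simp add: case_prod_unfold)
      from infsum_Sigma'_banach[OF this]
      have "(\<Sum>\<^sub>\<infinity>p\<in>?A \<times> ?A. \<Phi> p e) = (\<Sum>\<^sub>\<infinity>j\<in>?A. \<Sum>\<^sub>\<infinity>k\<in>?A. \<Phi> (j, k) e)"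
        by (simp add: case_prod_unfold)
      also have "\<dots> = (\<Sum>\<^sub>\<infinity>j\<in>?A. of_real (?f\<^sup>2) * (cnj (e j) * T e j))"
      proof (rule infsum_cong)
        fix j assume j: "j \<in> ?A"
        have "(\<Sum>\<^sub>\<infinity>k\<in>?A. \<Phi> (j, k) e) = (\<Sum>\<^sub>\<infinity>k\<in>?A. (of_real (?f\<^sup>2) * cnj (e j)) * (M j k * e k))"
          by (rule infsum_cong) (simp add: \<Phi>_def w j power2_eq_square mult_ac)
        also have "\<dots> = (of_real (?f\<^sup>2) * cnj (e j)) * T e j"
          unfolding infsum_cmult_right' using j by (simp add: T[OF EH[OF e]])
        finally show "(\<Sum>\<^sub>\<infinity>k\<in>?A. \<Phi> (j, k) e) = of_real (?f\<^sup>2) * (cnj (e j) * T e j)" by (simp add: mult.assoc)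
      qed
      also have "\<dots> = H_inner n e (T e)" unfolding infsum_cmult_right' H_inner_def ..
      finally show ?thesis .
    qed
    show ?thesis using total unfolding val by (rule has_sum_cong[THEN iffD1, rotated]) (rule eq)
  qed
  ultimately show ?thesis by (simp add: has_trace_def)
qed

section \<open>Smooth elements\<close>

lemma summable_inverse_one_plus_square_int: "(\<lambda>m::int. 1 / (1 + (real_of_int m)\<^sup>2)) summable_on UNIV"
proof -
  have "(\<lambda>k::nat. 1 / (1 + (real k)\<^sup>2)) summable_on UNIV"
  proof (rule norm_summable_imp_summable_on)
    have s: "summable (\<lambda>k::nat. inverse (real k ^ 2))" by (rule inverse_power_summable) simp
    show "summable (\<lambda>k::nat. norm (1 / (1 + (real k)\<^sup>2)))"
    proof (rule summable_comparison_test'[OF s, of 1])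
      fix k :: nat assume "1 \<le> k"
      then show "norm (norm (1 / (1 + (real k)\<^sup>2))) \<le> inverse (real k ^ 2)"
        using le_imp_inverse_le[of "(real k)\<^sup>2" "1 + (real k)\<^sup>2"] by (simp add: inverse_eq_divide)
    qed
  qed
  then have nat: "(\<lambda>m::int. 1 / (1 + (real_of_int m)\<^sup>2)) summable_on range int"
    by (subst summable_on_reindex) (auto simp: o_def)
  then have "(\<lambda>m::int. 1 / (1 + (real_of_int m)\<^sup>2)) summable_on uminus ` range int"
    by (subst summable_on_reindex) (auto simp: o_def)
  with nat have "(\<lambda>m::int. 1 / (1 + (real_of_int m)\<^sup>2)) summable_on (range int \<union> uminus ` range int)"
    by (rule summable_on_union)
  moreover have "range int \<union> uminus ` range int = UNIV"
    by (auto simp: image_iff) (metis int_cases2)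
  ultimately show ?thesis by simp
qed

lemma summable_prod_inverse_squares:
  "(\<lambda>k. \<Prod>i<n. 1 / (1 + (real_of_int (k $ i))\<^sup>2)) summable_on (carrier_vec n :: int vec set)"
proof (induction n)
  case 0
  have "carrier_vec 0 = {vNil :: int vec}" by auto
  then show ?case by simp
next
  case (Suc n)
  have "(\<lambda>(k, k0). (\<Prod>i<n. 1 / (1 + (real_of_int (k $ i))\<^sup>2)) * (1 / (1 + (real_of_int k0)\<^sup>2))) summable_on
      (carrier_vec n :: int vec set) \<times> UNIV"
    by (rule summable_on_Times_mult[OF Suc summable_inverse_one_plus_square_int]) (auto intro!: prod_nonneg)
  then show ?case
    unfolding summable_on_reindex_bij_betw[OF bij_betw_vCons[where 'a = int], symmetric]
    by (rule summable_on_cong[THEN iffD1, rotated]) (auto simp: prod.lessThan_Suc_shift mult.commute simp del: prod.lessThan_Suc)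
qed

text \<open>The product of the factors 1 + k_i^2 is at most (1 + |k|)^(2 n), so decay of order N + 2
  n leaves a summable product of inverse squares after the weight of order N is spent.\<close>

lemma smooth_nc_torus_summable:
  assumes "a \<in> smooth_nc_torus n"
  shows "(\<lambda>k. (1 + eucl_norm (real_vec k)) ^ N * norm (a k)) summable_on carrier_vec n"
proof -
  obtain C where C: "\<And>k. k \<in> carrier_vec n \<Longrightarrow> (1 + eucl_norm (real_vec k)) ^ (N + 2 * n) * norm (a k) \<le> C"
    using assms unfolding smooth_nc_torus_def by blast
  have "norm ((1 + eucl_norm (real_vec k)) ^ N * norm (a k)) \<le> C * (\<Prod>i<n. 1 / (1 + (real_of_int (k $ i))\<^sup>2))"
    if k: "k \<in> carrier_vec n" for k
  proof -
    let ?N = "1 + eucl_norm (real_vec k)" and ?P = "\<Prod>i<n. 1 + (real_of_int (k $ i))\<^sup>2"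
    have N: "?N \<ge> 1" by simp
    have "?P \<le> (\<Prod>i<n. ?N\<^sup>2)"
    proof (rule prod_mono)
      fix i assume "i \<in> {..<n}"
      then have "\<bar>real_vec k $ i\<bar> \<le> eucl_norm (real_vec k)" using k by (intro abs_index_le_eucl_norm) auto
      then have "(real_of_int (k $ i))\<^sup>2 \<le> (eucl_norm (real_vec k))\<^sup>2"
        using \<open>i \<in> {..<n}\<close> k by (simp add: abs_le_square_iff[symmetric])
      then show "0 \<le> 1 + (real_of_int (k $ i))\<^sup>2 \<and> 1 + (real_of_int (k $ i))\<^sup>2 \<le> ?N\<^sup>2"
        using eucl_norm_nonneg[of "real_vec k"] by (simp add: power2_sum add_increasing2)
    qed
    also have "\<dots> = ?N ^ (2 * n)" by (simp add: power_mult)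
    finally have P: "?P \<le> ?N ^ (2 * n)" .
    have "?P > 0" by (intro prod_pos) (simp add: add_pos_nonneg)
    have "?N ^ N * norm (a k) * ?P \<le> ?N ^ N * norm (a k) * ?N ^ (2 * n)"
      using P N by (intro mult_left_mono) auto
    also have "\<dots> \<le> C" using C[OF k] by (simp add: power_add mult_ac)
    finally have "?N ^ N * norm (a k) \<le> C / ?P" using \<open>?P > 0\<close> by (simp add: field_simps)
    then show ?thesis using N by (simp add: prod_dividef)
  qed
  then show ?thesis
    by (rule summable_on_norm_comparison[OF summable_on_cmult_right[OF summable_prod_inverse_squares]])
qed

lemma smooth_nc_torus_bounded:
  assumes "a \<in> smooth_nc_torus n"
  obtains C where "\<And>k. norm (a k) \<le> C"
proof -
  obtain C where C: "\<And>k. k \<in> carrier_vec n \<Longrightarrow> (1 + eucl_norm (real_vec k)) ^ 0 * norm (a k) \<le> C"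
    using assms unfolding smooth_nc_torus_def by blast
  have "norm (a k) \<le> max C 0" for k
    using C[of k] assms by (cases "k \<in> carrier_vec n") (auto simp: smooth_nc_torus_def)
  then show ?thesis by (rule that)
qed

section \<open>The heat trace\<close>

lemma laplacian_eigenvalue_form:
  assumes "ginv \<in> carrier_mat n n" "k \<in> carrier_vec n"
  shows "laplacian_eigenvalue n ginv k = real_vec k \<bullet> (ginv *\<^sub>v real_vec k)"
  using assms by (simp add: laplacian_eigenvalue_def scalar_prod_def sum_distrib_left atLeast0LessThan mult_ac)

lemma smult_mat_mult_vec:
  fixes A :: "real mat"
  assumes "A \<in> carrier_mat n n" "v \<in> carrier_vec n"
  shows "(c \<cdot>\<^sub>m A) *\<^sub>v v = c \<cdot>\<^sub>v (A *\<^sub>v v)"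
  using assms by (intro eq_vecI) auto

text \<open>The lattice formula for t g^-1 with inverse g / t. The factor 1 / t of the inverse turns
  the 4 of the dual Gaussian into 4 t, and the determinant t^n / det g supplies the
  prefactor.\<close>

lemma heat_poisson:
  assumes m: "constant_metric n g ginv" and t: "t > 0"
  shows "Determinant.det g > 0"
    and "(\<lambda>k. exp (- t * laplacian_eigenvalue n ginv k)) summable_on carrier_vec n"
    and "x \<in> carrier_vec n \<Longrightarrow>
      (\<lambda>m. exp (- ((x - (2 * pi) \<cdot>\<^sub>v real_vec m) \<bullet> (g *\<^sub>v (x - (2 * pi) \<cdot>\<^sub>v real_vec m))) / (4 * t))) summable_on carrier_vec n"
    and "x \<in> carrier_vec n \<Longrightarrow>
      (\<Sum>\<^sub>\<infinity>k\<in>carrier_vec n. of_real (exp (- t * laplacian_eigenvalue n ginv k)) * cis (real_vec k \<bullet> x)) =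
      complex_of_real (sqrt (pi ^ n * Determinant.det g / t ^ n) * (\<Sum>\<^sub>\<infinity>m\<in>carrier_vec n.
        exp (- ((x - (2 * pi) \<cdot>\<^sub>v real_vec m) \<bullet> (g *\<^sub>v (x - (2 * pi) \<cdot>\<^sub>v real_vec m))) / (4 * t))))"
proof -
  have g: "g \<in> carrier_mat n n" and gi: "ginv \<in> carrier_mat n n" and sym: "transpose_mat ginv = ginv"
    and pos: "positive_definite n ginv" and inv: "g * ginv = 1\<^sub>m n"
    using m by (auto simp: constant_metric_def)
  let ?A = "t \<cdot>\<^sub>m ginv" and ?B = "(1 / t) \<cdot>\<^sub>m g"
  have A: "?A \<in> carrier_mat n n" and B: "?B \<in> carrier_mat n n" using g gi by auto
  have symA: "transpose_mat ?A = ?A"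
    using sym gi by (intro eq_matI) (auto, metis carrier_matD index_transpose_mat(1))
  have formA: "v \<bullet> (?A *\<^sub>v v) = t * (v \<bullet> (ginv *\<^sub>v v))" if "v \<in> carrier_vec n" for v
    using that gi by (simp add: smult_mat_mult_vec[OF gi that])
  have formB: "v \<bullet> (?B *\<^sub>v v) = (v \<bullet> (g *\<^sub>v v)) / t" if "v \<in> carrier_vec n" for v
    using that g by (simp add: smult_mat_mult_vec[OF g that])
  have posA: "positive_definite n ?A"
    using pos t unfolding positive_definite_def by (simp add: formA)
  have AB: "?A *\<^sub>v (?B *\<^sub>v v) = v" and BA: "?B *\<^sub>v (?A *\<^sub>v v) = v" if v: "v \<in> carrier_vec n" for v
    using v t g gi constant_metric_cancel[OF m v]
    by (simp_all add: smult_mat_mult_vec[of _ n] mult_mat_vec_carrier[of _ n n] mult_mat_vec[of _ n n] smult_smult_assoc)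
  note P = poisson_gauss_lattice[OF A symA posA B AB BA]
  have prod1: "Determinant.det g * Determinant.det ginv = 1"
    using arg_cong[OF inv, of Determinant.det] by (simp add: Determinant.det_mult[OF g gi])
  have detA: "Determinant.det ?A = t ^ n * Determinant.det ginv" using gi by simp
  have "0 < t ^ n * Determinant.det ginv" using P unfolding detA by blast
  then have dgi: "Determinant.det ginv > 0" by (rule zero_less_mult_pos) (use t in simp)
  then have dg: "Determinant.det g = 1 / Determinant.det ginv" using prod1 by (simp add: field_simps)
  show "Determinant.det g > 0" using dgi dg by simp
  have eA: "exp (- (real_vec k \<bullet> (?A *\<^sub>v real_vec k))) = exp (- t * laplacian_eigenvalue n ginv k)"
    if "k \<in> carrier_vec n" for k
    using that by (simp add: formA laplacian_eigenvalue_form[OF gi])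
  show "(\<lambda>k. exp (- t * laplacian_eigenvalue n ginv k)) summable_on carrier_vec n"
    using P by (auto simp: eA cong: summable_on_cong)
  assume x: "x \<in> carrier_vec n"
  have eB: "exp (- ((x - (2 * pi) \<cdot>\<^sub>v real_vec m) \<bullet> (?B *\<^sub>v (x - (2 * pi) \<cdot>\<^sub>v real_vec m)) / 4)) =
      exp (- ((x - (2 * pi) \<cdot>\<^sub>v real_vec m) \<bullet> (g *\<^sub>v (x - (2 * pi) \<cdot>\<^sub>v real_vec m))) / (4 * t))"
    if "m \<in> carrier_vec n" for m
    using that x by (subst formB) (auto simp: mult.commute)
  show "(\<lambda>m. exp (- ((x - (2 * pi) \<cdot>\<^sub>v real_vec m) \<bullet> (g *\<^sub>v (x - (2 * pi) \<cdot>\<^sub>v real_vec m))) / (4 * t))) summable_on carrier_vec n"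
    using P x by (auto simp: eB cong: summable_on_cong)
  have "pi ^ n / Determinant.det ?A = pi ^ n * Determinant.det g / t ^ n"
    unfolding detA dg by simp
  then show "(\<Sum>\<^sub>\<infinity>k\<in>carrier_vec n. of_real (exp (- t * laplacian_eigenvalue n ginv k)) * cis (real_vec k \<bullet> x)) =
      complex_of_real (sqrt (pi ^ n * Determinant.det g / t ^ n) * (\<Sum>\<^sub>\<infinity>m\<in>carrier_vec n.
        exp (- ((x - (2 * pi) \<cdot>\<^sub>v real_vec m) \<bullet> (g *\<^sub>v (x - (2 * pi) \<cdot>\<^sub>v real_vec m))) / (4 * t))))"
    using P x by (simp only: eA eB cong: infsum_cong)
qed

lemma skew_form:
  fixes \<Theta> :: "real mat"
  assumes \<Theta>: "\<Theta> \<in> carrier_mat n n" and skew: "transpose_mat \<Theta> = - \<Theta>"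
    and x: "x \<in> carrier_vec n" and y: "y \<in> carrier_vec n"
  shows "x \<bullet> (\<Theta> *\<^sub>v y) = - (y \<bullet> (\<Theta> *\<^sub>v x))"
proof -
  have "y \<bullet> (\<Theta> *\<^sub>v x) = (transpose_mat \<Theta> *\<^sub>v y) \<bullet> x"
    using transpose_vec_mult_scalar[OF \<Theta> x y] by simp
  also have "\<dots> = - ((\<Theta> *\<^sub>v y) \<bullet> x)"
    using \<Theta> x y unfolding skew by (simp add: uminus_mult_mat_vec)
  also have "(\<Theta> *\<^sub>v y) \<bullet> x = x \<bullet> (\<Theta> *\<^sub>v y)"
    using \<Theta> x y by (intro comm_scalar_prod[of _ n]) (auto simp: mult_mat_vec_carrier[of _ n n])
  finally show ?thesis by simp
qed

text \<open>The two factors are the phases of U_k U_(-p) and of U_p U_(k - p). Skew symmetry removes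
  p . \<Theta>p and makes the remaining halves add up instead of cancelling.\<close>

lemma conjugation_phase:
  fixes \<Theta> :: "real mat"
  assumes \<Theta>: "\<Theta> \<in> carrier_mat n n" and skew: "transpose_mat \<Theta> = - \<Theta>"
    and k: "k \<in> carrier_vec n" and p: "p \<in> carrier_vec n"
  shows "exp (- (\<i> / 2) * of_real (real_vec k \<bullet> (\<Theta> *\<^sub>v real_vec (- p)))) *
    exp (- (\<i> / 2) * of_real (real_vec p \<bullet> (\<Theta> *\<^sub>v real_vec (k - p)))) =
    cis (real_vec k \<bullet> (\<Theta> *\<^sub>v real_vec p))"
proof -
  let ?k = "real_vec k" and ?p = "real_vec p"
  have kp: "?k \<in> carrier_vec n" "?p \<in> carrier_vec n" using k p by auto
  have m: "real_vec (- p) = (-1) \<cdot>\<^sub>v ?p" using p by (intro eq_vecI) auto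
  have d: "real_vec (k - p) = ?k - ?p" using k p by (intro eq_vecI) auto
  have 1: "?k \<bullet> (\<Theta> *\<^sub>v real_vec (- p)) = - (?k \<bullet> (\<Theta> *\<^sub>v ?p))"
    unfolding m using kp \<Theta> by (simp add: mult_mat_vec[of _ n n] mult_mat_vec_carrier[of _ n n])
  have "?p \<bullet> (\<Theta> *\<^sub>v real_vec (k - p)) = ?p \<bullet> (\<Theta> *\<^sub>v ?k) - ?p \<bullet> (\<Theta> *\<^sub>v ?p)"
    unfolding d using kp \<Theta>
    by (simp add: mult_minus_distrib_mat_vec[of _ n n] scalar_prod_minus_distrib[of _ n] mult_mat_vec_carrier[of _ n n])
  also have "?p \<bullet> (\<Theta> *\<^sub>v ?p) = 0" using skew_form[OF \<Theta> skew kp(2) kp(2)] by simp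
  also have "?p \<bullet> (\<Theta> *\<^sub>v ?k) = - (?k \<bullet> (\<Theta> *\<^sub>v ?p))" by (rule skew_form[OF \<Theta> skew kp(2,1)])
  finally show ?thesis unfolding 1 cis_conv_exp exp_add[symmetric] by (simp add: field_simps)
qed

lemma heat_trace:
  fixes \<Theta> g ginv :: "real mat" and l r :: coeffs
  assumes \<Theta>: "\<Theta> \<in> carrier_mat n n" and skew: "transpose_mat \<Theta> = - \<Theta>"
    and m: "constant_metric n g ginv"
    and l: "l \<in> smooth_nc_torus n" and r: "r \<in> smooth_nc_torus n" and t: "t > 0"
  shows "has_trace n (L_rep n \<Theta> l \<circ> R_rep n \<Theta> r \<circ> heat_op n ginv t)
    (of_real ((nc_norm_factor n)\<^sup>2) * (\<Sum>\<^sub>\<infinity>p\<in>carrier_vec n. l p * r (- p) *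
      (\<Sum>\<^sub>\<infinity>k\<in>carrier_vec n. of_real (exp (- t * laplacian_eigenvalue n ginv k)) * cis (real_vec k \<bullet> (\<Theta> *\<^sub>v real_vec p)))))"
proof -
  let ?A = "carrier_vec n :: int vec set" and ?T = "L_rep n \<Theta> l \<circ> R_rep n \<Theta> r \<circ> heat_op n ginv t"
  define f where "f = complex_of_real (nc_norm_factor n)"
  define h where "h k = exp (- t * laplacian_eigenvalue n ginv k)" for k
  define ph where "ph x y = exp (- (\<i> / 2) * complex_of_real (real_vec x \<bullet> (\<Theta> *\<^sub>v real_vec y)))" for x y
  have nph: "norm (ph x y) = 1" for x y by (simp add: ph_def)
  have h0: "0 \<le> h k" for k by (simp add: h_def)
  have hs: "h summable_on ?A" unfolding h_def by (rule heat_poisson(2)[OF m t])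
  have ls: "(\<lambda>p. norm (l p)) summable_on ?A" using smooth_nc_torus_summable[OF l, of 0] by simp
  have rs: "(\<lambda>p. norm (r p)) summable_on ?A" using smooth_nc_torus_summable[OF r, of 0] by simp
  obtain Cr where Cr: "\<And>k. norm (r k) \<le> Cr" using smooth_nc_torus_bounded[OF r] by blast
  \<comment> \<open>The contribution to the matrix entry (j, k) in which right multiplication
    carries k to j - p and left multiplication by U_p carries j - p to j.\<close>
  define G where "G p j k = l p * of_real (h k) * r (j - p - k) * (ph k (j - p - k) * ph p (j - p))" for p j k
  have nG: "norm (G p j k) = norm (l p) * (h k * norm (r (j - p - k)))" for p j k
    using h0 by (simp add: G_def norm_mult nph)
  define M where "M j k = f * f * (\<Sum>\<^sub>\<infinity>p\<in>?A. G p j k)" for j k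
  have "(\<lambda>(p, q). norm (l p) * (case q of (k, s) \<Rightarrow> h k * norm (r s))) summable_on ?A \<times> (?A \<times> ?A)"
    by (intro summable_on_Times_mult ls hs rs) (auto simp: h0)
  \<comment> \<open>With s = j - p - k as a variable in place of j, the modulus factors into
    \<open>norm (l p)\<close>, \<open>h k\<close> and \<open>norm (r s)\<close>, each of which is
    summable.\<close>
  moreover have "bij_betw (\<lambda>((j, k), p). (p, (k, j - p - k))) ((?A \<times> ?A) \<times> ?A) (?A \<times> (?A \<times> ?A))"
  proof (rule bij_betwI[where g = "\<lambda>(p, (k, s)). ((s + p + k, k), p)"])
    have "j - p - k + p + k = j" "s + p + k - p - k = s" if "j \<in> ?A" "p \<in> ?A" "k \<in> ?A" "s \<in> ?A" for j p k s
      using that by (auto intro!: eq_vecI)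
    then show "\<And>x. x \<in> (?A \<times> ?A) \<times> ?A \<Longrightarrow>
        (case case x of (x, xa) \<Rightarrow> (case x of (j, k) \<Rightarrow> \<lambda>p. (p, k, j - p - k)) xa of (p, k, s) \<Rightarrow> ((s + p + k, k), p)) = x"
      "\<And>y. y \<in> ?A \<times> (?A \<times> ?A) \<Longrightarrow>
        (case case y of (p, k, s) \<Rightarrow> ((s + p + k, k), p) of (x, xa) \<Rightarrow> (case x of (j, k) \<Rightarrow> \<lambda>p. (p, k, j - p - k)) xa) = y"
      by auto
  qed auto
  ultimately have "(\<lambda>x. (\<lambda>(p, q). norm (l p) * (case q of (k, s) \<Rightarrow> h k * norm (r s)))
      ((\<lambda>((j, k), p). (p, (k, j - p - k))) x)) summable_on (?A \<times> ?A) \<times> ?A"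
    by (simp only: summable_on_reindex_bij_betw)
  then have triple: "(\<lambda>(q, p). case q of (j, k) \<Rightarrow> norm (G p j k)) summable_on (?A \<times> ?A) \<times> ?A"
    by (rule summable_on_cong[THEN iffD1, rotated]) (auto simp: nG)
  have rowsG: "(\<lambda>p. norm (G p j k)) summable_on ?A" if "j \<in> ?A" "k \<in> ?A" for j k
    using summable_on_Times_rows(1)[OF triple, of "(j, k)"] that by simp
  have Mabs: "(\<lambda>(j, k). norm (M j k)) summable_on ?A \<times> ?A"
  proof (rule summable_on_norm_comparison)
    show "(\<lambda>q. norm (f * f) * (\<Sum>\<^sub>\<infinity>p\<in>?A. case q of (j, k) \<Rightarrow> norm (G p j k))) summable_on ?A \<times> ?A"
      by (rule summable_on_cmult_right[OF summable_on_Times_rows(2)[OF triple]])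
    fix q assume "q \<in> ?A \<times> ?A"
    then obtain j k where q: "q = (j, k)" "j \<in> ?A" "k \<in> ?A" by auto
    have "norm (M j k) \<le> norm (f * f) * (\<Sum>\<^sub>\<infinity>p\<in>?A. norm (G p j k))"
      unfolding M_def norm_mult[of "f * f"] by (intro mult_left_mono norm_infsum_bound rowsG q) auto
    then show "norm (case q of (j, k) \<Rightarrow> norm (M j k)) \<le> norm (f * f) * (\<Sum>\<^sub>\<infinity>p\<in>?A. case q of (j, k) \<Rightarrow> norm (G p j k))"
      by (simp add: q)
  qed
  have Teq: "?T a = (\<lambda>j. if j \<in> ?A then \<Sum>\<^sub>\<infinity>k\<in>?A. M j k * a k else 0)" if a: "a \<in> H_space n" for a
  proof
    fix j
    show "?T a j = (if j \<in> ?A then \<Sum>\<^sub>\<infinity>k\<in>?A. M j k * a k else 0)"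
    proof (cases "j \<in> ?A")
      case True
      define N where "N = sqrt (\<Sum>\<^sub>\<infinity>k\<in>?A. (norm (a k))\<^sup>2)"
      have N: "norm (a k) \<le> N" for k unfolding N_def by (rule H_space_abs_le[OF a])
      have N0: "0 \<le> N" by (simp add: N_def infsum_nonneg)
      have inner: "R_rep n \<Theta> r (heat_op n ginv t a) s = f * (\<Sum>\<^sub>\<infinity>k\<in>?A. of_real (h k) * a k * r (s - k) * ph k (s - k))"
        if "s \<in> ?A" for s
        using that by (simp add: R_rep_def nc_mult_def heat_op_def f_def h_def ph_def)
      \<comment> \<open>For fixed j, \<open>a\<close> and \<open>r\<close> need only be bounded: the
        heat factor makes the sum over k converge and \<open>l\<close> the sum over p.\<close>
      have ps: "(\<lambda>(p, k). G p j k * a k) summable_on ?A \<times> ?A"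
      proof (rule summable_on_norm_comparison)
        show "(\<lambda>q. (case q of (p, k) \<Rightarrow> norm (l p) * h k) * (Cr * N)) summable_on ?A \<times> ?A"
          by (rule summable_on_cmult_left[OF summable_on_Times_mult[OF ls hs]]) (auto simp: h0)
        fix q assume "q \<in> ?A \<times> ?A"
        have "norm (G p j k * a k) \<le> norm (l p) * h k * (Cr * N)" for p k
        proof -
          have "norm (r (j - p - k)) * norm (a k) \<le> Cr * N"
            using order_trans[OF norm_ge_zero Cr] by (intro mult_mono Cr N) auto
          then have "(norm (l p) * h k) * (norm (r (j - p - k)) * norm (a k)) \<le> norm (l p) * h k * (Cr * N)"
            using h0 by (intro mult_left_mono) auto
          then show ?thesis unfolding norm_mult nG by (simp add: mult_ac)
        qed
        then show "norm (case q of (p, k) \<Rightarrow> G p j k * a k) \<le> (case q of (p, k) \<Rightarrow> norm (l p) * h k) * (Cr * N)"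
          by (simp add: case_prod_unfold)
      qed
      have "?T a j = f * (\<Sum>\<^sub>\<infinity>p\<in>?A. l p * R_rep n \<Theta> r (heat_op n ginv t a) (j - p) * ph p (j - p))"
        using True by (simp add: L_rep_def nc_mult_def f_def ph_def)
      also have "(\<Sum>\<^sub>\<infinity>p\<in>?A. l p * R_rep n \<Theta> r (heat_op n ginv t a) (j - p) * ph p (j - p)) =
          (\<Sum>\<^sub>\<infinity>p\<in>?A. f * (\<Sum>\<^sub>\<infinity>k\<in>?A. G p j k * a k))"
      proof (rule infsum_cong)
        fix p assume p: "p \<in> ?A"
        have "l p * R_rep n \<Theta> r (heat_op n ginv t a) (j - p) * ph p (j - p) =
            f * ((l p * ph p (j - p)) * (\<Sum>\<^sub>\<infinity>k\<in>?A. of_real (h k) * a k * r (j - p - k) * ph k (j - p - k)))"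
          using p True by (subst inner) (auto simp: mult_ac)
        also have "(l p * ph p (j - p)) * (\<Sum>\<^sub>\<infinity>k\<in>?A. of_real (h k) * a k * r (j - p - k) * ph k (j - p - k)) =
            (\<Sum>\<^sub>\<infinity>k\<in>?A. G p j k * a k)"
          unfolding infsum_cmult_right'[symmetric] by (rule infsum_cong) (simp add: G_def mult_ac)
        finally show "l p * R_rep n \<Theta> r (heat_op n ginv t a) (j - p) * ph p (j - p) = f * (\<Sum>\<^sub>\<infinity>k\<in>?A. G p j k * a k)" .
      qed
      also have "\<dots> = f * (\<Sum>\<^sub>\<infinity>p\<in>?A. \<Sum>\<^sub>\<infinity>k\<in>?A. G p j k * a k)" by (rule infsum_cmult_right')
      also have "(\<Sum>\<^sub>\<infinity>p\<in>?A. \<Sum>\<^sub>\<infinity>k\<in>?A. G p j k * a k) = (\<Sum>\<^sub>\<infinity>k\<in>?A. \<Sum>\<^sub>\<infinity>p\<in>?A. G p j k * a k)"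
        by (rule infsum_swap_banach[OF ps])
      also have "f * (f * (\<Sum>\<^sub>\<infinity>k\<in>?A. \<Sum>\<^sub>\<infinity>p\<in>?A. G p j k * a k)) = (\<Sum>\<^sub>\<infinity>k\<in>?A. M j k * a k)"
        unfolding infsum_cmult_left' M_def mult.assoc infsum_cmult_right' ..
      finally show ?thesis using True by simp
    next
      case False
      then show ?thesis by (simp add: L_rep_def nc_mult_def)
    qed
  qed
  have trace: "has_trace n ?T (\<Sum>\<^sub>\<infinity>k\<in>?A. M k k)" by (rule has_trace_matrix[OF Mabs Teq])
  \<comment> \<open>On the diagonal the shift by p from the left must be undone from the right; this
    pairs the coefficients of \<open>l\<close> and \<open>r\<close> at opposite points.\<close>
  have Gkk: "G p k k = of_real (h k) * (l p * r (- p) * cis (real_vec k \<bullet> (\<Theta> *\<^sub>v real_vec p)))"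
    if "k \<in> ?A" "p \<in> ?A" for k p
  proof -
    have "k - p - k = - p" using that by (intro eq_vecI) auto
    then show ?thesis using conjugation_phase[OF \<Theta> skew that] by (simp add: G_def ph_def mult_ac)
  qed
  have ls': "(\<lambda>p. norm (l p) * Cr) summable_on ?A" by (rule summable_on_cmult_left[OF ls])
  have Cr0: "0 \<le> Cr" using order_trans[OF norm_ge_zero Cr] .
  have ds: "(\<lambda>(k, p). of_real (h k) * (l p * r (- p) * cis (real_vec k \<bullet> (\<Theta> *\<^sub>v real_vec p)))) summable_on ?A \<times> ?A"
    by (rule summable_on_norm_comparison[OF summable_on_Times_mult[OF hs ls']])
       (use h0 Cr Cr0 in \<open>auto simp: norm_mult intro!: mult_left_mono\<close>)
  have "(\<Sum>\<^sub>\<infinity>k\<in>?A. M k k) =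
      f * f * (\<Sum>\<^sub>\<infinity>k\<in>?A. \<Sum>\<^sub>\<infinity>p\<in>?A. of_real (h k) * (l p * r (- p) * cis (real_vec k \<bullet> (\<Theta> *\<^sub>v real_vec p))))"
    unfolding infsum_cmult_right'[symmetric, of "f * f"] M_def
    by (intro infsum_cong) (simp add: Gkk infsum_cmult_right' cong: infsum_cong)
  also have "(\<Sum>\<^sub>\<infinity>k\<in>?A. \<Sum>\<^sub>\<infinity>p\<in>?A. of_real (h k) * (l p * r (- p) * cis (real_vec k \<bullet> (\<Theta> *\<^sub>v real_vec p)))) =
      (\<Sum>\<^sub>\<infinity>p\<in>?A. \<Sum>\<^sub>\<infinity>k\<in>?A. of_real (h k) * (l p * r (- p) * cis (real_vec k \<bullet> (\<Theta> *\<^sub>v real_vec p))))"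
    by (rule infsum_swap_banach[OF ds])
  also have "\<dots> = (\<Sum>\<^sub>\<infinity>p\<in>?A. l p * r (- p) * (\<Sum>\<^sub>\<infinity>k\<in>?A. of_real (h k) * cis (real_vec k \<bullet> (\<Theta> *\<^sub>v real_vec p))))"
    unfolding infsum_cmult_right'[symmetric] by (intro infsum_cong) (simp add: mult_ac)
  finally show ?thesis using trace by (simp add: f_def h_def power2_eq_square)
qed

text \<open>The squared normalisation factor is (2 pi)^(-n), and (2 pi)^(-n) (pi / t)^(n / 2) = (4
  pi t)^(-n / 2).\<close>

lemma heat_prefactor:
  assumes "t > 0" "d > 0"
  shows "(nc_norm_factor n)\<^sup>2 * sqrt (pi ^ n * d / t ^ n) = sqrt d / (4 * pi * t) powr (real n / 2)"
proof -
  have 1: "(nc_norm_factor n)\<^sup>2 = 1 / (2 * pi) ^ n"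
  proof -
    have "(nc_norm_factor n)\<^sup>2 = (2 * pi) powr (- real n)"
      by (simp add: nc_norm_factor_def power2_eq_square flip: powr_add)
    then show ?thesis by (simp add: powr_minus_divide powr_realpow)
  qed
  have 2: "(4 * pi * t) powr (real n / 2) = sqrt ((4 * pi * t) ^ n)"
  proof -
    have "(4 * pi * t) powr (real n / 2) = ((4 * pi * t) powr real n) powr (1 / 2)"
      by (simp only: powr_powr times_divide_eq_right mult_1_right)
    also have "\<dots> = sqrt ((4 * pi * t) powr real n)" by (rule powr_half_sqrt) simp
    finally show ?thesis using assms by (simp add: powr_realpow)
  qed
  have "sqrt (pi ^ n * d / t ^ n) * sqrt ((4 * pi * t) ^ n) = sqrt (((2 * pi) ^ n)\<^sup>2 * d)"
  proof -
    have "pi ^ n * d / t ^ n * (4 * pi * t) ^ n = ((2 * pi) ^ n)\<^sup>2 * d"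
    proof -
      have "((2 * pi) ^ n)\<^sup>2 = ((2 * pi)\<^sup>2) ^ n" by (simp only: power_mult[symmetric] mult.commute)
      also have "(2 * pi)\<^sup>2 = 4 * pi * pi" by (simp add: power2_eq_square)
      finally show ?thesis using assms by (simp add: power_mult_distrib)
    qed
    then show ?thesis by (simp flip: real_sqrt_mult)
  qed
  also have "\<dots> = (2 * pi) ^ n * sqrt d" by (simp add: real_sqrt_mult)
  finally show ?thesis using assms unfolding 1 2 by (simp add: field_simps)
qed

text \<open>The exponential series dominates each of its terms. With u proportional to 1 / t this
  converts the Gaussian gain into an arbitrary power of t.\<close>

lemma exp_minus_le_fact_div_power:
  fixes u :: real
  assumes "u > 0"
  shows "exp (- u) \<le> fact N / u ^ N"
proof -
  have "u ^ N / fact N \<le> exp u"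
    using sum_le_suminf[OF summable_exp_generic[of u], of "{N}"] assms
    by (simp add: exp_def divide_inverse mult.commute)
  then show ?thesis using assms by (simp add: exp_minus field_simps)
qed

section \<open>The error term\<close>

text \<open>The bound \<open>D\<close> comes from Poisson summation at \<open>t = 2\<close>, read backwards: the dual sum is
  largest at \<open>x = 0\<close>.\<close>

lemma dual_sum_error:
  assumes m: "constant_metric n g ginv"
  shows "\<exists>c>0. \<exists>D\<ge>0. \<forall>t \<delta>. \<forall>x\<in>carrier_vec n. 0 < t \<longrightarrow> t \<le> 1 \<longrightarrow> 0 \<le> \<delta> \<longrightarrow>
    (\<forall>m\<in>carrier_vec n. x \<noteq> (2 * pi) \<cdot>\<^sub>v real_vec m \<longrightarrow> \<delta> \<le> eucl_norm (x - (2 * pi) \<cdot>\<^sub>v real_vec m)) \<longrightarrow>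
    \<bar>(\<Sum>\<^sub>\<infinity>m\<in>carrier_vec n. exp (- ((x - (2 * pi) \<cdot>\<^sub>v real_vec m) \<bullet> (g *\<^sub>v (x - (2 * pi) \<cdot>\<^sub>v real_vec m))) / (4 * t)))
      - (if \<exists>m\<in>carrier_vec n. x = (2 * pi) \<cdot>\<^sub>v real_vec m then 1 else 0)\<bar> \<le> D * exp (- (c * \<delta>\<^sup>2 / t))"
proof -
  have g: "g \<in> carrier_mat n n" using m by (simp add: constant_metric_def)
  obtain c where c: "c > 0" and coer: "\<And>y. y \<in> carrier_vec n \<Longrightarrow> c * (y \<bullet> y) \<le> y \<bullet> (g *\<^sub>v y)"
    using constant_metric_coercive[OF m] by blast
  let ?A = "carrier_vec n :: int vec set"
  define Y where "Y x m = (x - (2 * pi) \<cdot>\<^sub>v real_vec m) \<bullet> (g *\<^sub>v (x - (2 * pi) \<cdot>\<^sub>v real_vec m))" for x m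
  note P = heat_poisson[OF m, folded Y_def]
  define s where "s = sqrt (pi ^ n * Determinant.det g / 2 ^ n)"
  have s: "s > 0" using P(1)[of 2] by (simp add: s_def)
  define D where "D = (\<Sum>\<^sub>\<infinity>k\<in>?A. exp (- 2 * laplacian_eigenvalue n ginv k)) / s"
  have D0: "D \<ge> 0" using s by (simp add: D_def infsum_nonneg)
  have D: "(\<Sum>\<^sub>\<infinity>m\<in>?A. exp (- Y x m / (4 * 2))) \<le> D" if x: "x \<in> carrier_vec n" for x
  proof -
    let ?e = "\<lambda>k. complex_of_real (exp (- 2 * laplacian_eigenvalue n ginv k)) * cis (real_vec k \<bullet> x)"
    have ne: "norm (?e k) = exp (- 2 * laplacian_eigenvalue n ginv k)" for k by (simp add: norm_mult)
    have "s * (\<Sum>\<^sub>\<infinity>m\<in>?A. exp (- Y x m / (4 * 2))) \<le> norm (complex_of_real (s * (\<Sum>\<^sub>\<infinity>m\<in>?A. exp (- Y x m / (4 * 2)))))"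
      unfolding norm_of_real by simp
    also have "complex_of_real (s * (\<Sum>\<^sub>\<infinity>m\<in>?A. exp (- Y x m / (4 * 2)))) = infsum ?e ?A"
      unfolding s_def using P(4)[of 2 x] x by simp
    also have "norm (infsum ?e ?A) \<le> (\<Sum>\<^sub>\<infinity>k\<in>?A. norm (?e k))"
      by (rule norm_infsum_bound, unfold ne, rule P(2)) simp
    also have "\<dots> = D * s" unfolding ne D_def using s by simp
    finally show ?thesis using s by (simp add: mult.commute)
  qed
  have "\<bar>(\<Sum>\<^sub>\<infinity>m\<in>?A. exp (- Y x m / (4 * t))) - (if \<exists>m\<in>?A. x = (2 * pi) \<cdot>\<^sub>v real_vec m then 1 else 0)\<bar>
      \<le> D * exp (- (c / 8 * \<delta>\<^sup>2 / t))"
    if x: "x \<in> carrier_vec n" and t: "0 < t" "t \<le> 1" and \<delta>: "0 \<le> \<delta>"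
      and gap: "\<And>m. m \<in> ?A \<Longrightarrow> x \<noteq> (2 * pi) \<cdot>\<^sub>v real_vec m \<Longrightarrow> \<delta> \<le> eucl_norm (x - (2 * pi) \<cdot>\<^sub>v real_vec m)"
    for x t \<delta>
  proof -
    \<comment> \<open>At most one lattice point satisfies x = 2 pi m. Writing the correction as a
      sum of indicators allows a termwise comparison, in which the resonant term cancels
      exactly.\<close>
    let ?i = "\<lambda>m. if x = (2 * pi) \<cdot>\<^sub>v real_vec m then 1 else (0::real)"
    have i: "(?i has_sum (if \<exists>m\<in>?A. x = (2 * pi) \<cdot>\<^sub>v real_vec m then 1 else 0)) ?A"
    proof (cases "\<exists>m\<in>?A. x = (2 * pi) \<cdot>\<^sub>v real_vec m")
      case True
      then obtain m0 where m0: "m0 \<in> ?A" "x = (2 * pi) \<cdot>\<^sub>v real_vec m0" by blast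
      have uniq: "m = m0" if "m \<in> ?A" "x = (2 * pi) \<cdot>\<^sub>v real_vec m" for m
      proof (rule eq_vecI)
        fix j assume "j < dim_vec m0"
        then have j: "j < n" using m0 by simp
        have "x $ j = 2 * pi * of_int (m $ j)" using that(1) j unfolding that(2) by simp
        moreover have "x $ j = 2 * pi * of_int (m0 $ j)" using m0(1) j unfolding m0(2) by simp
        ultimately show "m $ j = m0 $ j" by simp
      qed (use m0 that in simp)
      have z: "?i m = 0" if "m \<in> ?A - {m0}" for m
      proof -
        have "x \<noteq> (2 * pi) \<cdot>\<^sub>v real_vec m" using uniq[of m] that by blast
        then show ?thesis by simp
      qed
      have "?i m0 = 1" using m0(2) by simp
      then have "(?i has_sum 1) {m0}" by (intro has_sum_finiteI) auto
      moreover have "{m0} - ?A = {}" using m0(1) by blast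
      ultimately have "(?i has_sum 1) ?A"
        using has_sum_cong_neutral[of ?A "{m0}" ?i ?i 1] z by blast
      then show ?thesis using True by simp
    next
      case False
      then have "(?i has_sum 0) ?A" by (intro has_sum_0) auto
      then show ?thesis using False by simp
    qed
    have Y0: "0 \<le> Y x m" if "m \<in> ?A" for m
      using coer[of "x - (2 * pi) \<cdot>\<^sub>v real_vec m"] x that c
        mult_nonneg_nonneg[OF less_imp_le[OF c] scalar_prod_self_nonneg[of "x - (2 * pi) \<cdot>\<^sub>v real_vec m"]]
      by (simp add: Y_def)
    have es: "(\<lambda>m. exp (- Y x m / (4 * t))) summable_on ?A" by (rule P(3)[OF t(1) x])
    let ?d = "\<lambda>m. exp (- Y x m / (4 * t)) - ?i m"
    have d: "(?d has_sum (\<Sum>\<^sub>\<infinity>m\<in>?A. exp (- Y x m / (4 * t))) - (if \<exists>m\<in>?A. x = (2 * pi) \<cdot>\<^sub>v real_vec m then 1 else 0)) ?A"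
      using has_sum_add[OF has_sum_infsum[OF es] has_sum_cmult_right[OF i, of "-1"]] by simp
    \<comment> \<open>The exponent Y / (4 t) is split into two halves. One gives the gap factor with
      constant c / 8; the other is at least Y / 8 because t <= 1 and keeps the series summable,
      which is the dual Gaussian at t = 2.\<close>
    have le: "norm (?d m) \<le> exp (- (c / 8 * \<delta>\<^sup>2 / t)) * exp (- Y x m / (4 * 2))" if mA: "m \<in> ?A" for m
    proof (cases "x = (2 * pi) \<cdot>\<^sub>v real_vec m")
      case True
      then have "x - (2 * pi) \<cdot>\<^sub>v real_vec m = 0\<^sub>v n" using x by simp
      then have "Y x m = 0" using g by (simp add: Y_def scalar_prod_left_zero[of _ n] mult_mat_vec_carrier[of _ n n])
      then show ?thesis using True by simp
    next
      case False
      let ?y = "x - (2 * pi) \<cdot>\<^sub>v real_vec m"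
      have y: "?y \<in> carrier_vec n" using x mA by simp
      have "\<delta>\<^sup>2 \<le> (eucl_norm ?y)\<^sup>2" using gap[OF mA False] \<delta> by (rule power_mono)
      then have "c * \<delta>\<^sup>2 \<le> c * (?y \<bullet> ?y)" unfolding eucl_norm_sq[OF y] using c by simp
      also have "\<dots> \<le> Y x m" unfolding Y_def by (rule coer[OF y])
      finally have 1: "c * \<delta>\<^sup>2 / (8 * t) \<le> Y x m / (8 * t)" using t by (simp add: divide_right_mono)
      have "Y x m / 8 \<le> Y x m / (8 * t)" using Y0[OF mA] t by (intro divide_left_mono) auto
      then have "c / 8 * \<delta>\<^sup>2 / t + Y x m / 8 \<le> Y x m / (4 * t)" using 1 by simp
      then have "exp (- Y x m / (4 * t)) \<le> exp (- (c / 8 * \<delta>\<^sup>2 / t) + - Y x m / (4 * 2))" by simp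
      then show ?thesis using False unfolding exp_add by simp
    qed
    have "norm ((\<Sum>\<^sub>\<infinity>m\<in>?A. exp (- Y x m / (4 * t))) - (if \<exists>m\<in>?A. x = (2 * pi) \<cdot>\<^sub>v real_vec m then 1 else 0))
        \<le> exp (- (c / 8 * \<delta>\<^sup>2 / t)) * (\<Sum>\<^sub>\<infinity>m\<in>?A. exp (- Y x m / (4 * 2)))"
      by (rule norm_infsum_le[OF d has_sum_cmult_right[OF has_sum_infsum] le]) (use P(3)[of 2 x] x in simp_all)
    also have "\<dots> \<le> exp (- (c / 8 * \<delta>\<^sup>2 / t)) * D" by (intro mult_left_mono D x) simp
    finally show ?thesis by (simp add: mult.commute)
  qed
  then show ?thesis unfolding Y_def[symmetric] using c D0
    by (intro exI[of _ "c / 8"] conjI exI[of _ D] allI ballI impI) auto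
qed

section \<open>Assembling the main term and the remainder\<close>

theorem mainTheorem2:
  fixes n l\<^sub>0 m\<^sub>1 m\<^sub>2 :: nat and \<Theta> g ginv :: "real mat" and l r :: coeffs
  assumes "n \<ge> 1"
    and "n = l\<^sub>0 + m\<^sub>1 + m\<^sub>2"
    and "\<Theta> \<in> carrier_mat n n" and "transpose_mat \<Theta> = - \<Theta>"
    and "block_normal_form l\<^sub>0 m\<^sub>1 m\<^sub>2 \<Theta>"
    and "diophantine n m\<^sub>2 \<Theta>"
    and "constant_metric n g ginv"
    and "l \<in> smooth_nc_torus n" and "r \<in> smooth_nc_torus n"
  shows "(\<forall>t>0. trace_class n (L_rep n \<Theta> l \<circ> R_rep n \<Theta> r \<circ> heat_op n ginv t)) \<and>
    vanishes_to_all_orders (\<lambda>t.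
      Tr n (L_rep n \<Theta> l \<circ> R_rep n \<Theta> r \<circ> heat_op n ginv t)
      - of_real (sqrt (Determinant.det g) / (4 * pi * t) powr (real n / 2))
          * (\<Sum>\<^sub>\<infinity>q \<in> Z_lattice n \<Theta>. l q * r (- q)))"
proof
  note \<Theta> = assms(3) and skew = assms(4) and m = assms(7) and l = assms(8) and r = assms(9)
  note trace = heat_trace[OF \<Theta> skew m l r]
  show "\<forall>t>0. trace_class n (L_rep n \<Theta> l \<circ> R_rep n \<Theta> r \<circ> heat_op n ginv t)"
    using trace unfolding trace_class_def by blast
  let ?A = "carrier_vec n :: int vec set"
  define \<kappa> where "\<kappa> t = sqrt (Determinant.det g) / (4 * pi * t) powr (real n / 2)" for t :: real
  define P where "P t x = (\<Sum>\<^sub>\<infinity>m\<in>?A. exp (- ((x - (2 * pi) \<cdot>\<^sub>v real_vec m) \<bullet> (g *\<^sub>v (x - (2 * pi) \<cdot>\<^sub>v real_vec m))) / (4 * t)))"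
    for t x
  \<comment> \<open>The indicator of \<open>Z_lattice\<close> on integer vectors, in the form in
    which the resonant dual term appears; it lets main term and trace be subtracted under one
    sum.\<close>
  define \<chi> where "\<chi> q = (if \<exists>m\<in>?A. \<Theta> *\<^sub>v real_vec q = (2 * pi) \<cdot>\<^sub>v real_vec m then 1 else (0::real))" for q
  define E where "E t = Tr n (L_rep n \<Theta> l \<circ> R_rep n \<Theta> r \<circ> heat_op n ginv t)
      - of_real (\<kappa> t) * (\<Sum>\<^sub>\<infinity>q \<in> Z_lattice n \<Theta>. l q * r (- q))" for t
  have \<Theta>q: "\<Theta> *\<^sub>v real_vec q \<in> carrier_vec n" if "q \<in> ?A" for q
    using \<Theta> that by (simp add: mult_mat_vec_carrier[of _ n n])
  obtain c K where c: "c > 0" and nonres: "\<And>q m. q \<in> ?A \<Longrightarrow> m \<in> ?A \<Longrightarrow> \<Theta> *\<^sub>v real_vec q \<noteq> (2 * pi) \<cdot>\<^sub>v real_vec m \<Longrightarrow>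
    c \<le> eucl_norm (\<Theta> *\<^sub>v real_vec q - (2 * pi) \<cdot>\<^sub>v real_vec m) * (1 + eucl_norm (real_vec q)) ^ K"
    using nonresonance[OF assms(2) \<Theta> assms(5,6)] by blast
  obtain c' D where c': "c' > 0" and D: "D \<ge> 0" and err: "\<And>t \<delta> x. x \<in> carrier_vec n \<Longrightarrow> 0 < t \<Longrightarrow> t \<le> 1 \<Longrightarrow> 0 \<le> \<delta> \<Longrightarrow>
    (\<forall>m\<in>?A. x \<noteq> (2 * pi) \<cdot>\<^sub>v real_vec m \<longrightarrow> \<delta> \<le> eucl_norm (x - (2 * pi) \<cdot>\<^sub>v real_vec m)) \<Longrightarrow>
    \<bar>P t x - (if \<exists>m\<in>?A. x = (2 * pi) \<cdot>\<^sub>v real_vec m then 1 else 0)\<bar> \<le> D * exp (- (c' * \<delta>\<^sup>2 / t))"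
    using dual_sum_error[OF m] unfolding P_def[symmetric] by blast
  obtain Cr where Cr: "\<And>k. norm (r k) \<le> Cr" using smooth_nc_torus_bounded[OF r] by blast
  have Cr0: "0 \<le> Cr" using order_trans[OF norm_ge_zero Cr] .
  define w where "w q = 1 + eucl_norm (real_vec q)" for q
  have w: "w q \<ge> 1" for q by (simp add: w_def)
  have lw: "(\<lambda>q. w q ^ N * norm (l q)) summable_on ?A" for N
    unfolding w_def by (rule smooth_nc_torus_summable[OF l])
  define C where "C N = D * (fact N / (c' * c\<^sup>2) ^ N) * Cr" for N
  have C0: "0 \<le> C N" for N using c c' D Cr0 by (simp add: C_def)
  have err': "\<bar>P t (\<Theta> *\<^sub>v real_vec q) - \<chi> q\<bar> \<le> D * (fact N / (c' * c\<^sup>2) ^ N) * t ^ N * w q ^ (2 * K * N)"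
    if q: "q \<in> ?A" and t: "0 < t" "t \<le> 1" for q t N
  proof -
    have wK: "w q ^ K > 0" using w[of q] by (intro zero_less_power) linarith
    \<comment> \<open>The gap guaranteed for this \<open>q\<close>. Its square in the denominator is
      the origin of the weight exponent 2 K N.\<close>
    define \<delta> where "\<delta> = c / w q ^ K"
    have \<delta>: "\<delta> > 0" using c wK by (simp add: \<delta>_def)
    have "\<bar>P t (\<Theta> *\<^sub>v real_vec q) - \<chi> q\<bar> \<le> D * exp (- (c' * \<delta>\<^sup>2 / t))"
      unfolding \<chi>_def
      by (rule err[OF \<Theta>q[OF q] t less_imp_le[OF \<delta>]]) (use nonres[OF q] wK in \<open>auto simp: \<delta>_def w_def field_simps\<close>)
    also have "\<dots> \<le> D * (fact N / (c' * \<delta>\<^sup>2 / t) ^ N)"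
      using D c' \<delta> t by (intro mult_left_mono exp_minus_le_fact_div_power) auto
    also have "(c' * \<delta>\<^sup>2 / t) ^ N = (c' * c\<^sup>2) ^ N / (t ^ N * w q ^ (2 * K * N))"
      by (simp add: \<delta>_def power_divide power_mult_distrib power_mult mult.commute[of 2 K] flip: power_mult)
    finally show ?thesis by (simp add: mult_ac)
  qed
  have E_bound: "norm (E t) \<le> \<kappa> t * t ^ N * (C N * (\<Sum>\<^sub>\<infinity>q\<in>?A. w q ^ (2 * K * N) * norm (l q)))"
    if t: "0 < t" "t \<le> 1" for t N
  proof -
    have \<kappa>: "\<kappa> t \<ge> 0" by (simp add: \<kappa>_def heat_poisson(1)[OF m t(1)] less_imp_le)
    let ?b = "\<lambda>q. t ^ N * C N * (w q ^ (2 * K * N) * norm (l q))"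
    have bs: "?b summable_on ?A" by (rule summable_on_cmult_right[OF lw])
    have le: "norm (l q * r (- q) * of_real (P t (\<Theta> *\<^sub>v real_vec q) - \<chi> q)) \<le> ?b q" if q: "q \<in> ?A" for q
    proof -
      have "norm (l q) * norm (r (- q)) * \<bar>P t (\<Theta> *\<^sub>v real_vec q) - \<chi> q\<bar> \<le>
          norm (l q) * Cr * (D * (fact N / (c' * c\<^sup>2) ^ N) * t ^ N * w q ^ (2 * K * N))"
        using Cr Cr0 by (intro mult_mono err'[OF q t]) auto
      then show ?thesis unfolding norm_mult norm_of_real C_def by (simp add: mult_ac)
    qed
    have \<chi>s: "(\<lambda>q. l q * r (- q) * of_real (\<chi> q)) summable_on ?A"
      by (rule summable_on_norm_comparison[OF summable_on_cmult_left[OF lw[of 0], of Cr]])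
         (use Cr Cr0 in \<open>auto simp: \<chi>_def norm_mult intro!: mult_left_mono\<close>)
    have ds: "(\<lambda>q. l q * r (- q) * of_real (P t (\<Theta> *\<^sub>v real_vec q) - \<chi> q)) summable_on ?A"
      by (rule summable_on_norm_comparison[OF bs le])
    have Z: "(\<Sum>\<^sub>\<infinity>q\<in>Z_lattice n \<Theta>. l q * r (- q)) = (\<Sum>\<^sub>\<infinity>q\<in>?A. l q * r (- q) * of_real (\<chi> q))"
    proof (rule infsum_cong_neutral)
      have eq: "(1 / (2 * pi)) \<cdot>\<^sub>v v = u \<longleftrightarrow> v = (2 * pi) \<cdot>\<^sub>v u" for u v :: "real vec"
        by (auto simp: smult_smult_assoc)
      have Zeq: "Z_lattice n \<Theta> = {q \<in> ?A. \<chi> q = 1}"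
        unfolding Z_lattice_def eq \<chi>_def by auto
      show "\<And>q. q \<in> ?A - Z_lattice n \<Theta> \<Longrightarrow> l q * r (- q) * of_real (\<chi> q) = 0"
        unfolding Zeq by (auto simp: \<chi>_def split: if_splits)
      show "\<And>q. q \<in> Z_lattice n \<Theta> - ?A \<Longrightarrow> l q * r (- q) = 0"
        unfolding Zeq by auto
      show "\<And>q. q \<in> Z_lattice n \<Theta> \<inter> ?A \<Longrightarrow> l q * r (- q) = l q * r (- q) * of_real (\<chi> q)"
        unfolding Zeq by auto
    qed
    have "Tr n (L_rep n \<Theta> l \<circ> R_rep n \<Theta> r \<circ> heat_op n ginv t) =
        of_real ((nc_norm_factor n)\<^sup>2) * (\<Sum>\<^sub>\<infinity>q\<in>?A. l q * r (- q) *
          of_real (sqrt (pi ^ n * Determinant.det g / t ^ n) * P t (\<Theta> *\<^sub>v real_vec q)))"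
      unfolding Tr_eqI[OF trace[OF t(1)]] P_def
      by (intro arg_cong2[of _ _ _ _ "(*)"] infsum_cong refl heat_poisson(4)[OF m t(1) \<Theta>q])
    also have "\<dots> = of_real ((nc_norm_factor n)\<^sup>2) * (\<Sum>\<^sub>\<infinity>q\<in>?A. of_real (sqrt (pi ^ n * Determinant.det g / t ^ n)) *
          (l q * r (- q) * of_real (P t (\<Theta> *\<^sub>v real_vec q))))"
      by (rule arg_cong[where f = "(*) _"], rule infsum_cong) simp
    also have "\<dots> = of_real (\<kappa> t) * (\<Sum>\<^sub>\<infinity>q\<in>?A. l q * r (- q) * of_real (P t (\<Theta> *\<^sub>v real_vec q)))"
      unfolding infsum_cmult_right' \<kappa>_def heat_prefactor[OF t(1) heat_poisson(1)[OF m t(1)], symmetric] by simp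
    also have "(\<Sum>\<^sub>\<infinity>q\<in>?A. l q * r (- q) * of_real (P t (\<Theta> *\<^sub>v real_vec q))) =
        (\<Sum>\<^sub>\<infinity>q\<in>?A. l q * r (- q) * of_real (P t (\<Theta> *\<^sub>v real_vec q) - \<chi> q) + l q * r (- q) * of_real (\<chi> q))"
      by (intro infsum_cong) (simp add: algebra_simps)
    also have "\<dots> = (\<Sum>\<^sub>\<infinity>q\<in>?A. l q * r (- q) * of_real (P t (\<Theta> *\<^sub>v real_vec q) - \<chi> q)) +
        (\<Sum>\<^sub>\<infinity>q\<in>?A. l q * r (- q) * of_real (\<chi> q))"
      by (rule infsum_add[OF ds \<chi>s])
    finally have "E t = of_real (\<kappa> t) * (\<Sum>\<^sub>\<infinity>q\<in>?A. l q * r (- q) * of_real (P t (\<Theta> *\<^sub>v real_vec q) - \<chi> q))"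
      unfolding E_def Z by (simp only: distrib_left add_diff_cancel_right')
    then have "norm (E t) = \<kappa> t * norm (\<Sum>\<^sub>\<infinity>q\<in>?A. l q * r (- q) * of_real (P t (\<Theta> *\<^sub>v real_vec q) - \<chi> q))"
      using \<kappa> by (simp add: norm_mult)
    also have "\<dots> \<le> \<kappa> t * infsum ?b ?A"
      using \<kappa> by (intro mult_left_mono norm_infsum_le[OF has_sum_infsum[OF ds] has_sum_infsum[OF bs] le])
    also have "infsum ?b ?A = t ^ N * C N * (\<Sum>\<^sub>\<infinity>q\<in>?A. w q ^ (2 * K * N) * norm (l q))"
      by (rule infsum_cmult_right')
    finally show ?thesis by (simp add: mult_ac)
  qed
  \<comment> \<open>The half-integer order n / 2 is weakened to the natural exponent n, harmless
    because the order of the remainder is at choice.\<close>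
  have \<kappa>_le: "\<kappa> t \<le> sqrt (Determinant.det g) / t ^ n" if t: "0 < t" "t \<le> 1" for t
  proof -
    have "t ^ n = t powr real n" using t by (simp add: powr_realpow)
    also have "\<dots> \<le> t powr (real n / 2)" using t by (intro powr_mono') auto
    also have "\<dots> \<le> (4 * pi * t) powr (real n / 2)"
    proof (rule powr_mono2)
      have "1 * t \<le> 4 * pi * t" using t pi_ge_two by (intro mult_right_mono) auto
      then show "t \<le> 4 * pi * t" by simp
    qed (use t in auto)
    finally show ?thesis unfolding \<kappa>_def
      using t heat_poisson(1)[OF m t(1)] by (intro divide_left_mono) auto
  qed
  have "E \<in> o[at_right 0](\<lambda>t. of_real (t ^ N))" for N :: nat
  proof (rule landau_o.smallI)
    fix e :: real assume e: "e > 0"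
    \<comment> \<open>The n compensates the bound t^(-n) on the prefactor; the extra 1 leaves a
      factor t that beats the constant \<open>B\<close>, giving little-o instead of big-O.\<close>
    define N' where "N' = n + N + 1"
    define B where "B = sqrt (Determinant.det g) * (C N' * (\<Sum>\<^sub>\<infinity>q\<in>?A. w q ^ (2 * K * N') * norm (l q)))"
    have S0: "0 \<le> C N' * (\<Sum>\<^sub>\<infinity>q\<in>?A. w q ^ (2 * K * N') * norm (l q))"
      using C0 w by (intro mult_nonneg_nonneg infsum_nonneg) (auto intro: order_trans[of 0 1] zero_le_power)
    have B0: "0 \<le> B" unfolding B_def using S0 heat_poisson(1)[OF m, of 1] by simp
    have "norm (E t) \<le> e * norm (complex_of_real (t ^ N))" if t: "0 < t" "t < min 1 (e / (B + 1))" for t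
    proof -
      have t1: "t \<le> 1" using t by simp
      have "norm (E t) \<le> \<kappa> t * t ^ N' * (C N' * (\<Sum>\<^sub>\<infinity>q\<in>?A. w q ^ (2 * K * N') * norm (l q)))"
        by (rule E_bound[OF t(1) t1])
      also have "\<dots> \<le> sqrt (Determinant.det g) / t ^ n * t ^ N' * (C N' * (\<Sum>\<^sub>\<infinity>q\<in>?A. w q ^ (2 * K * N') * norm (l q)))"
        using \<kappa>_le[OF t(1) t1] t S0 by (intro mult_right_mono) auto
      also have "\<dots> = (B * t) * t ^ N" using t by (simp add: B_def N'_def power_add)
      also have "\<dots> \<le> e * t ^ N"
      proof (rule mult_right_mono)
        have "B * t \<le> (B + 1) * t" using t by (simp add: algebra_simps)
        also have "\<dots> \<le> e" using t B0 by (simp add: field_simps)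
        finally show "B * t \<le> e" .
      qed (use t in simp)
      finally show ?thesis using t by (simp add: norm_power)
    qed
    then show "\<forall>\<^sub>F t in at_right 0. norm (E t) \<le> e * norm (complex_of_real (t ^ N))"
      unfolding eventually_at_right_field using e B0 by (intro exI[of _ "min 1 (e / (B + 1))"]) auto
  qed
  then show "vanishes_to_all_orders (\<lambda>t.
      Tr n (L_rep n \<Theta> l \<circ> R_rep n \<Theta> r \<circ> heat_op n ginv t)
      - of_real (sqrt (Determinant.det g) / (4 * pi * t) powr (real n / 2))
          * (\<Sum>\<^sub>\<infinity>q \<in> Z_lattice n \<Theta>. l q * r (- q)))"
    unfolding vanishes_to_all_orders_def E_def[abs_def] \<kappa>_def by blast
qed

end
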